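(* Let $k$ be an algebraically closed field of characteristic zero, and write $\zeta_n=e^{2\pi i/n}$ for a primitive $n$-th root of unity. Let $X\subset\mathbb{P}^4$ be a cubic threefold over $k$ whose singular locus consists of exactly two nodes, with an action of a cyclic group $G=\langle\iota\rangle\subseteq\mathrm{Aut}(X)$ not fixing any node. Then, up to a change of coordinates, $X$ is given by $$x_1x_2x_3+x_1q_1+x_2q_2+f_3=0,$$ for $q_1,q_2\in k[x_4,x_5]$ (forms of degree 2) and $f_3\in k[x_3,x_4,x_5]$ (a form of degree 3) that can be described together with $\iota$ by one of the following: ($C_2$) $\iota(x_1,x_2,x_3,x_4,x_5)=(x_2,x_1,x_3,x_4,x_5)$, $q_1=q_2=x_4x_5$, $f_3\in k[x_3,x_4,x_5]$; ($C_2'$) $\iota(x_1,x_2,x_3,x_4,x_5)=(-x_2,-x_1,x_3,x_4,-x_5)$, $q_1=a_1x_4^2+x_4x_5+a_3x_5^2$, $q_2=-a_1x_4^2+x_4x_5-a_3x_5^2$, $f_3=c_1x_3^3+d_1x_3^2x_4+x_3(e_1x_4^2+e_3x_5^2)+r_1x_4^3+r_3x_4x_5^2$, for some $a_1,a_3,c_1,d_1,e_1,e_3,r_1,r_3\in k$; ($C_2''$) $\iota(x_1,x_2,x_3,x_4,x_5)=(x_2,x_1,x_3,x_4,-x_5)$, $q_1=q_2=x_4^2+x_5^2$, $f_3=c_1x_3^3+d_1x_3^2x_4+x_3(e_1x_4^2+e_3x_5^2)+r_1x_4^3+r_3x_4x_5^2$, for some $c_1,d_1,e_1,e_3,r_1,r_3\in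 k$; ($C_4$) $\iota(x_1,x_2,x_3,x_4,x_5)=(x_2,x_1,x_3,\zeta_4x_4,-\zeta_4x_5)$, $q_1=a_1x_4^2+x_4x_5+a_3x_5^2$, $q_2=-a_1x_4^2+x_4x_5-a_3x_5^2$, $f_3=x_3^3+e_2x_3x_4x_5$, for some $a_1,a_3,e_2\in k$; ($C_4'$) $\iota(x_1,x_2,x_3,x_4,x_5)=(x_2,x_1,x_3,x_4,\zeta_4x_5)$, $q_1=x_4^2-x_5^2$, $q_2=x_4^2+x_5^2$, $f_3\in k[x_3,x_4]$; ($C_4''$) $\iota(x_1,x_2,x_3,x_4,x_5)=(x_2,x_1,x_3,-x_4,\zeta_4x_5)$, $q_1=x_4^2-x_5^2$, $q_2=x_4^2+x_5^2$, $f_3=x_3^3+e_1x_3x_4^2+r_3x_4x_5^2$, for some $e_1,r_3\in k$; ($C_6$) $\iota(x_1,x_2,x_3,x_4,x_5)=(x_2,x_1,x_3,\zeta_3x_4,\zeta_3^2x_5)$, $q_1=q_2=x_4x_5$, $f_3=x_3^3+e_2x_3x_4x_5+r_1(x_4^3+x_5^3)$, for some $e_2,r_1\in k$; ($C_6'$) $\iota(x_1,x_2,x_3,x_4,x_5)=(\zeta_6x_2,\zeta_6x_1,x_3,\zeta_6^5x_4,\zeta_6^2x_5)$, $q_1=a_1x_4^2+x_4x_5+a_3x_5^2$, $q_2=-a_1x_4^2+x_4x_5-a_3x_5^2$, $f_3=x_3^2x_5$, for some $a_1,a_3\in k$; ($C_{12}$) $\iota(x_1,x_2,x_3,x_4,x_5)=(\zeta_{12}^8x_2,\zeta_{12}^8x_1,x_3,\zeta_{12}^4x_4,\zeta_{12}x_5)$,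 $q_1=x_4^2-x_5^2$, $q_2=x_4^2+x_5^2$, $f_3=x_3^2x_4$.
   Context: A node is an ordinary double point. Automorphisms of $X$ are restrictions of projective linear transformations of $\mathbb{P}^4$, written here through their action on the homogeneous coordinates. *)

theory Defs
  imports
    "HOL-Analysis.Analysis"
    "HOL-Algebra.Generated_Groups"
    "HOL-Library.Poly_Mapping"
    "HOL-Computational_Algebra.Polynomial"
begin

section \<open>Polynomials in five variables\<close>

text \<open>
  A polynomial in \<open>k[x\<^sub>1, \<dots>, x\<^sub>5]\<close> is a finitely supported map from exponent vectors to
  coefficients; its ring structure is the convolution structure of \<^theory>\<open>HOL-Library.Poly_Mapping\<close>.
  The index type \<open>5\<close> has the elements 1, 2, 3, 4 and 5 (the last of which equals 0).
\<close>

type_synonym 'k poly5 = "(5 \<Rightarrow>\<^sub>0 nat) \<Rightarrow>\<^sub>0 'k"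

definition Const :: "'k \<Rightarrow> 'k::comm_ring_1 poly5" where
  "Const c = Poly_Mapping.single 0 c"

definition Var :: "5 \<Rightarrow> 'k::comm_ring_1 poly5" where
  "Var i = Poly_Mapping.single (Poly_Mapping.single i 1) 1"

definition vars :: "'k::comm_ring_1 poly5 \<Rightarrow> 5 set" where
  "vars F = (\<Union>\<alpha>\<in>Poly_Mapping.keys F. Poly_Mapping.keys \<alpha>)"

text \<open>The zero polynomial is a form of every degree.\<close>

definition is_form :: "nat \<Rightarrow> 'k::comm_ring_1 poly5 \<Rightarrow> bool" where
  "is_form d F \<longleftrightarrow> (\<forall>\<alpha>\<in>Poly_Mapping.keys F. (\<Sum>i\<in>UNIV. Poly_Mapping.lookup \<alpha> i) = d)"

definition eval :: "'k::comm_ring_1 poly5 \<Rightarrow> 'k^5 \<Rightarrow> 'k" where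
  "eval F v = (\<Sum>\<alpha>\<in>Poly_Mapping.keys F.
     Poly_Mapping.lookup F \<alpha> * (\<Prod>i\<in>UNIV. (v $ i) ^ Poly_Mapping.lookup \<alpha> i))"

text \<open>If \<open>\<alpha>\<^sub>i = 0\<close>, the (truncated) exponent is meaningless, but the coefficient vanishes.\<close>

definition partial :: "5 \<Rightarrow> 'k::comm_ring_1 poly5 \<Rightarrow> 'k poly5" where
  "partial i F = (\<Sum>\<alpha>\<in>Poly_Mapping.keys F.
     Poly_Mapping.single (\<alpha> - Poly_Mapping.single i 1)
       (of_nat (Poly_Mapping.lookup \<alpha> i) * Poly_Mapping.lookup F \<alpha>))"

section \<open>Projective space, singular points and nodes\<close>

text \<open>
  The point of \<open>\<P>\<^sup>4\<close> with homogeneous coordinates \<open>v \<noteq> 0\<close> is the set of all its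
  coordinate vectors. A form \<open>F\<close> stands for the hypersurface (scheme) \<open>F = 0\<close>.
\<close>

definition proj_point :: "'k::field^5 \<Rightarrow> ('k^5) set" where
  "proj_point v = {c *s v | c. c \<noteq> 0}"

definition sing_locus :: "'k::field poly5 \<Rightarrow> ('k^5) set set" where
  "sing_locus F = {proj_point v | v. v \<noteq> 0 \<and> eval F v = 0 \<and> (\<forall>i. eval (partial i F) v = 0)}"

text \<open>
  A node (ordinary double point) is a singular point at which a local equation has a
  nondegenerate Hessian. With \<open>v\<close> scaled such that \<open>v\<^sub>i = 1\<close>, the equation of \<open>F = 0\<close> in the
  affine chart \<open>x\<^sub>i = 1\<close> has as Hessian form at \<open>v\<close> the restriction of \<open>hessian F v\<close> to the
  tangent directions \<open>u\<^sub>i = 0\<close> of the chart.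
\<close>

definition hessian :: "'k::field poly5 \<Rightarrow> 'k^5 \<Rightarrow> 'k^5 \<Rightarrow> 'k^5 \<Rightarrow> 'k" where
  "hessian F v u w = (\<Sum>j\<in>UNIV. \<Sum>l\<in>UNIV. eval (partial j (partial l F)) v * u $ j * w $ l)"

definition is_node :: "'k::field poly5 \<Rightarrow> ('k^5) set \<Rightarrow> bool" where
  "is_node F p \<longleftrightarrow> p \<in> sing_locus F \<and>
     (\<exists>v\<in>p. \<exists>i. v $ i = 1 \<and>
        (\<forall>u. u $ i = 0 \<and> (\<forall>w. w $ i = 0 \<longrightarrow> hessian F v u w = 0) \<longrightarrow> u = 0))"

section \<open>Projective linear transformations\<close>

definition GL5 :: "('k::field^5^5) monoid" where
  "GL5 = \<lparr>carrier = {A. invertible A}, mult = (**), one = mat 1\<rparr>"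

definition scalars5 :: "('k::field^5^5) set" where
  "scalars5 = {mat c | c. c \<noteq> 0}"

definition PGL5 :: "(('k::field^5^5) set) monoid" where
  "PGL5 = GL5 Mod scalars5"

definition proj_class :: "'k::field^5^5 \<Rightarrow> ('k^5^5) set" where
  "proj_class A = scalars5 #>\<^bsub>GL5\<^esub> A"

definition act :: "('k::field^5^5) set \<Rightarrow> ('k^5) set \<Rightarrow> ('k^5) set" where
  "act g p = {A *v v | A v. A \<in> g \<and> v \<in> p}"

text \<open>
  The projective linear transformations mapping the hypersurface \<open>F = 0\<close> to itself.
  Identities of polynomials are tested on values, which is no loss over an infinite field.
\<close>

definition Aut :: "'k::field poly5 \<Rightarrow> ('k^5^5) set set" where
  "Aut F = {g \<in> carrier PGL5. \<forall>A\<in>g. \<exists>c. c \<noteq> 0 \<and> (\<forall>v. eval F (A *v v) = c * eval F v)}"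

section \<open>The normal forms\<close>

definition primitive_root_of_unity :: "nat \<Rightarrow> 'k::field \<Rightarrow> bool" where
  "primitive_root_of_unity n z \<longleftrightarrow>
     n > 0 \<and> z ^ n = 1 \<and> (\<forall>m. 0 < m \<and> m < n \<longrightarrow> z ^ m \<noteq> 1)"

text \<open>
  The list of data \<open>(\<iota>, q\<^sub>1, q\<^sub>2, f\<^sub>3)\<close>, relative to a choice \<open>\<zeta> n\<close> of primitive \<open>n\<close>-th roots
  of unity. Here \<open>\<iota>\<close> is a linear map of coordinate vectors.
\<close>

inductive normal_form ::
  "(nat \<Rightarrow> 'k::field) \<Rightarrow> ('k^5 \<Rightarrow> 'k^5) \<Rightarrow> 'k poly5 \<Rightarrow> 'k poly5 \<Rightarrow> 'k poly5 \<Rightarrow> bool"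
  for \<zeta> :: "nat \<Rightarrow> 'k"
where
  C2: "is_form 3 f3 \<Longrightarrow> vars f3 \<subseteq> {3, 4, 5} \<Longrightarrow>
    normal_form \<zeta>
      (\<lambda>x. vector [x$2, x$1, x$3, x$4, x$5])
      (Var 4 * Var 5)
      (Var 4 * Var 5)
      f3"
| C2': "normal_form \<zeta>
      (\<lambda>x. vector [- x$2, - x$1, x$3, x$4, - x$5])
      (Const a1 * Var 4 ^ 2 + Var 4 * Var 5 + Const a3 * Var 5 ^ 2)
      (- Const a1 * Var 4 ^ 2 + Var 4 * Var 5 - Const a3 * Var 5 ^ 2)
      (Const c1 * Var 3 ^ 3 + Const d1 * Var 3 ^ 2 * Var 4
        + Var 3 * (Const e1 * Var 4 ^ 2 + Const e3 * Var 5 ^ 2)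
        + Const r1 * Var 4 ^ 3 + Const r3 * Var 4 * Var 5 ^ 2)"
| C2'': "normal_form \<zeta>
      (\<lambda>x. vector [x$2, x$1, x$3, x$4, - x$5])
      (Var 4 ^ 2 + Var 5 ^ 2)
      (Var 4 ^ 2 + Var 5 ^ 2)
      (Const c1 * Var 3 ^ 3 + Const d1 * Var 3 ^ 2 * Var 4
        + Var 3 * (Const e1 * Var 4 ^ 2 + Const e3 * Var 5 ^ 2)
        + Const r1 * Var 4 ^ 3 + Const r3 * Var 4 * Var 5 ^ 2)"
| C4: "normal_form \<zeta>
      (\<lambda>x. vector [x$2, x$1, x$3, \<zeta> 4 * x$4, - \<zeta> 4 * x$5])
      (Const a1 * Var 4 ^ 2 + Var 4 * Var 5 + Const a3 * Var 5 ^ 2)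
      (- Const a1 * Var 4 ^ 2 + Var 4 * Var 5 - Const a3 * Var 5 ^ 2)
      (Var 3 ^ 3 + Const e2 * Var 3 * Var 4 * Var 5)"
| C4': "is_form 3 f3 \<Longrightarrow> vars f3 \<subseteq> {3, 4} \<Longrightarrow>
    normal_form \<zeta>
      (\<lambda>x. vector [x$2, x$1, x$3, x$4, \<zeta> 4 * x$5])
      (Var 4 ^ 2 - Var 5 ^ 2)
      (Var 4 ^ 2 + Var 5 ^ 2)
      f3"
| C4'': "normal_form \<zeta>
      (\<lambda>x. vector [x$2, x$1, x$3, - x$4, \<zeta> 4 * x$5])
      (Var 4 ^ 2 - Var 5 ^ 2)
      (Var 4 ^ 2 + Var 5 ^ 2)
      (Var 3 ^ 3 + Const e1 * Var 3 * Var 4 ^ 2 + Const r3 * Var 4 * Var 5 ^ 2)"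
| C6: "normal_form \<zeta>
      (\<lambda>x. vector [x$2, x$1, x$3, \<zeta> 3 * x$4, \<zeta> 3 ^ 2 * x$5])
      (Var 4 * Var 5)
      (Var 4 * Var 5)
      (Var 3 ^ 3 + Const e2 * Var 3 * Var 4 * Var 5 + Const r1 * (Var 4 ^ 3 + Var 5 ^ 3))"
| C6': "normal_form \<zeta>
      (\<lambda>x. vector [\<zeta> 6 * x$2, \<zeta> 6 * x$1, x$3, \<zeta> 6 ^ 5 * x$4, \<zeta> 6 ^ 2 * x$5])
      (Const a1 * Var 4 ^ 2 + Var 4 * Var 5 + Const a3 * Var 5 ^ 2)
      (- Const a1 * Var 4 ^ 2 + Var 4 * Var 5 - Const a3 * Var 5 ^ 2)
      (Var 3 ^ 2 * Var 5)"
| C12: "normal_form \<zeta>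
      (\<lambda>x. vector [\<zeta> 12 ^ 8 * x$2, \<zeta> 12 ^ 8 * x$1, x$3, \<zeta> 12 ^ 4 * x$4, \<zeta> 12 * x$5])
      (Var 4 ^ 2 - Var 5 ^ 2)
      (Var 4 ^ 2 + Var 5 ^ 2)
      (Var 3 ^ 2 * Var 4)"

text \<open>
  After the change of coordinates \<open>x = P y\<close>, the hypersurface \<open>F = 0\<close> and its automorphism \<open>g\<close>
  are one of the pairs in the list.
\<close>

definition has_normal_form ::
  "(nat \<Rightarrow> 'k::field) \<Rightarrow> 'k poly5 \<Rightarrow> ('k^5^5) set \<Rightarrow> bool" where
  "has_normal_form \<zeta> F g \<longleftrightarrow>
     (\<exists>P \<iota> q1 q2 f3. invertible P \<and> normal_form \<zeta> \<iota> q1 q2 f3 \<and>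
        (\<exists>c. c \<noteq> 0 \<and> (\<forall>y. eval F (P *v y) =
           c * eval (Var 1 * Var 2 * Var 3 + Var 1 * q1 + Var 2 * q2 + f3) y)) \<and>
        g = proj_class (P ** matrix \<iota> ** matrix_inv P))"

end

theory Submission
  imports Defs
begin

text \<open>
  Polarize the cubic: \<open>F(v) = T(v, v, v)\<close> with \<open>T\<close> symmetric and trilinear. The nodes are vectors
  \<open>p1\<close>, \<open>p2\<close> with \<open>T(pi, pi, _) = 0\<close>, and the radical of the bilinear form \<open>T(pi, _, _)\<close> is the line
  of \<open>pi\<close>. The automorphism interchanges them. On the kernel of \<open>T(p1, p2, _)\<close> modulo \<open>p1, p2\<close>, a
  plane, it multiplies the sum and the difference of the two (suitably scaled) nondegenerate forms
  \<open>q1, q2\<close> by \<open>\<plusminus>\<alpha>\<close>. This forbids a Jordan block there, and comparing coefficients of the cubic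
  forbids one in the whole quotient. So there are eigenvectors \<open>p3, p4, p5\<close> which, with the nodes, bring
  \<open>F\<close> into the shape \<open>x1 x2 x3 + x1 q1 + x2 q2 + f3\<close>.

  The invariance of \<open>q1, q2\<close> leaves few relations between the eigenvalues. That \<open>p3\<close> is not singular
  gives a monomial of \<open>f3\<close> divisible by the square of \<open>x3\<close>, whose invariance makes the eigenvalues roots
  of unity. When \<open>q1 = q2\<close>, one also needs that \<open>f3\<close> is nonzero at the common zeros of \<open>q1\<close> and
  \<open>q2\<close>: otherwise there is a third singular point above such a zero. Since \<open>\<iota>\<close> is a swap followed by a
  diagonal map, an odd power of \<open>\<iota>\<close> replaces its roots of unity by any others of the same order.
\<close>

section \<open>Polynomials in five variables\<close>

text \<open>A matrix lifting the automorphism and vectors representing the nodes are each determined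
  only up to a factor. These three factors are spent on making both nodes acquire the same factor
  \<alpha> in the exchange and T the multiplier \<alpha>^2. Then the linear form T(p1, p2, _) is
  invariant, which gives p3 the eigenvalue 1, and only \<alpha> and the eigenvalues \<mu>, \<nu> of
  p4 and p5 remain unknown. A last freedom is to multiply the nodes by j and -j with j^2 = -1: this
  replaces \<alpha> by -\<alpha> and reverses the sign between q1 and q2, so that one pair of
  coefficients may be assumed equal.

  The roots of unity that arise are those which the matrix happens to have as eigenvalues. Hence the
  conclusion has two versions: the given roots of unity with some generator, or the given generator
  with some choice of roots of unity.\<close>

lemma UNIV_5: "UNIV = {1, 2, 3, 4, 5::5}"
proof -
  have "card {1, 2, 3, 4, 5::5} = CARD(5)"
    by simp
  then show ?thesis
    by (metis card_subset_eq finite_class.finite_UNIV subset_UNIV)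
qed

lemma sum_5: "sum f (UNIV :: 5 set) = f 1 + f 2 + f 3 + f 4 + f 5"
  unfolding UNIV_5 by (simp add: add.assoc)

lemma forall_5: "(\<forall>i::5. P i) \<longleftrightarrow> P 1 \<and> P 2 \<and> P 3 \<and> P 4 \<and> P 5"
proof -
  have "(\<forall>i. P i) \<longleftrightarrow> (\<forall>i\<in>{1, 2, 3, 4, 5::5}. P i)"
    unfolding UNIV_5[symmetric] by simp
  then show ?thesis
    by simp
qed

lemma vector_5 [simp]:
  "(vector [a, b, c, d, e] :: 'a::zero^5) $ 1 = a"
  "(vector [a, b, c, d, e] :: 'a::zero^5) $ 2 = b"
  "(vector [a, b, c, d, e] :: 'a::zero^5) $ 3 = c"
  "(vector [a, b, c, d, e] :: 'a::zero^5) $ 4 = d"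
  "(vector [a, b, c, d, e] :: 'a::zero^5) $ 5 = e"
  unfolding vector_def by simp_all

definition mono_val :: "(5 \<Rightarrow>\<^sub>0 nat) \<Rightarrow> 'k::comm_ring_1^5 \<Rightarrow> 'k" where
  "mono_val \<alpha> v = (\<Prod>i\<in>UNIV. (v $ i) ^ Poly_Mapping.lookup \<alpha> i)"

lemma mono_val_add: "mono_val (\<alpha> + \<beta>) v = mono_val \<alpha> v * mono_val \<beta> v"
  by (simp add: mono_val_def lookup_add power_add prod.distrib)

lemma mono_val_0: "mono_val 0 v = 1"
  by (simp add: mono_val_def)

lemma mono_val_single: "mono_val (Poly_Mapping.single i n) v = (v $ i) ^ n"
proof -
  have "mono_val (Poly_Mapping.single i n) v = (\<Prod>j\<in>UNIV. if i = j then (v $ j) ^ n else 1)"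
    unfolding mono_val_def by (intro prod.cong refl) (auto simp: lookup_single when_def)
  then show ?thesis
    by simp
qed

lemma eval_eq: "eval F v = (\<Sum>\<alpha>\<in>Poly_Mapping.keys F. Poly_Mapping.lookup F \<alpha> * mono_val \<alpha> v)"
  by (simp add: eval_def mono_val_def)

lemma eval_superset:
  assumes "finite S" "Poly_Mapping.keys F \<subseteq> S"
  shows "eval F v = (\<Sum>\<alpha>\<in>S. Poly_Mapping.lookup F \<alpha> * mono_val \<alpha> v)"
  unfolding eval_eq using assms
  by (intro sum.mono_neutral_left) (auto simp: in_keys_iff)

lemma eval_add [simp]: "eval (F + G) v = eval F v + eval G v"
proof -
  let ?S = "Poly_Mapping.keys F \<union> Poly_Mapping.keys G"
  have "Poly_Mapping.keys (F + G) \<subseteq> ?S"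
    by (rule Poly_Mapping.keys_add)
  then show ?thesis
    by (simp add: eval_superset[of ?S] lookup_add algebra_simps sum.distrib)
qed

lemma eval_0 [simp]: "eval 0 v = 0"
  by (simp add: eval_def)

lemma eval_single: "eval (Poly_Mapping.single \<alpha> c) v = c * mono_val \<alpha> v"
  by (simp add: eval_eq)

lemma eval_sum: "eval (sum f S) v = (\<Sum>x\<in>S. eval (f x) v)"
  by (induction S rule: infinite_finite_induct) auto

lemma eval_uminus [simp]: "eval (- F) v = - eval F v"
  using eval_add[of F "- F" v] by (simp add: eq_neg_iff_add_eq_0 add.commute)

lemma eval_diff [simp]: "eval (F - G) v = eval F v - eval G v"
  using eval_add[of F "- G" v] by simp

lemma poly5_sum_single:
  fixes F :: "'k::comm_ring_1 poly5"
  shows "F = (\<Sum>\<alpha>\<in>Poly_Mapping.keys F. Poly_Mapping.single \<alpha> (Poly_Mapping.lookup F \<alpha>))"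
proof (rule poly_mapping_eqI)
  fix \<beta>
  have "(\<Sum>\<alpha>\<in>Poly_Mapping.keys F. Poly_Mapping.lookup (Poly_Mapping.single \<alpha> (Poly_Mapping.lookup F \<alpha>)) \<beta>)
      = (\<Sum>\<alpha>\<in>Poly_Mapping.keys F. if \<beta> = \<alpha> then Poly_Mapping.lookup F \<alpha> else 0)"
    by (intro sum.cong refl) (auto simp: lookup_single when_def)
  then show "Poly_Mapping.lookup F \<beta> = Poly_Mapping.lookup
      (\<Sum>\<alpha>\<in>Poly_Mapping.keys F. Poly_Mapping.single \<alpha> (Poly_Mapping.lookup F \<alpha>)) \<beta>"
    by (auto simp: lookup_sum in_keys_iff)
qed

text \<open>Single terms generate the polynomials additively, so identities between additive
  operations such as evaluation and differentiation need only be checked on terms.\<close>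

lemma poly5_induct [case_names zero add single]:
  fixes F :: "'k::comm_ring_1 poly5"
  assumes "P 0" "\<And>F G. P F \<Longrightarrow> P G \<Longrightarrow> P (F + G)" "\<And>\<alpha> c. P (Poly_Mapping.single \<alpha> c)"
  shows "P F"
proof -
  have "P (\<Sum>\<alpha>\<in>S. Poly_Mapping.single \<alpha> (Poly_Mapping.lookup F \<alpha>))" for S
    by (induction S rule: infinite_finite_induct) (auto intro: assms)
  then show ?thesis
    by (subst poly5_sum_single)
qed

lemma eval_mult [simp]: "eval (F * G) v = eval F v * eval G v"
proof (induction F rule: poly5_induct)
  case (single \<alpha> c)
  show ?case
    by (induction G rule: poly5_induct)
      (simp_all add: mult_single eval_single mono_val_add algebra_simps)
qed (simp_all add: algebra_simps)

lemma eval_Const [simp]: "eval (Const c) v = c"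
  by (simp add: Const_def eval_single mono_val_0)

lemma eval_Var [simp]: "eval (Var i) v = v $ i"
  by (simp add: Var_def eval_single mono_val_single)

lemma eval_power [simp]: "eval (F ^ n) v = eval F v ^ n"
proof (induction n)
  case 0
  have "(1 :: 'a poly5) = Const 1"
    by (simp add: Const_def)
  then show ?case
    by (metis eval_Const power_0)
qed simp

lemma is_form_add: "is_form d F \<Longrightarrow> is_form d G \<Longrightarrow> is_form d (F + G)"
  unfolding is_form_def using Poly_Mapping.keys_add[of F G] by auto

lemma is_form_mult: "is_form d F \<Longrightarrow> is_form e G \<Longrightarrow> is_form (d + e) (F * G)"
  unfolding is_form_def using keys_mult[of F G] by (fastforce simp: lookup_add sum.distrib)

lemma is_form_Const: "is_form 0 (Const c)"
  by (auto simp: is_form_def Const_def split: if_splits)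

lemma is_form_Var: "is_form 1 (Var i)"
  by (auto simp: is_form_def Var_def lookup_single when_def split: if_splits)

lemma is_form_Const_Var3: "is_form 3 (Const c * Var i * Var j * Var l)"
  using is_form_mult[OF is_form_mult[OF is_form_mult[OF is_form_Const is_form_Var] is_form_Var] is_form_Var]
  by (simp add: numeral_3_eq_3)

lemma vars_add: "vars F \<subseteq> S \<Longrightarrow> vars G \<subseteq> S \<Longrightarrow> vars (F + G) \<subseteq> S"
  unfolding vars_def UN_subset_iff
proof
  fix \<gamma> assume F: "\<forall>\<alpha>\<in>Poly_Mapping.keys F. Poly_Mapping.keys \<alpha> \<subseteq> S"
    and G: "\<forall>\<alpha>\<in>Poly_Mapping.keys G. Poly_Mapping.keys \<alpha> \<subseteq> S"
    and "\<gamma> \<in> Poly_Mapping.keys (F + G)"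
  then have "\<gamma> \<in> Poly_Mapping.keys F \<or> \<gamma> \<in> Poly_Mapping.keys G"
    using Poly_Mapping.keys_add[of F G] by auto
  then show "Poly_Mapping.keys \<gamma> \<subseteq> S"
    using F G by auto
qed

lemma vars_mult: "vars F \<subseteq> S \<Longrightarrow> vars G \<subseteq> S \<Longrightarrow> vars (F * G) \<subseteq> S"
  unfolding vars_def UN_subset_iff
proof
  fix \<gamma> assume F: "\<forall>\<alpha>\<in>Poly_Mapping.keys F. Poly_Mapping.keys \<alpha> \<subseteq> S"
    and G: "\<forall>\<alpha>\<in>Poly_Mapping.keys G. Poly_Mapping.keys \<alpha> \<subseteq> S"
    and "\<gamma> \<in> Poly_Mapping.keys (F * G)"
  then obtain \<alpha> \<beta> where "\<gamma> = \<alpha> + \<beta>" "\<alpha> \<in> Poly_Mapping.keys F" "\<beta> \<in> Poly_Mapping.keys G"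
    using keys_mult by blast
  then show "Poly_Mapping.keys \<gamma> \<subseteq> S"
    using F G Poly_Mapping.keys_add[of \<alpha> \<beta>] by (meson Un_least order_trans)
qed

lemma vars_Const: "vars (Const c) \<subseteq> S"
  by (auto simp: vars_def Const_def split: if_splits)

lemma vars_Var: "i \<in> S \<Longrightarrow> vars (Var i) \<subseteq> S"
  by (auto simp: vars_def Var_def split: if_splits)

section \<open>Euler's formula and the polarization of a cubic form\<close>

lemma partial_superset:
  assumes "finite S" "Poly_Mapping.keys F \<subseteq> S"
  shows "partial i F = (\<Sum>\<alpha>\<in>S. Poly_Mapping.single (\<alpha> - Poly_Mapping.single i 1)
       (of_nat (Poly_Mapping.lookup \<alpha> i) * Poly_Mapping.lookup F \<alpha>))"
  unfolding partial_def using assms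
  by (intro sum.mono_neutral_left) (auto simp: in_keys_iff)

lemma partial_add: "partial i (F + G) = partial i F + partial i G"
proof -
  let ?S = "Poly_Mapping.keys F \<union> Poly_Mapping.keys G"
  have "Poly_Mapping.keys (F + G) \<subseteq> ?S"
    by (rule Poly_Mapping.keys_add)
  then show ?thesis
    by (simp add: partial_superset[of ?S] lookup_add algebra_simps sum.distrib single_add)
qed

lemma partial_0: "partial i 0 = 0"
  by (simp add: partial_def)

lemma partial_single: "partial i (Poly_Mapping.single \<alpha> c) =
    Poly_Mapping.single (\<alpha> - Poly_Mapping.single i 1) (of_nat (Poly_Mapping.lookup \<alpha> i) * c)"
  by (simp add: partial_def)

lemma partial_commute: "partial i (partial j F) = partial j (partial i F)"
proof (cases "i = j")
  case False
  show ?thesis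
  proof (induction F rule: poly5_induct)
    case (single \<alpha> c)
    have "\<alpha> - Poly_Mapping.single j 1 - Poly_Mapping.single i 1 =
        \<alpha> - Poly_Mapping.single i 1 - Poly_Mapping.single j (1::nat)"
      by (rule poly_mapping_eqI) (simp add: lookup_minus)
    \<comment> \<open>For distinct indices neither truncated subtraction disturbs the exponent that
      the other derivative brings down.\<close>
    then show ?case
      using False by (simp add: partial_single lookup_minus lookup_single when_def algebra_simps)
  qed (simp_all add: partial_add partial_0)
qed simp

lemma is_form_partial:
  assumes "is_form (Suc d) F"
  shows "is_form d (partial i F)"
  unfolding is_form_def
proof
  fix \<beta> assume "\<beta> \<in> Poly_Mapping.keys (partial i F)"
  then obtain \<alpha> where \<alpha>: "\<alpha> \<in> Poly_Mapping.keys F"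
      "\<beta> \<in> Poly_Mapping.keys (Poly_Mapping.single (\<alpha> - Poly_Mapping.single i 1)
         (of_nat (Poly_Mapping.lookup \<alpha> i) * Poly_Mapping.lookup F \<alpha>))"
    using keys_sum unfolding partial_def by fastforce
  then have \<beta>: "\<beta> = \<alpha> - Poly_Mapping.single i 1" and pos: "Poly_Mapping.lookup \<alpha> i \<noteq> 0"
    by (auto split: if_splits intro: Nat.gr0I)
  \<comment> \<open>The truncated subtraction is exact, as a monomial without the variable is killed
    by its coefficient 0.\<close>
  have "\<alpha> = \<beta> + Poly_Mapping.single i 1"
    using pos unfolding \<beta>
    by (intro poly_mapping_eqI) (auto simp: lookup_add lookup_minus lookup_single when_def)
  moreover have "(\<Sum>j\<in>UNIV. Poly_Mapping.lookup \<alpha> j) = Suc d"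
    using \<alpha>(1) assms by (auto simp: is_form_def)
  ultimately show "(\<Sum>j\<in>UNIV. Poly_Mapping.lookup \<beta> j) = d"
    by (simp add: lookup_add sum.distrib lookup_single when_def)
qed

lemma euler_formula:
  assumes "is_form d F"
  shows "(\<Sum>i\<in>UNIV. v $ i * eval (partial i F) v) = of_nat d * eval F v"
proof -
  have *: "v $ i * (of_nat (Poly_Mapping.lookup \<alpha> i) * c * mono_val (\<alpha> - Poly_Mapping.single i 1) v)
      = of_nat (Poly_Mapping.lookup \<alpha> i) * (c * mono_val \<alpha> v)" for i \<alpha> c
  proof (cases "Poly_Mapping.lookup \<alpha> i = 0")
    case False
    then have "\<alpha> = (\<alpha> - Poly_Mapping.single i 1) + Poly_Mapping.single i 1"
      by (intro poly_mapping_eqI) (auto simp: lookup_add lookup_minus lookup_single when_def)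
    then have "mono_val \<alpha> v = mono_val (\<alpha> - Poly_Mapping.single i 1) v * v $ i"
      by (metis mono_val_add mono_val_single power_one_right)
    then show ?thesis
      by (simp add: algebra_simps)
  qed simp
  have "(\<Sum>i\<in>UNIV. v $ i * eval (partial i F) v) = (\<Sum>i\<in>UNIV. \<Sum>\<alpha>\<in>Poly_Mapping.keys F.
      of_nat (Poly_Mapping.lookup \<alpha> i) * (Poly_Mapping.lookup F \<alpha> * mono_val \<alpha> v))"
    by (simp add: partial_def eval_sum eval_single sum_distrib_left *[unfolded One_nat_def])
  also have "\<dots> = (\<Sum>\<alpha>\<in>Poly_Mapping.keys F. of_nat (\<Sum>i\<in>UNIV. Poly_Mapping.lookup \<alpha> i)
      * (Poly_Mapping.lookup F \<alpha> * mono_val \<alpha> v))"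
    by (subst sum.swap) (simp add: sum_distrib_right)
  also have "\<dots> = (\<Sum>\<alpha>\<in>Poly_Mapping.keys F. of_nat d * (Poly_Mapping.lookup F \<alpha> * mono_val \<alpha> v))"
    using assms by (intro sum.cong refl) (simp add: is_form_def)
  finally show ?thesis
    by (simp add: eval_eq sum_distrib_left)
qed

text \<open>The third derivatives of a cubic form are such constants; evaluated at \<open>0\<close>,
  they give the coefficients of its polarization.\<close>

lemma eval_form_0:
  assumes "is_form 0 F"
  shows "eval F v = eval F w"
proof -
  have "\<alpha> = 0" if "\<alpha> \<in> Poly_Mapping.keys F" for \<alpha>
    using assms that by (intro poly_mapping_eqI) (auto simp: is_form_def)
  then show ?thesis
    unfolding eval_eq by (intro sum.cong refl) (metis mono_val_0)
qed

text \<open>The transpositions of neighbouring arguments generate all permutations, so linearity in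
  one argument yields trilinearity.\<close>

locale sym_trilinear =
  fixes T :: "'k::field_char_0^5 \<Rightarrow> 'k^5 \<Rightarrow> 'k^5 \<Rightarrow> 'k"
  assumes add1: "T (u + u') v w = T u v w + T u' v w"
    and scale1: "T (c *s u) v w = c * T u v w"
    and sym12: "T u v w = T v u w"
    and sym23: "T u v w = T u w v"
begin

lemma sym13: "T u v w = T v w u"
  by (metis sym12 sym23)

lemma add2: "T u (v + v') w = T u v w + T u v' w"
  by (metis add1 sym12)

lemma add3: "T u v (w + w') = T u v w + T u v w'"
  by (metis add2 sym23)

lemma scale2: "T u (c *s v) w = c * T u v w"
  by (metis scale1 sym12)

lemma scale3: "T u v (c *s w) = c * T u v w"
  by (metis scale2 sym23)

lemma zero1: "T 0 v w = 0"
  using scale1[of 0] by simp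

lemma zero2: "T v 0 w = 0"
  using scale2[of _ 0] by simp

lemma zero3: "T v w 0 = 0"
  using scale3[of _ _ 0] by simp

lemma neg1: "T (- u) v w = - T u v w"
  using scale1[of "- 1"] by simp

lemma neg2: "T u (- v) w = - T u v w"
  using scale2[of _ "- 1"] by simp

lemma neg3: "T u v (- w) = - T u v w"
  using scale3[of _ _ "- 1"] by simp

lemma diff1: "T (u - u') v w = T u v w - T u' v w"
  using add1[of u "- u'"] by (simp add: neg1)

lemma diff2: "T u (v - v') w = T u v w - T u v' w"
  using add2[of _ v "- v'"] by (simp add: neg2)

lemma diff3: "T u v (w - w') = T u v w - T u v w'"
  using add3[of _ _ w "- w'"] by (simp add: neg3)

lemmas expand = add1 add2 add3 scale1 scale2 scale3 zero1 zero2 zero3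
  neg1 neg2 neg3 diff1 diff2 diff3

text \<open>Inclusion and exclusion leaves the six orderings of \<open>u\<close>, \<open>v\<close>,
  \<open>w\<close>. In characteristic zero the cubic values therefore determine the trilinear form,
  and an invariance known only for the values of a cubic passes to its polarization.\<close>

lemma polarization:
  "6 * T u v w = T (u+v+w) (u+v+w) (u+v+w) - T (u+v) (u+v) (u+v) - T (u+w) (u+w) (u+w)
     - T (v+w) (v+w) (v+w) + T u u u + T v v v + T w w w"
proof -
  have eqs: "T v u u = T u u v" "T u v u = T u u v" "T w u u = T u u w" "T u w u = T u u w"
      "T v u v = T u v v" "T v v u = T u v v" "T w v v = T v v w" "T v w v = T v v w"
      "T w u w = T u w w" "T w w u = T u w w" "T w v w = T v w w" "T w w v = T v w w"
      "T u w v = T u v w" "T v u w = T u v w" "T v w u = T u v w" "T w u v = T u v w" "T w v u = T u v w"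
    by (metis sym12 sym23)+
  show ?thesis
    by (simp add: expand eqs)
qed

end

lemma sym_trilinear_eqI:
  assumes "sym_trilinear S" "sym_trilinear T" "\<And>v. S v v v = T v v v"
  shows "S u v w = T u v w"
proof -
  have "6 * S u v w = 6 * T u v w"
    unfolding sym_trilinear.polarization[OF assms(1)] sym_trilinear.polarization[OF assms(2)]
    by (simp add: assms(3))
  then show ?thesis
    by simp
qed

text \<open>Euler's formula in degrees 1, 2 and 3 leads from the constant third derivatives to
  second derivatives, first derivatives and values. The factors 6, 3 and 1 are what successive
  division of 6 by 1, 2 and 3 leaves.\<close>

lemma cubic_form_polarization:
  fixes F :: "'k::field_char_0 poly5"
  assumes "is_form 3 F"
  obtains T where "sym_trilinear T" "\<And>v. eval F v = T v v v"
    "\<And>i v. eval (partial i F) v = 3 * T (axis i 1) v v"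
    "\<And>u v w. hessian F v u w = 6 * T v u w"
proof
  define C where "C i j l = eval (partial i (partial j (partial l F))) 0 / 6" for i j l
  define T where "T u v w = (\<Sum>i\<in>UNIV. \<Sum>j\<in>UNIV. \<Sum>l\<in>UNIV. C i j l * u $ i * v $ j * w $ l)" for u v w
  have C12: "C i j l = C j i l" for i j l
    unfolding C_def by (subst partial_commute) rule
  have C23: "C i j l = C i l j" for i j l
    unfolding C_def by (subst (2) partial_commute) rule
  show T: "sym_trilinear T"
  proof
    fix u v w
    have "T u v w = (\<Sum>j\<in>UNIV. \<Sum>i\<in>UNIV. \<Sum>l\<in>UNIV. C i j l * u $ i * v $ j * w $ l)"
      unfolding T_def by (rule sum.swap)
    then show "T u v w = T v u w"
      unfolding T_def by (simp add: C12 mult_ac)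
    have "T u v w = (\<Sum>i\<in>UNIV. \<Sum>l\<in>UNIV. \<Sum>j\<in>UNIV. C i j l * u $ i * v $ j * w $ l)"
      unfolding T_def by (subst (2) sum.swap) rule
    then show "T u v w = T u w v"
      unfolding T_def by (simp add: C23 mult_ac)
  qed (simp_all add: T_def algebra_simps sum.distrib sum_distrib_left)
  have forms: "is_form 2 (partial i F)" "is_form 1 (partial j (partial i F))"
      "is_form 0 (partial l (partial j (partial i F)))" for i j l
    by (intro is_form_partial, simp add: assms flip: numeral_3_eq_3 numeral_2_eq_2 One_nat_def)+
  have hess: "eval (partial j (partial i F)) v = 6 * T (axis i 1) (axis j 1) v" for i j v
  proof -
    have "eval (partial j (partial i F)) v = (\<Sum>l\<in>UNIV. v $ l * (6 * C l j i))"
      using euler_formula[OF forms(2), of v j i] eval_form_0[OF forms(3), of _ _ _ v 0]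
      by (simp add: C_def)
    also have "\<dots> = (\<Sum>l\<in>UNIV. 6 * C i j l * v $ l)"
      by (intro sum.cong refl) (metis C12 C23 mult.commute)
    moreover have "T (axis i 1) (axis j 1) v = (\<Sum>l\<in>UNIV. C i j l * v $ l)"
    proof -
      have "T (axis i 1) (axis j 1) v = (\<Sum>m\<in>UNIV. if m = i then
          \<Sum>n\<in>UNIV. if n = j then \<Sum>l\<in>UNIV. C m n l * v $ l else 0 else 0)"
        unfolding T_def
      proof (intro sum.cong refl)
        fix m
        have "(\<Sum>n\<in>UNIV. \<Sum>l\<in>UNIV. C i n l * 1 * axis j 1 $ n * v $ l) =
            (\<Sum>n\<in>UNIV. if n = j then \<Sum>l\<in>UNIV. C i n l * v $ l else 0)"
          by (intro sum.cong refl) (simp add: axis_def)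
        then show "(\<Sum>n\<in>UNIV. \<Sum>l\<in>UNIV. C m n l * axis i 1 $ m * axis j 1 $ n * v $ l) =
            (if m = i then \<Sum>n\<in>UNIV. if n = j then \<Sum>l\<in>UNIV. C m n l * v $ l else 0 else 0)"
          by (cases "m = i") (simp_all add: axis_def)
      qed
      then show ?thesis
        by simp
    qed
    ultimately show ?thesis
      by (simp add: sum_distrib_left mult_ac)
  qed
  have combine: "(\<Sum>j\<in>UNIV. v $ j * T u (axis j 1) w) = T u v w" for u v w
  proof -
    have "T u v w = (\<Sum>j\<in>UNIV. \<Sum>i\<in>UNIV. \<Sum>l\<in>UNIV. C i j l * u $ i * v $ j * w $ l)"
      unfolding T_def by (rule sum.swap)
    moreover have "T u (axis j 1) w = (\<Sum>i\<in>UNIV. \<Sum>l\<in>UNIV. C i j l * u $ i * w $ l)" for j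
    proof -
      have "T u (axis j 1) w = (\<Sum>i\<in>UNIV. \<Sum>m\<in>UNIV. if m = j then \<Sum>l\<in>UNIV. C i m l * u $ i * w $ l else 0)"
        unfolding T_def by (intro sum.cong refl) (simp add: axis_def)
      then show ?thesis
        by simp
    qed
    ultimately show ?thesis
      by (simp add: sum_distrib_left mult_ac)
  qed
  show grad: "eval (partial i F) v = 3 * T (axis i 1) v v" for i v
  proof -
    have "2 * eval (partial i F) v = 6 * (\<Sum>j\<in>UNIV. v $ j * T (axis i 1) (axis j 1) v)"
      using euler_formula[OF forms(1), of v i]
      by (simp add: hess sum_distrib_left mult_ac)
    then show ?thesis
      by (simp add: combine)
  qed
  show "eval F v = T v v v" for v
  proof -
    have "3 * eval F v = 3 * (\<Sum>j\<in>UNIV. v $ j * T v (axis j 1) v)"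
      using euler_formula[OF assms, of v]
      by (simp add: grad sum_distrib_left mult_ac sym_trilinear.sym12[OF T, of v])
    then show ?thesis
      by (simp add: combine)
  qed
  show "hessian F v u w = 6 * T v u w" for u v w
  proof -
    have "hessian F v u w = 6 * (\<Sum>j\<in>UNIV. u $ j * (\<Sum>l\<in>UNIV. w $ l * T (axis j 1) (axis l 1) v))"
      unfolding hessian_def
      by (simp add: hess sum_distrib_left mult_ac sym_trilinear.sym12[OF T, of "axis _ 1" "axis _ 1"])
    also have "\<dots> = 6 * (\<Sum>j\<in>UNIV. u $ j * T w (axis j 1) v)"
      by (simp only: combine sym_trilinear.sym12[OF T, of w])
    also have "\<dots> = 6 * T v u w"
      unfolding combine by (metis sym_trilinear.sym12[OF T] sym_trilinear.sym23[OF T])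
    finally show ?thesis .
  qed
qed

section \<open>Projective linear transformations\<close>

lemma matrix_mult_scale: "A *v (c *s x) = c *s (A *v (x :: 'k::field^5))"
  by (simp add: vec_eq_iff matrix_vector_mult_def sum_distrib_left algebra_simps)

lemma matrix_mult_neg: "A *v (- x) = - (A *v (x :: 'k::field^5))"
  using matrix_mult_scale[of A "- 1" x] by simp

lemma mat_vector_mult: "mat c *v (x :: 'k::field^5) = c *s x"
  by (simp add: vec_eq_iff matrix_vector_mult_def mat_def if_distrib if_distribR cong: if_cong)

lemma mat_commute: "A ** mat c = mat c ** (A :: 'k::field^5^5)"
  by (simp add: matrix_eq mat_vector_mult matrix_mult_scale flip: matrix_vector_mul_assoc)

lemma mat_mult_mat: "mat c ** mat d = (mat (c * d) :: 'k::field^5^5)"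
  by (simp add: matrix_eq mat_vector_mult flip: matrix_vector_mul_assoc)

lemma matrix_inv: "invertible A \<Longrightarrow> A ** matrix_inv A = mat 1" "invertible A \<Longrightarrow> matrix_inv A ** A = mat 1"
  unfolding invertible_def matrix_inv_def by (metis (mono_tags, lifting) someI_ex)+

lemma invertible_matrix_inv: "invertible A \<Longrightarrow> invertible (matrix_inv A)"
  using matrix_inv unfolding invertible_def by blast

lemma invertible_mat: "c \<noteq> 0 \<Longrightarrow> invertible (mat c :: 'k::field^5^5)"
  unfolding invertible_def by (rule exI[of _ "mat (1 / c)"]) (simp add: mat_mult_mat)

lemma group_GL5: "group (GL5 :: ('k::field^5^5) monoid)"
proof (rule groupI)
  fix A :: "'k^5^5"
  assume "A \<in> carrier GL5"
  then have "matrix_inv A \<in> carrier GL5" "matrix_inv A \<otimes>\<^bsub>GL5\<^esub> A = \<one>\<^bsub>GL5\<^esub>"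
    by (auto simp: GL5_def invertible_matrix_inv matrix_inv)
  then show "\<exists>B\<in>carrier GL5. B \<otimes>\<^bsub>GL5\<^esub> A = \<one>\<^bsub>GL5\<^esub>"
    by blast
qed (auto simp: GL5_def invertible_mult invertible_mat matrix_mul_assoc)

lemma normal_scalars5: "normal scalars5 (GL5 :: ('k::field^5^5) monoid)"
proof -
  have inv: "inv\<^bsub>GL5\<^esub> A = matrix_inv A" if "invertible A" for A :: "'k^5^5"
    using that by (intro group.inv_equality[OF group_GL5])
      (auto simp: GL5_def invertible_matrix_inv matrix_inv)
  have "subgroup scalars5 (GL5 :: ('k^5^5) monoid)"
  proof (rule group.subgroupI[OF group_GL5])
    show "scalars5 \<subseteq> carrier (GL5 :: ('k^5^5) monoid)" "scalars5 \<noteq> ({} :: ('k^5^5) set)"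
      by (auto simp: scalars5_def GL5_def invertible_mat intro!: exI[of _ 1])
    show "inv\<^bsub>GL5\<^esub> A \<in> scalars5" if "A \<in> scalars5" for A :: "'k^5^5"
    proof -
      obtain c where c: "A = mat c" "c \<noteq> 0"
        using \<open>A \<in> scalars5\<close> by (auto simp: scalars5_def)
      have "inv\<^bsub>GL5\<^esub> A = mat (1 / c)"
        using c by (intro group.inv_equality[OF group_GL5]) (auto simp: GL5_def invertible_mat mat_mult_mat)
      then show ?thesis
        using c by (auto simp: scalars5_def)
    qed
    show "A \<otimes>\<^bsub>GL5\<^esub> B \<in> scalars5" if "A \<in> scalars5" "B \<in> scalars5" for A B :: "'k^5^5"
      using that by (auto simp: scalars5_def GL5_def mat_mult_mat)
  qed
  moreover have "A \<otimes>\<^bsub>GL5\<^esub> S \<otimes>\<^bsub>GL5\<^esub> inv\<^bsub>GL5\<^esub> A \<in> scalars5"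
    if "A \<in> carrier GL5" and S: "S \<in> scalars5" for A S :: "'k^5^5"
  proof -
    have A: "invertible A"
      using that by (simp add: GL5_def)
    obtain c where "S = mat c"
      using S by (auto simp: scalars5_def)
    then have "A ** S ** matrix_inv A = S"
      using matrix_inv[OF A] by (simp add: mat_commute[of A]) (simp flip: matrix_mul_assoc)
    then show ?thesis
      using that by (simp add: inv[OF A]) (simp add: GL5_def)
  qed
  ultimately show ?thesis
    by (simp add: group.normal_inv_iff[OF group_GL5])
qed

lemma group_PGL5: "group (PGL5 :: ('k::field^5^5) set monoid)"
  unfolding PGL5_def by (rule normal.factorgroup_is_group[OF normal_scalars5])

lemma proj_class_eq: "proj_class A = {mat c ** A | c. c \<noteq> 0}"
  by (auto simp: proj_class_def r_coset_def scalars5_def GL5_def)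

lemma proj_class_mat_mult: "c \<noteq> 0 \<Longrightarrow> proj_class (mat c ** A) = proj_class (A :: 'k::field^5^5)"
  unfolding proj_class_eq
  by (auto simp: matrix_mul_assoc mat_mult_mat intro: exI[of _ "_ * c"] exI[of _ "_ / c"])

lemma carrier_PGL5: "carrier PGL5 = {proj_class A | A. invertible (A :: 'k::field^5^5)}"
  unfolding PGL5_def carrier_FactGroup by (auto simp: proj_class_def GL5_def)

lemma proj_class_mult:
  fixes A B :: "'k::field^5^5"
  assumes "invertible A" "invertible B"
  shows "proj_class A \<otimes>\<^bsub>PGL5\<^esub> proj_class B = proj_class (A ** B)"
  using normal.rcos_sum[OF normal_scalars5, of A B] assms
  by (simp add: PGL5_def proj_class_def) (simp add: GL5_def)

lemma proj_class_one: "\<one>\<^bsub>PGL5\<^esub> = proj_class (mat 1)"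
  by (auto simp: PGL5_def proj_class_eq scalars5_def)

lemma proj_class_inv:
  fixes A :: "'k::field^5^5"
  assumes "invertible A"
  shows "inv\<^bsub>PGL5\<^esub> (proj_class A) = proj_class (matrix_inv A)"
  using assms
  by (intro group.inv_equality[OF group_PGL5])
    (auto simp: proj_class_mult invertible_matrix_inv matrix_inv proj_class_one carrier_PGL5)

section \<open>Points of projective space and the action of a cyclic group\<close>

lemma proj_point_self: "v \<in> proj_point v"
  unfolding proj_point_def by (auto intro: exI[of _ 1])

lemma proj_point_eq_iff: "proj_point v = proj_point w \<longleftrightarrow> (\<exists>c. c \<noteq> 0 \<and> v = c *s w)"
proof
  assume "proj_point v = proj_point w"
  then show "\<exists>c. c \<noteq> 0 \<and> v = c *s w"
    using proj_point_self[of v] by (auto simp: proj_point_def)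
next
  assume "\<exists>c. c \<noteq> 0 \<and> v = c *s w"
  then obtain c where c: "c \<noteq> 0" "v = c *s w"
    by blast
  have "\<exists>d. e *s w = d *s v \<and> d \<noteq> 0" if "e \<noteq> 0" for e
    using that c by (intro exI[of _ "e / c"]) simp
  moreover have "\<exists>d. e *s v = d *s w \<and> d \<noteq> 0" if "e \<noteq> 0" for e
    using that c by (intro exI[of _ "e * c"]) simp
  ultimately show "proj_point v = proj_point w"
    unfolding proj_point_def by (intro Collect_cong) metis
qed

lemma act_proj_class:
  fixes A :: "'k::field^5^5"
  shows "act (proj_class A) (proj_point v) = proj_point (A *v v)"
proof -
  have eq: "(mat d ** A) *v (c *s v) = (d * c) *s (A *v v)" for c d
    by (simp add: matrix_mult_scale mat_vector_mult flip: matrix_vector_mul_assoc)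
  show ?thesis
  proof
    show "act (proj_class A) (proj_point v) \<subseteq> proj_point (A *v v)"
      by (auto simp: act_def proj_class_eq proj_point_def eq)
    show "proj_point (A *v v) \<subseteq> act (proj_class A) (proj_point v)"
    proof
      fix w assume "w \<in> proj_point (A *v v)"
      then obtain c where "c \<noteq> 0" "w = (mat c ** A) *v (1 *s v)"
        unfolding eq by (auto simp: proj_point_def)
      then show "w \<in> act (proj_class A) (proj_point v)"
        unfolding act_def proj_class_eq using proj_point_self[of v] by auto
    qed
  qed
qed

text \<open>Used in contraposition: as the group fixes no node, neither does the generator. The
  induction carries a matrix for each element because products and inverses are computed on
  representatives.\<close>

lemma generate_fixes_point:
  fixes A :: "'k::field^5^5"
  assumes A: "invertible A" and fixed: "proj_point (A *v p) = proj_point p"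
    and h: "h \<in> generate PGL5 {proj_class A}"
  shows "act h (proj_point p) = proj_point p"
proof -
  have "\<exists>B. invertible B \<and> h = proj_class B \<and> proj_point (B *v p) = proj_point p"
    using h
  proof (induction h rule: generate.induct)
    case one
    then show ?case
      by (intro exI[of _ "mat 1"]) (simp add: proj_class_one invertible_mat)
  next
    case (incl h)
    then show ?case
      using A fixed by auto
  next
    case (inv h)
    obtain c where c: "c \<noteq> 0" "A *v p = c *s p"
      using fixed by (auto simp: proj_point_eq_iff)
    have "p = matrix_inv A *v (A *v p)"
      by (simp add: matrix_vector_mul_assoc matrix_inv[OF A])
    then have "p = c *s (matrix_inv A *v p)"
      by (simp add: c matrix_mult_scale)
    then have "proj_point p = proj_point (matrix_inv A *v p)"
      using c by (auto simp: proj_point_eq_iff)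
    then show ?case
      using inv A by (intro exI[of _ "matrix_inv A"]) (auto simp: proj_class_inv invertible_matrix_inv)
  next
    case (eng h1 h2)
    then obtain B C where BC: "invertible B" "h1 = proj_class B" "proj_point (B *v p) = proj_point p"
      "invertible C" "h2 = proj_class C" "proj_point (C *v p) = proj_point p"
      by blast
    have "proj_point (B *v (C *v p)) = act (proj_class B) (proj_point (C *v p))"
      by (simp add: act_proj_class)
    also have "\<dots> = proj_point p"
      by (simp add: BC act_proj_class)
    finally show ?case
      using BC by (intro exI[of _ "B ** C"]) (simp add: proj_class_mult invertible_mult matrix_vector_mul_assoc)
  qed
  then obtain B where "h = proj_class B" "proj_point (B *v p) = proj_point p"
    by blast
  then show ?thesis
    by (simp add: act_proj_class)
qed

text \<open>Used in both directions between a generator in normal form and an odd power of it, to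
  see that they generate the same group. \<open>N\<close> is given by its effect on vectors, where
  iterates of the maps of the list are explicit.\<close>

lemma generate_conjugate_power:
  fixes P M N :: "'k::field^5^5"
  assumes P: "invertible P" and M: "invertible M" and N: "\<And>x. N *v x = ((\<lambda>x. M *v x) ^^ j) x"
  shows "proj_class (P ** N ** matrix_inv P) \<in> generate PGL5 {proj_class (P ** M ** matrix_inv P)}"
proof -
  have "\<exists>N. invertible N \<and> (\<forall>x. N *v x = ((\<lambda>x. M *v x) ^^ j) x) \<and>
      proj_class (P ** N ** matrix_inv P) \<in> generate PGL5 {proj_class (P ** M ** matrix_inv P)}"
  proof (induction j)
    case 0
    show ?case
      by (rule exI[of _ "mat 1"])
        (use P in \<open>auto simp: invertible_mat matrix_inv proj_class_one[symmetric] intro: generate.one\<close>)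
  next
    case (Suc j)
    then obtain N where N: "invertible N" "\<And>x. N *v x = ((\<lambda>x. M *v x) ^^ j) x"
        "proj_class (P ** N ** matrix_inv P) \<in> generate PGL5 {proj_class (P ** M ** matrix_inv P)}"
      by blast
    have "P ** (M ** N) ** matrix_inv P = (P ** M ** matrix_inv P) ** (P ** N ** matrix_inv P)"
      by (metis (no_types, lifting) P matrix_inv(1) matrix_inv(2) matrix_mul_assoc matrix_mul_rid)
    then have "proj_class (P ** (M ** N) ** matrix_inv P) =
        proj_class (P ** M ** matrix_inv P) \<otimes>\<^bsub>PGL5\<^esub> proj_class (P ** N ** matrix_inv P)"
      using P M N by (simp add: proj_class_mult invertible_mult invertible_matrix_inv)
    then have "proj_class (P ** (M ** N) ** matrix_inv P) \<in> generate PGL5 {proj_class (P ** M ** matrix_inv P)}"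
      using generate.eng[OF generate.incl N(3)] by simp
    then show ?case
      using M N by (intro exI[of _ "M ** N"]) (auto simp: invertible_mult simp flip: matrix_vector_mul_assoc)
  qed
  then obtain N' where "\<And>x. N' *v x = ((\<lambda>x. M *v x) ^^ j) x"
      "proj_class (P ** N' ** matrix_inv P) \<in> generate PGL5 {proj_class (P ** M ** matrix_inv P)}"
    by blast
  moreover from this have "N' = N"
    by (simp add: matrix_eq N)
  ultimately show ?thesis
    by simp
qed

section \<open>Two nodes interchanged by an automorphism\<close>

context sym_trilinear
begin

text \<open>The vector version of having exactly two singular points, both nodes. That the radical
  of \<open>T p\<close> is a line expresses the nondegenerate Hessian without a chart. The last
  clause excludes further singular points; the zero vector is covered by the factor 0.\<close>

definition nodes :: "'k^5 \<Rightarrow> 'k^5 \<Rightarrow> bool" where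
  "nodes p q \<longleftrightarrow> p \<noteq> 0 \<and> q \<noteq> 0 \<and> (\<nexists>t. q = t *s p) \<and> (\<forall>w. T p p w = 0) \<and> (\<forall>w. T q q w = 0) \<and>
     (\<forall>u. (\<forall>w. T p u w = 0) \<longrightarrow> (\<exists>t. u = t *s p)) \<and>
     (\<forall>u. (\<forall>w. T q u w = 0) \<longrightarrow> (\<exists>t. u = t *s q)) \<and>
     (\<forall>v. (\<forall>w. T v v w = 0) \<longrightarrow> (\<exists>t. v = t *s p) \<or> (\<exists>t. v = t *s q))"

lemma nodes_scale:
  assumes "nodes p q" "s \<noteq> 0" "t \<noteq> 0"
  shows "nodes (s *s p) (t *s q)"
proof -
  have *: "(\<exists>t. u = t *s (c *s v)) \<longleftrightarrow> (\<exists>t. u = t *s v)" if "c \<noteq> 0" for c :: 'k and u v :: "'k^5"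
  proof
    assume "\<exists>t. u = t *s v"
    then obtain r where "u = r *s v" ..
    then show "\<exists>t. u = t *s (c *s v)"
      using that by (intro exI[of _ "r / c"]) simp
  qed (auto simp: vector_smult_assoc)
  have "(\<exists>r. q = r *s p)" if "t *s q = r *s p" for r
  proof -
    have "q = (1 / t) *s (t *s q)"
      using assms(3) by simp
    then show ?thesis
      unfolding that vector_smult_assoc by blast
  qed
  then show ?thesis
    using assms unfolding nodes_def expand *[OF assms(2)] *[OF assms(3)] mult_eq_0_iff vector_mul_eq_0
    by metis
qed

end

lemma nodes_of_cubic:
  fixes F :: "'k::field_char_0 poly5"
  assumes T: "sym_trilinear T"
    and grad: "\<And>i v. eval (partial i F) v = 3 * T (axis i 1) v v"
    and val: "\<And>v. eval F v = T v v v"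
    and hess: "\<And>u v w. hessian F v u w = 6 * T v u w"
    and card: "card (sing_locus F) = 2" and node: "\<forall>p\<in>sing_locus F. is_node F p"
  obtains p q where "sym_trilinear.nodes T p q" "sing_locus F = {proj_point p, proj_point q}"
proof -
  interpret sym_trilinear T
    by (rule T)
  have expand_axis: "T w v v = (\<Sum>i\<in>UNIV. w $ i * T (axis i 1) v v)" for w v
  proof -
    have "w = (\<Sum>i\<in>UNIV. w $ i *s axis i 1)"
      by (simp add: vec_eq_iff axis_def if_distrib cong: if_cong)
    moreover have "T (\<Sum>i\<in>S. w $ i *s axis i 1) v v = (\<Sum>i\<in>S. w $ i * T (axis i 1) v v)" for S
      by (induction S rule: infinite_finite_induct) (auto simp: expand)
    ultimately show ?thesis
      by metis
  qed
  have sing: "eval F v = 0 \<and> (\<forall>i. eval (partial i F) v = 0) \<longleftrightarrow> (\<forall>w. T v v w = 0)" for v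
  proof
    assume "eval F v = 0 \<and> (\<forall>i. eval (partial i F) v = 0)"
    then have "T w v v = 0" for w
      by (subst expand_axis) (simp add: grad)
    then show "\<forall>w. T v v w = 0"
      by (metis sym12 sym23)
  next
    assume "\<forall>w. T v v w = 0"
    then show "eval F v = 0 \<and> (\<forall>i. eval (partial i F) v = 0)"
      unfolding val grad by (metis sym12 sym23 mult_zero_right)
  qed
  have locus: "sing_locus F = {proj_point v | v. v \<noteq> 0 \<and> (\<forall>w. T v v w = 0)}"
    unfolding sing_locus_def using sing by auto
  obtain p q where pq: "sing_locus F = {proj_point p, proj_point q}" "proj_point p \<noteq> proj_point q"
      "p \<noteq> 0" "q \<noteq> 0" "\<forall>w. T p p w = 0" "\<forall>w. T q q w = 0"
  proof -
    obtain x y where xy: "sing_locus F = {x, y}" "x \<noteq> y"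
      using card by (meson card_2_iff)
    then have "x \<in> sing_locus F" "y \<in> sing_locus F"
      by auto
    then obtain p q where "x = proj_point p" "p \<noteq> 0" "\<forall>w. T p p w = 0"
        "y = proj_point q" "q \<noteq> 0" "\<forall>w. T q q w = 0"
      unfolding locus by blast
    then show ?thesis
      using xy that by metis
  qed
  have radical: "\<exists>t. u = t *s p" if p: "proj_point p \<in> sing_locus F" and u: "\<forall>w. T p u w = 0" for p u
  proof -
    obtain v i where v: "v \<in> proj_point p" "v $ i = 1"
        "\<forall>u. u $ i = 0 \<and> (\<forall>w. w $ i = 0 \<longrightarrow> hessian F v u w = 0) \<longrightarrow> u = 0"
      using node[rule_format, OF p] unfolding is_node_def by (elim conjE bexE exE) (rule that)
    obtain c where c: "v = c *s p" "c \<noteq> 0"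
      using v by (auto simp: proj_point_def)
    have "\<forall>w. T p p w = 0"
    proof -
      obtain p' where "proj_point p = proj_point p'" "\<forall>w. T p' p' w = 0"
        using p unfolding locus by blast
      then show ?thesis
        by (auto simp: proj_point_eq_iff expand)
    qed
    \<comment> \<open>Subtracting a multiple of \<open>v\<close> brings \<open>u\<close> into the
      tangent directions of the chart. As \<open>T v v\<close> vanishes, the result still lies in
      the radical.\<close>
    then have "\<forall>w. T v (u + (- (u $ i)) *s v) w = 0"
      using u by (simp only: c expand) simp
    then have zero: "u + (- (u $ i)) *s v = 0"
      by (intro v(3)[rule_format]) (simp add: v(2) hess)
    have "u = (u + (- (u $ i)) *s v) + (u $ i) *s v"
      by (simp add: vec_eq_iff)
    then have "u = (u $ i) *s v"
      unfolding zero by (simp only: add_0)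
    then have "u = (u $ i * c) *s p"
      unfolding c(1) vector_smult_assoc .
    then show ?thesis
      by blast
  qed
  have "nodes p q"
    unfolding nodes_def
  proof (intro conjI allI impI pq(3,4) pq(5,6)[rule_format])
    show "\<nexists>t. q = t *s p"
      using pq(2,4) by (metis proj_point_eq_iff vector_smult_lzero)
    show "\<exists>t. u = t *s p" if "\<forall>w. T p u w = 0" for u
      using radical that pq by blast
    show "\<exists>t. u = t *s q" if "\<forall>w. T q u w = 0" for u
      using radical that pq by blast
    show "(\<exists>t. v = t *s p) \<or> (\<exists>t. v = t *s q)" if v: "\<forall>w. T v v w = 0" for v
    proof (cases "v = 0")
      case False
      then have "proj_point v \<in> sing_locus F"
        unfolding locus using v by blast
      then show ?thesis
        unfolding pq(1) by (auto simp: proj_point_eq_iff)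
    qed (auto intro: exI[of _ 0])
  qed
  then show ?thesis
    using that pq by blast
qed

lemma swapped_nodes:
  fixes F :: "'k::{alg_closed_field, field_char_0} poly5"
  assumes F: "is_form 3 F"
    and card: "card (sing_locus F) = 2" and node: "\<forall>p\<in>sing_locus F. is_node F p"
    and g: "g \<in> Aut F" and moved: "\<forall>p\<in>sing_locus F. \<not> (\<forall>h\<in>generate PGL5 {g}. act h p = p)"
  obtains T p q A \<alpha> where "sym_trilinear T" "\<And>v. eval F v = T v v v" "sym_trilinear.nodes T p q"
    "invertible A" "g = proj_class A" "\<alpha> \<noteq> 0" "A *v p = \<alpha> *s q" "A *v q = \<alpha> *s p"
    "\<And>u v w. T (A *v u) (A *v v) (A *v w) = \<alpha>\<^sup>2 * T u v w"
proof -
  obtain T where T: "sym_trilinear T" and val: "\<And>v. eval F v = T v v v"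
    and grad: "\<And>i v. eval (partial i F) v = 3 * T (axis i 1) v v"
    and hess: "\<And>u v w. hessian F v u w = 6 * T v u w"
    using cubic_form_polarization[OF F] by blast
  interpret sym_trilinear T
    by (rule T)
  obtain p q where pq: "nodes p q" "sing_locus F = {proj_point p, proj_point q}"
    using nodes_of_cubic[OF T grad val hess card node] .
  obtain A where A: "g = proj_class A" "invertible A"
    using g unfolding Aut_def carrier_PGL5 by blast
  have "A \<in> g"
    unfolding A proj_class_eq by (auto intro!: exI[of _ 1])
  then obtain c where c: "c \<noteq> 0" "\<And>v. eval F (A *v v) = c * eval F v"
    using g unfolding Aut_def by blast
  have inv: "T (A *v u) (A *v v) (A *v w) = c * T u v w" for u v w
  proof -
    have "sym_trilinear (\<lambda>u v w. T (A *v u) (A *v v) (A *v w) / c)"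
      by standard (simp_all add: matrix_vector_right_distrib matrix_mult_scale expand add_divide_distrib,
        metis sym12, metis sym23)
    then have "T (A *v u) (A *v v) (A *v w) / c = T u v w"
      by (rule sym_trilinear_eqI[OF _ T]) (use c in \<open>simp flip: val\<close>)
    then show ?thesis
      using c by (simp add: field_simps)
  qed
  have surj: "\<exists>w'. w = A *v w'" for w
    by (rule exI[of _ "matrix_inv A *v w"]) (simp add: matrix_vector_mul_assoc matrix_inv[OF A(2)])
  have inj: "v = 0" if "A *v v = 0" for v
    by (metis that A(2) matrix_inv(2) matrix_vector_mul_assoc matrix_vector_mul_lid matrix_vector_mult_0_right)
  have singular: "(\<exists>t. A *v v = t *s p) \<or> (\<exists>t. A *v v = t *s q)" if "\<forall>w. T v v w = 0" for v
  proof -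
    have "T (A *v v) (A *v v) w = 0" for w
      using surj[of w] inv that by auto
    then show ?thesis
      using pq unfolding nodes_def by blast
  qed
  have not_fixed: "A *v v \<noteq> t *s v" if v: "proj_point v \<in> sing_locus F" "v \<noteq> 0" for v t
  proof
    assume fixed: "A *v v = t *s v"
    then have "t \<noteq> 0"
      using inj v by auto
    then have "proj_point (A *v v) = proj_point v"
      using fixed by (auto simp: proj_point_eq_iff)
    then show False
      using moved v generate_fixes_point[OF A(2)] unfolding A by blast
  qed
  have pq0: "p \<noteq> 0" "q \<noteq> 0" "\<forall>w. T p p w = 0" "\<forall>w. T q q w = 0"
    using pq unfolding nodes_def by auto
  \<comment> \<open>Singular vectors go to singular vectors and no node is fixed, so each node goes
    to the other.\<close>
  obtain a b where ab: "A *v p = a *s q" "A *v q = b *s p"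
    using singular[OF pq0(3)] singular[OF pq0(4)] not_fixed pq pq0 by blast
  have nz: "a \<noteq> 0" "b \<noteq> 0"
    using ab inj pq0 by force+
  \<comment> \<open>For the vectors \<open>r *s p\<close> and \<open>(1 / r) *s q\<close> the
    factors of the exchange are \<open>r^2 * a\<close> and \<open>b / r^2\<close>; they agree when
    \<open>r^4 = b / a\<close>.\<close>
  obtain r where r: "r ^ 4 = b / a"
    using nth_root_exists[of 4 "b / a"] by auto
  then have "r \<noteq> 0"
    using nz by auto
  \<comment> \<open>Scaling \<open>A\<close> by \<open>s\<close> gives \<open>T\<close> the
    multiplier \<open>s^3 * c\<close>, while the square of the common factor of the nodes is
    \<open>s^2 * a * b\<close>; this \<open>s\<close> equates the two.\<close>
  define s where "s = a * b / c"
  have s: "s \<noteq> 0"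
    using nz c by (simp add: s_def)
  define B where "B = mat s ** A"
  have B: "B *v v = s *s (A *v v)" for v
    unfolding B_def by (simp add: mat_vector_mult flip: matrix_vector_mul_assoc)
  have \<alpha>2: "(r\<^sup>2 * s * a)\<^sup>2 = s * s * a * b"
  proof -
    have "(r\<^sup>2 * s * a)\<^sup>2 = r ^ 4 * (s * s * a * a)"
      by (simp add: power_mult_distrib power2_eq_square power4_eq_xxxx mult_ac)
    then show ?thesis
      using nz by (simp add: r)
  qed
  show ?thesis
  proof (rule that[OF T val, of "r *s p" "(1 / r) *s q" B "r\<^sup>2 * s * a"])
    show "nodes (r *s p) ((1 / r) *s q)"
      using nodes_scale pq \<open>r \<noteq> 0\<close> by auto
    show "invertible B" "g = proj_class B"
      unfolding B_def A using s A by (auto simp: invertible_mult invertible_mat proj_class_mat_mult)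
    show "r\<^sup>2 * s * a \<noteq> 0"
      using \<open>r \<noteq> 0\<close> s nz by simp
    show "B *v (r *s p) = (r\<^sup>2 * s * a) *s ((1 / r) *s q)"
      using \<open>r \<noteq> 0\<close> by (simp add: B matrix_mult_scale ab power2_eq_square mult_ac)
    have "b = r ^ 4 * a"
      using nz by (simp add: r)
    then show "B *v ((1 / r) *s q) = (r\<^sup>2 * s * a) *s (r *s p)"
      using \<open>r \<noteq> 0\<close> by (simp add: B matrix_mult_scale ab power2_eq_square power4_eq_xxxx field_simps)
    have "s * s * s * c = s * s * a * b"
      using c by (simp add: s_def)
    then show "T (B *v u) (B *v v) (B *v w) = (r\<^sup>2 * s * a)\<^sup>2 * T u v w" for u v w
      unfolding \<alpha>2 by (simp add: B expand inv) (metis mult.assoc)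
  qed
qed

section \<open>Bases adapted to the two nodes\<close>

definition basis_matrix :: "'k::field^5 \<Rightarrow> 'k^5 \<Rightarrow> 'k^5 \<Rightarrow> 'k^5 \<Rightarrow> 'k^5 \<Rightarrow> 'k^5^5" where
  "basis_matrix p1 p2 p3 p4 p5 = transpose (vector [p1, p2, p3, p4, p5])"

text \<open>Five spanning vectors are the columns of an invertible matrix, so independence follows,
  and for a change of basis it is enough to express the old vectors by the new ones.\<close>

definition spanning :: "'k::field^5 \<Rightarrow> 'k^5 \<Rightarrow> 'k^5 \<Rightarrow> 'k^5 \<Rightarrow> 'k^5 \<Rightarrow> bool" where
  "spanning p1 p2 p3 p4 p5 \<longleftrightarrow> vec.span {p1, p2, p3, p4, p5} = UNIV"

lemma basis_matrix_mult: "basis_matrix p1 p2 p3 p4 p5 *v y =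
    y $ 1 *s p1 + y $ 2 *s p2 + y $ 3 *s p3 + y $ 4 *s p4 + y $ 5 *s p5"
  by (simp add: vec_eq_iff basis_matrix_def matrix_vector_mult_def transpose_def sum_5 mult.commute)

lemma spanning_coordinates:
  assumes "spanning p1 p2 p3 p4 p5"
  obtains a b c d e where "v = a *s p1 + b *s p2 + c *s p3 + d *s p4 + e *s p5"
proof -
  have "v \<in> vec.span {p1, p2, p3, p4, p5}"
    using assms by (simp add: spanning_def)
  then obtain a b c d e where "v - a *s p1 - b *s p2 - c *s p3 - d *s p4 - e *s p5 = 0"
    by (auto simp: vec.span_insert)
  then have "v = a *s p1 + b *s p2 + c *s p3 + d *s p4 + e *s p5"
    by (simp add: algebra_simps)
  then show ?thesis
    by (rule that)
qed

lemma invertible_basis_matrix: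
  assumes "spanning p1 p2 p3 p4 p5"
  shows "invertible (basis_matrix p1 p2 p3 p4 p5)"
proof -
  have "surj (\<lambda>y. basis_matrix p1 p2 p3 p4 p5 *v y)"
  proof (rule surjI)
    fix v
    have "\<exists>y. basis_matrix p1 p2 p3 p4 p5 *v y = v"
      using spanning_coordinates[OF assms, of v] by (metis basis_matrix_mult vector_5)
    then show "basis_matrix p1 p2 p3 p4 p5 *v (SOME y. basis_matrix p1 p2 p3 p4 p5 *v y = v) = v"
      by (rule someI_ex)
  qed
  then show ?thesis
    by (metis invertible_right_inverse matrix_right_invertible_surjective)
qed

lemma spanning_independent:
  assumes "spanning p1 p2 p3 p4 p5"
    and "a *s p1 + b *s p2 + c *s p3 + d *s p4 + e *s p5 = 0"
  shows "a = 0" "b = 0" "c = 0" "d = 0" "e = 0"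
proof -
  let ?P = "basis_matrix p1 p2 p3 p4 p5" and ?y = "vector [a, b, c, d, e] :: 'a^5"
  have "?P *v ?y = 0"
    using assms(2) by (simp add: basis_matrix_mult)
  then have "?y = 0"
    by (metis invertible_basis_matrix[OF assms(1)] matrix_inv(2) matrix_vector_mul_assoc
        matrix_vector_mul_lid matrix_vector_mult_0_right)
  then show "a = 0" "b = 0" "c = 0" "d = 0" "e = 0"
    by (metis vector_5 zero_index)+
qed

lemma spanningI:
  assumes "spanning p1 p2 p3 p4 p5" "{p1, p2, p3, p4, p5} \<subseteq> vec.span {q1, q2, q3, q4, q5}"
  shows "spanning q1 q2 q3 q4 q5"
  using vec.span_mono[OF assms(2)] assms(1) unfolding spanning_def vec.span_span by blast

lemma span5_combination:
  "a *s q1 + b *s q2 + c *s q3 + d *s q4 + e *s q5 \<in> vec.span {q1, q2, q3, q4, q5 :: 'k::field^5}"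
  by (intro vec.span_add vec.span_scale vec.span_base) auto

lemma span5_combinationI:
  "v = a *s q1 + b *s q2 + c *s q3 + d *s q4 + e *s q5 \<Longrightarrow> v \<in> vec.span {q1, q2, q3, q4, q5 :: 'k::field^5}"
  using span5_combination by simp

lemma span5_base:
  "q1 \<in> vec.span {q1, q2, q3, q4, q5}" "q2 \<in> vec.span {q1, q2, q3, q4, q5}"
  "q3 \<in> vec.span {q1, q2, q3, q4, q5}" "q4 \<in> vec.span {q1, q2, q3, q4, q5}"
  "q5 \<in> vec.span {q1, q2, q3, q4, q5 :: 'k::field^5}"
  by (simp_all add: vec.span_base)

lemma spanning_scale:
  assumes "spanning p1 p2 p3 p4 p5" "t1 \<noteq> 0" "t2 \<noteq> 0" "t3 \<noteq> 0" "t4 \<noteq> 0" "t5 \<noteq> 0"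
  shows "spanning (t1 *s p1) (t2 *s p2) (t3 *s p3) (t4 *s p4) (t5 *s p5)"
proof (rule spanningI[OF assms(1)])
  let ?S = "{t1 *s p1, t2 *s p2, t3 *s p3, t4 *s p4, t5 *s p5}"
  have "p1 \<in> vec.span ?S"
    by (rule span5_combinationI[of _ "1/t1" _ 0 _ 0 _ 0 _ 0]) (simp add: assms)
  moreover have "p2 \<in> vec.span ?S"
    by (rule span5_combinationI[of _ 0 _ "1/t2" _ 0 _ 0 _ 0]) (simp add: assms)
  moreover have "p3 \<in> vec.span ?S"
    by (rule span5_combinationI[of _ 0 _ 0 _ "1/t3" _ 0 _ 0]) (simp add: assms)
  moreover have "p4 \<in> vec.span ?S"
    by (rule span5_combinationI[of _ 0 _ 0 _ 0 _ "1/t4" _ 0]) (simp add: assms)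
  moreover have "p5 \<in> vec.span ?S"
    by (rule span5_combinationI[of _ 0 _ 0 _ 0 _ 0 _ "1/t5"]) (simp add: assms)
  ultimately show "{p1, p2, p3, p4, p5} \<subseteq> vec.span ?S"
    by simp
qed

lemma spanning_swap45: "spanning p1 p2 p3 p4 p5 \<Longrightarrow> spanning p1 p2 p3 p5 p4"
  by (simp add: spanning_def insert_commute)

lemma spanning_change45:
  assumes "spanning p1 p2 p3 p4 p5" "a * d \<noteq> b * c"
  shows "spanning p1 p2 p3 (a *s p4 + b *s p5) (c *s p4 + d *s p5)"
proof (rule spanningI[OF assms(1)])
  let ?S = "{p1, p2, p3, a *s p4 + b *s p5, c *s p4 + d *s p5}" and ?D = "a * d - b * c"
  have D: "?D \<noteq> 0"
    using assms(2) by simp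
  \<comment> \<open>Cramer's rule: the entries of the product of the coefficient matrix with its
    inverse.\<close>
  have e4: "a * (d / ?D) - c * (b / ?D) = 1" "b * (d / ?D) - d * (b / ?D) = 0"
    "c * (a / ?D) - a * (c / ?D) = 0" "d * (a / ?D) - b * (c / ?D) = 1"
    using D by (simp_all add: diff_divide_distrib[symmetric] mult.commute)
  have gen: "x * (a * u + b * v) + - y * (c * u + d * v) = (a * x - c * y) * u + (b * x - d * y) * v" for x y u v
    by (simp add: algebra_simps)
  have "p4 $ i = (d / ?D) * (a * p4 $ i + b * p5 $ i) + - (b / ?D) * (c * p4 $ i + d * p5 $ i)" for i
    unfolding gen e4 by simp
  then have "p4 \<in> vec.span ?S"
    by (intro span5_combinationI[of _ 0 _ 0 _ 0 _ "d / ?D" _ "- (b / ?D)"])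
      (simp only: vec_eq_iff vector_add_component vector_smult_component mult_zero_left add_0, blast)
  moreover have "p5 $ i = - (c / ?D) * (a * p4 $ i + b * p5 $ i) + (a / ?D) * (c * p4 $ i + d * p5 $ i)" for i
    using gen[of "- (c / ?D)" "p4 $ i" "p5 $ i" "- (a / ?D)"] e4(3,4)
    by (simp only: minus_minus mult_minus_right) (simp only: minus_diff_minus diff_minus_eq_add add.commute, simp)
  then have "p5 \<in> vec.span ?S"
    by (intro span5_combinationI[of _ 0 _ 0 _ 0 _ "- (c / ?D)" _ "a / ?D"])
      (simp only: vec_eq_iff vector_add_component vector_smult_component mult_zero_left add_0, blast)
  ultimately show "{p1, p2, p3, p4, p5} \<subseteq> vec.span ?S"
    by (simp add: span5_base)
qed

lemma spanning_shear:
  assumes "spanning p1 p2 p3 p4 p5"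
  shows "spanning p1 p2 (p3 + (s *s p1 + t *s p2 + x *s p4 + y *s p5))
    (p4 + (s' *s p1 + t' *s p2)) (p5 + (s'' *s p1 + t'' *s p2))"
proof (rule spanningI[OF assms(1)])
  let ?p4 = "p4 + (s' *s p1 + t' *s p2)" and ?p5 = "p5 + (s'' *s p1 + t'' *s p2)"
  let ?p3 = "p3 + (s *s p1 + t *s p2 + x *s p4 + y *s p5)"
  let ?S = "{p1, p2, ?p3, ?p4, ?p5}"
  have "p4 \<in> vec.span ?S"
    by (rule span5_combinationI[of _ "- s'" _ "- t'" _ 0 _ 1 _ 0]) (simp add: vec_eq_iff)
  moreover have "p5 \<in> vec.span ?S"
    by (rule span5_combinationI[of _ "- s''" _ "- t''" _ 0 _ 0 _ 1]) (simp add: vec_eq_iff)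
  moreover have "p3 \<in> vec.span ?S"
    by (rule span5_combinationI[of _ "x * s' + y * s'' - s" _ "x * t' + y * t'' - t" _ 1 _ "- x" _ "- y"])
      (simp add: vec_eq_iff algebra_simps)
  ultimately show "{p1, p2, p3, p4, p5} \<subseteq> vec.span ?S"
    by (simp add: span5_base)
qed

lemma spanning_extend:
  fixes p q r :: "'k::field^5"
  assumes "q \<noteq> 0" "\<nexists>t. p = t *s q" "\<nexists>s t. r = s *s p + t *s q"
  obtains v w where "spanning p q r v w"
proof -
  have nz: "p \<noteq> 0" "r \<noteq> 0" "p \<noteq> q" "r \<noteq> p" "r \<noteq> q"
    using assms(2,3) by (metis vector_smult_lzero add_0 vector_smult_lid add_0_right)+
  have "p \<notin> vec.span {q}"
    using assms(2) by (auto simp: vec.span_insert)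
  moreover have "r \<notin> vec.span {p, q}"
  proof
    assume "r \<in> vec.span {p, q}"
    then obtain s t where "r - s *s p - t *s q = 0"
      by (auto simp: vec.span_insert)
    then have "r = s *s p + t *s q"
      by (simp add: algebra_simps)
    then show False
      using assms(3) by blast
  qed
  ultimately have ind: "vec.independent {r, p, q}"
    using nz assms(1) by (simp add: vec.independent_insert)
  define B where "B = vec.extend_basis {r, p, q}"
  have B: "{r, p, q} \<subseteq> B" "vec.independent B" "vec.span B = UNIV"
    using vec.extend_basis_superset[OF ind] vec.independent_extend_basis[OF ind]
      vec.span_extend_basis[OF ind] by (simp_all add: B_def)
  have "card B = vec.dim (UNIV :: ('k^5) set)"
    using vec.basis_card_eq_dim[of B UNIV] B by simp
  then have "card B = 5"
    unfolding vec_dim_card by simp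
  then have "card (B - {r, p, q}) = 2"
    using B(1) nz by (subst card_Diff_subset) auto
  then obtain v w where "B - {r, p, q} = {v, w}"
    by (meson card_2_iff)
  then have "B = {p, q, r, v, w}"
    using B(1) by auto
  then show ?thesis
    using that B(3) unfolding spanning_def by blast
qed

text \<open>Each vanishing condition removes a monomial that the shape
  \<open>x1 x2 x3 + x1 q1 + x2 q2 + f3\<close> excludes, and the value 1 normalizes
  \<open>x1 x2 x3\<close> up to a global factor. The eigenvalue 1 of \<open>p3\<close> reflects the
  scaling of \<open>A\<close>.\<close>

definition (in sym_trilinear) frame ::
  "'k^5^5 \<Rightarrow> 'k \<Rightarrow> 'k \<Rightarrow> 'k \<Rightarrow> 'k^5 \<Rightarrow> 'k^5 \<Rightarrow> 'k^5 \<Rightarrow> 'k^5 \<Rightarrow> 'k^5 \<Rightarrow> bool" where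
  "frame A \<alpha> \<mu> \<nu> p1 p2 p3 p4 p5 \<longleftrightarrow> nodes p1 p2 \<and> \<alpha> \<noteq> 0 \<and>
     (\<forall>u v w. T (A *v u) (A *v v) (A *v w) = \<alpha>\<^sup>2 * T u v w) \<and> spanning p1 p2 p3 p4 p5 \<and>
     A *v p1 = \<alpha> *s p2 \<and> A *v p2 = \<alpha> *s p1 \<and>
     A *v p3 = p3 \<and> A *v p4 = \<mu> *s p4 \<and> A *v p5 = \<nu> *s p5 \<and>
     T p1 p2 p3 = 1 \<and> T p1 p2 p4 = 0 \<and> T p1 p2 p5 = 0 \<and>
     T p1 p3 p3 = 0 \<and> T p1 p3 p4 = 0 \<and> T p1 p3 p5 = 0 \<and>
     T p2 p3 p3 = 0 \<and> T p2 p3 p4 = 0 \<and> T p2 p3 p5 = 0"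

section \<open>The induced action modulo the span of the two nodes\<close>

locale swapped_nodes = sym_trilinear T for T :: "'k::{alg_closed_field, field_char_0}^5 \<Rightarrow> 'k^5 \<Rightarrow> 'k^5 \<Rightarrow> 'k" +
  fixes p q :: "'k^5" and A :: "'k^5^5" and \<alpha> :: 'k
  assumes nodes: "nodes p q" and \<alpha>: "\<alpha> \<noteq> 0"
    and Ap: "A *v p = \<alpha> *s q" and Aq: "A *v q = \<alpha> *s p"
    and inv: "T (A *v u) (A *v v) (A *v w) = \<alpha>\<^sup>2 * T u v w"
begin

lemmas sym = sym12 sym23

lemmas A_linear = matrix_vector_right_distrib matrix_mult_scale

lemma Tpp: "T p p w = 0" "T p w p = 0" "T w p p = 0"
  using nodes unfolding nodes_def by (metis sym)+

lemma Tqq: "T q q w = 0" "T q w q = 0" "T w q q = 0"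
  using nodes unfolding nodes_def by (metis sym)+

lemma invp: "T q (A *v v) (A *v w) = \<alpha> * T p v w"
  using inv[of p v w] \<alpha> by (simp add: Ap expand power2_eq_square)

lemma invq: "T p (A *v v) (A *v w) = \<alpha> * T q v w"
  using inv[of q v w] \<alpha> by (simp add: Aq expand power2_eq_square)

text \<open>The reason for the scaling of \<open>A\<close>: the factors \<alpha> of the two nodes
  cancel the multiplier of \<open>T\<close>.\<close>

lemma inv_pq: "T p q (A *v v) = T p q v"
  using inv[of q p v] \<alpha> by (simp add: Ap Aq expand power2_eq_square sym)

text \<open>The nodes with \<open>e\<close> and \<open>f\<close> form a basis of the kernel of
  \<open>T p q\<close>, which \<open>A\<close> preserves; \<open>r\<close> spans a
  complement.\<close>

definition adapted :: "'k^5 \<Rightarrow> 'k^5 \<Rightarrow> 'k^5 \<Rightarrow> bool" where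
  "adapted r e f \<longleftrightarrow> spanning p q r e f \<and> T p q r = 1 \<and> T p q e = 0 \<and> T p q f = 0"

lemma adapted_exists: obtains r e f where "adapted r e f"
proof -
  \<comment> \<open>Were \<open>T p q\<close> zero, \<open>q\<close> would lie in the radical of
    \<open>T p\<close>, which is the line of \<open>p\<close>.\<close>
  obtain r0 where r0: "T p q r0 \<noteq> 0"
    using nodes unfolding nodes_def by metis
  define r where "r = (1 / T p q r0) *s r0"
  have r: "T p q r = 1"
    using r0 by (simp add: r_def expand)
  have "\<nexists>t. p = t *s q"
  proof
    assume "\<exists>t. p = t *s q"
    then have "T p q r = 0"
      by (auto simp: expand Tqq)
    then show False
      using r by simp
  qed
  moreover have "\<nexists>s t. r = s *s p + t *s q"
    using r by (auto simp: expand Tpp Tqq)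
  ultimately obtain v w where vw: "spanning p q r v w"
    using spanning_extend nodes unfolding nodes_def by metis
  define e where "e = v + (- T p q v) *s r"
  define f where "f = w + (- T p q w) *s r"
  have "spanning p q r e f"
  proof (rule spanningI[OF vw])
    have "v \<in> vec.span {p, q, r, e, f}"
      by (rule span5_combinationI[of _ 0 _ 0 _ "T p q v" _ 1 _ 0]) (simp add: e_def vec_eq_iff)
    moreover have "w \<in> vec.span {p, q, r, e, f}"
      by (rule span5_combinationI[of _ 0 _ 0 _ "T p q w" _ 0 _ 1]) (simp add: f_def vec_eq_iff)
    ultimately show "{p, q, r, v, w} \<subseteq> vec.span {p, q, r, e, f}"
      by (simp add: span5_base)
  qed
  then have "adapted r e f"
    unfolding adapted_def by (simp add: r e_def f_def expand)
  then show ?thesis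
    by (rule that)
qed

lemma adapted_image:
  assumes "adapted r e f"
  obtains s t x y where "A *v v = s *s p + t *s q + T p q v *s r + x *s e + y *s f"
proof -
  have r: "T p q r = 1" "T p q e = 0" "T p q f = 0"
    using assms by (auto simp: adapted_def)
  obtain s t z x y where v: "A *v v = s *s p + t *s q + z *s r + x *s e + y *s f"
    using spanning_coordinates assms unfolding adapted_def by metis
  have "T p q (A *v v) = z"
    unfolding v by (simp add: expand r Tpp Tqq)
  then have "z = T p q v"
    by (simp add: inv_pq)
  then show ?thesis
    using that v by blast
qed

text \<open>The form \<open>T p\<close> pairs \<open>q\<close> with \<open>r\<close>. So a radical
  vector of its restriction to the plane, corrected by a multiple of \<open>q\<close>, is orthogonal
  to everything and thus a multiple of \<open>p\<close>.\<close>

lemma nondegenerate: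
  assumes "adapted r e f" and "x * T p e e + y * T p e f = 0" "x * T p e f + y * T p f f = 0"
  shows "x = 0 \<and> y = 0"
proof -
  have r: "T p q r = 1" "T p q e = 0" "T p q f = 0" "spanning p q r e f"
    using assms by (auto simp: adapted_def)
  define t where "t = - (x * T p e r + y * T p f r)"
  define u where "u = t *s q + x *s e + y *s f"
  have "T p u w = 0" for w
  proof -
    obtain a b c d g where w: "w = a *s p + b *s q + c *s r + d *s e + g *s f"
      using spanning_coordinates r by metis
    have "T p u p = 0" "T p u q = 0"
      by (simp_all add: u_def expand Tpp Tqq r sym23[of p e q] sym23[of p f q])
    moreover have "T p u r = 0"
      by (simp add: u_def expand r t_def)
    moreover have "T p u e = 0" "T p u f = 0"
      using assms(2,3) by (simp_all add: u_def expand r sym23[of p f e])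
    ultimately show ?thesis
      unfolding w by (simp add: expand)
  qed
  then obtain s where "u = s *s p"
    using nodes unfolding nodes_def by blast
  then have "(- s) *s p + t *s q + 0 *s r + x *s e + y *s f = 0"
    by (simp add: u_def algebra_simps)
  then show ?thesis
    using spanning_independent(4,5)[OF r(4)] by blast
qed

lemma adapted_swap: "adapted r e f \<Longrightarrow> adapted r f e"
  by (simp add: adapted_def spanning_swap45)

lemma adapted_change:
  "adapted r e f \<Longrightarrow> a * d \<noteq> b * c \<Longrightarrow> adapted r (a *s e + b *s f) (c *s e + d *s f)"
  by (simp add: adapted_def spanning_change45 expand)

lemma adapted_shear:
  "adapted r e f \<Longrightarrow> adapted (r + (s *s p + t *s q + x *s e + y *s f))
    (e + (s' *s p + t' *s q)) (f + (s'' *s p + t'' *s q))"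
  by (simp add: adapted_def spanning_shear expand Tpp Tqq)

text \<open>Congruence modulo the two nodes. Since \<open>A\<close> exchanges their lines,
  eigenvectors can be sought in the three-dimensional quotient and lifted afterwards.\<close>

definition eqpq :: "'k^5 \<Rightarrow> 'k^5 \<Rightarrow> bool" (infix \<open>\<doteq>\<close> 50) where
  "u \<doteq> v \<longleftrightarrow> (\<exists>s t. u = v + (s *s p + t *s q))"

lemma eqpq_add: "u \<doteq> v \<Longrightarrow> u' \<doteq> v' \<Longrightarrow> u + u' \<doteq> v + v'"
proof -
  assume "u \<doteq> v" "u' \<doteq> v'"
  then obtain s t s' t' where "u = v + (s *s p + t *s q)" "u' = v' + (s' *s p + t' *s q)"
    unfolding eqpq_def by blast
  then have "u + u' = v + v' + ((s + s') *s p + (t + t') *s q)"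
    by (simp add: vec_eq_iff algebra_simps)
  then show ?thesis
    unfolding eqpq_def by blast
qed

lemma eqpq_scale: "u \<doteq> v \<Longrightarrow> c *s u \<doteq> c *s v"
proof -
  assume "u \<doteq> v"
  then obtain s t where "u = v + (s *s p + t *s q)"
    unfolding eqpq_def by blast
  then have "c *s u = c *s v + ((c * s) *s p + (c * t) *s q)"
    by (simp add: vec_eq_iff algebra_simps)
  then show ?thesis
    unfolding eqpq_def by blast
qed

lemma adapted_image':
  assumes "adapted r e f"
  obtains x y where "A *v v \<doteq> T p q v *s r + x *s e + y *s f"
proof -
  obtain s t x y where "A *v v = s *s p + t *s q + T p q v *s r + x *s e + y *s f"
    using adapted_image[OF assms] .
  then have "A *v v = (T p q v *s r + x *s e + y *s f) + (s *s p + t *s q)"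
    by (simp add: algebra_simps)
  then show ?thesis
    using that unfolding eqpq_def by blast
qed

lemma triangular:
  obtains r e f \<mu> \<nu> \<kappa> where "adapted r e f" "A *v e \<doteq> \<mu> *s e" "A *v f \<doteq> \<nu> *s f + \<kappa> *s e"
proof -
  obtain r e f where ref: "adapted r e f"
    by (rule adapted_exists)
  then have U: "T p q e = 0" "T p q f = 0"
    by (auto simp: adapted_def)
  obtain a c where e: "A *v e \<doteq> a *s e + c *s f"
    using adapted_image'[OF ref, of e] U by auto
  obtain b d where f: "A *v f \<doteq> b *s e + d *s f"
    using adapted_image'[OF ref, of f] U by auto
  show ?thesis
  proof (cases "c = 0")
    case True
    then show ?thesis
      using that[OF ref, of a d b] e f by (simp add: add.commute)
  next
    case False
    let ?P = "[:a * d - b * c, - (a + d), 1:]"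
    obtain \<mu> where "poly ?P \<mu> = 0"
      using alg_closed_imp_poly_has_root[of ?P] by auto
    then have \<mu>: "a * (\<mu> - d) + b * c = \<mu> * (\<mu> - d)"
      by (simp add: algebra_simps)
    \<comment> \<open>For a root \<mu> of the characteristic polynomial on the plane this is an
      eigenvector. As \<open>c \<noteq> 0\<close>, it forms a basis with \<open>e\<close>, and the
      trace gives the second eigenvalue.\<close>
    define e' where "e' = (\<mu> - d) *s e + c *s f"
    have ref': "adapted r e' (1 *s e + 0 *s f)"
      unfolding e'_def using False by (intro adapted_change ref) simp
    have "A *v e' \<doteq> (\<mu> - d) *s (a *s e + c *s f) + c *s (b *s e + d *s f)"
      unfolding e'_def A_linear by (intro eqpq_add eqpq_scale e f)
    moreover have "(\<mu> - d) *s (a *s e + c *s f) + c *s (b *s e + d *s f) = \<mu> *s e'"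
    proof -
      have "(\<mu> - d) *s (a *s e + c *s f) + c *s (b *s e + d *s f) =
          (a * (\<mu> - d) + b * c) *s e + (\<mu> * c) *s f"
        by (simp add: vec_eq_iff algebra_simps)
      then show ?thesis
        unfolding \<mu> by (simp add: e'_def vec_eq_iff algebra_simps)
    qed
    moreover have "a *s e + c *s f = (a + d - \<mu>) *s e + 1 *s e'"
      by (simp add: e'_def vec_eq_iff algebra_simps)
    ultimately have "A *v e' \<doteq> \<mu> *s e'" "A *v (1 *s e + 0 *s f) \<doteq> (a + d - \<mu>) *s (1 *s e + 0 *s f) + 1 *s e'"
      using e by (simp_all only: vector_smult_lid vector_smult_lzero add_0_right)
    then show ?thesis
      by (rule that[OF ref'])
  qed
qed

text \<open>On the kernel of \<open>T p q\<close> the forms \<open>T p\<close> and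
  \<open>T q\<close> do not see multiples of the nodes.\<close>

lemma T_eqpq:
  assumes "u \<doteq> u'" "v \<doteq> v'" "T p q u' = 0" "T p q v' = 0"
  shows "T p u v = T p u' v'" "T q u v = T q u' v'"
proof -
  obtain s t s' t' where uv: "u = u' + (s *s p + t *s q)" "v = v' + (s' *s p + t' *s q)"
    using assms unfolding eqpq_def by blast
  have eqs: "T p u' q = 0" "T q u' p = 0" "T q p v' = 0"
    using assms(3,4) by (metis sym)+
  show "T p u v = T p u' v'" "T q u v = T q u' v'"
    by (simp_all add: uv expand Tpp Tqq assms eqs)
qed

text \<open>On a Jordan block, a form that \<open>A\<close> scales by a nonzero factor vanishes at
  \<open>e, e\<close> and \<open>e, f\<close>: a nonzero value would force the factor to be
  \<open>\<mu>\<^sup>2\<close>, and the next equation would then make it zero. Hence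
  \<open>e\<close> would lie in the radical of \<open>T p\<close> on the plane, against
  nondegeneracy.\<close>

lemma plane_diagonal:
  obtains r e f \<mu> \<nu> where "adapted r e f" "A *v e \<doteq> \<mu> *s e" "A *v f \<doteq> \<nu> *s f"
proof -
  obtain r e f \<mu> \<nu> \<kappa> where ref: "adapted r e f" and e: "A *v e \<doteq> \<mu> *s e"
    and f: "A *v f \<doteq> \<nu> *s f + \<kappa> *s e"
    by (rule triangular)
  show ?thesis
  proof (cases "\<mu> = \<nu>")
    case False
    \<comment> \<open>For distinct eigenvalues, adding this multiple of \<open>e\<close> turns
      \<open>f\<close> into an eigenvector.\<close>
    define x where "x = \<kappa> / (\<nu> - \<mu>)"
    have x: "x * \<nu> = \<kappa> + x * \<mu>"
      using False by (simp add: x_def field_simps)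
    have "A *v (x *s e + 1 *s f) \<doteq> x *s (\<mu> *s e) + 1 *s (\<nu> *s f + \<kappa> *s e)"
      unfolding A_linear by (intro eqpq_add eqpq_scale e f)
    moreover have "x *s (\<mu> *s e) + 1 *s (\<nu> *s f + \<kappa> *s e) = (\<kappa> + x * \<mu>) *s e + \<nu> *s f"
      by (simp add: vec_eq_iff algebra_simps)
    moreover have "(\<kappa> + x * \<mu>) *s e + \<nu> *s f = \<nu> *s (x *s e + 1 *s f)"
      unfolding x[symmetric] by (simp add: vec_eq_iff algebra_simps)
    ultimately have f': "A *v (x *s e + 1 *s f) \<doteq> \<nu> *s (x *s e + 1 *s f)"
      by (simp only:)
    have "adapted r (1 *s e + 0 *s f) (x *s e + 1 *s f)"
      by (intro adapted_change ref) simp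
    then have "adapted r e (x *s e + 1 *s f)"
      by simp
    then show ?thesis
      using e f' by (rule that)
  next
    case True
    have "\<kappa> = 0"
    proof (rule ccontr)
      assume \<kappa>: "\<kappa> \<noteq> 0"
      have U: "T p q e = 0" "T p q f = 0"
        using ref by (auto simp: adapted_def)
      have f': "A *v f \<doteq> \<mu> *s f + \<kappa> *s e"
        using f True by simp
      have U': "T p q (\<mu> *s e) = 0" "T p q (\<mu> *s f + \<kappa> *s e) = 0"
        by (simp_all add: expand U)
      have swap: "T p f e = T p e f" "T q f e = T q e f"
        by (metis sym)+
      have ee: "\<mu>\<^sup>2 * T q e e = \<alpha> * T p e e" "\<mu>\<^sup>2 * T p e e = \<alpha> * T q e e"
        using T_eqpq[OF e e U'(1,1)] by (simp_all add: invp invq expand power2_eq_square mult.assoc)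
      have ef: "\<mu>\<^sup>2 * T q e f + \<mu> * \<kappa> * T q e e = \<alpha> * T p e f" "\<mu>\<^sup>2 * T p e f + \<mu> * \<kappa> * T p e e = \<alpha> * T q e f"
        using T_eqpq[OF e f' U'] by (simp_all add: invp invq expand power2_eq_square algebra_simps)
      have ff: "\<mu>\<^sup>2 * T q f f + 2 * \<mu> * \<kappa> * T q e f + \<kappa>\<^sup>2 * T q e e = \<alpha> * T p f f"
        "\<mu>\<^sup>2 * T p f f + 2 * \<mu> * \<kappa> * T p e f + \<kappa>\<^sup>2 * T p e e = \<alpha> * T q f f"
        using T_eqpq[OF f' f' U'(2,2)] by (simp_all add: invp invq expand swap power2_eq_square algebra_simps)
      text \<open>The sum and the difference of \<open>T p\<close> and \<open>T q\<close> are multiplied by \<open>\<plusminus>\<alpha>\<close>.\<close>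
      have semi: "a = 0 \<and> b = 0" if "\<mu>\<^sup>2 * a = \<beta> * a" "\<mu>\<^sup>2 * b + \<mu> * \<kappa> * a = \<beta> * b"
        "\<mu>\<^sup>2 * c + 2 * \<mu> * \<kappa> * b + \<kappa>\<^sup>2 * a = \<beta> * c" "\<beta> \<noteq> 0" for a b c \<beta>
      proof -
        have "a = 0"
        proof (rule ccontr)
          assume "a \<noteq> 0"
          then have "\<mu>\<^sup>2 = \<beta>"
            using that(1) by simp
          then have "\<mu> \<noteq> 0" "\<mu> * \<kappa> * a = 0"
            using that(2,4) by auto
          then show False
            using \<open>a \<noteq> 0\<close> \<kappa> by simp
        qed
        moreover have "b = 0"
        proof (rule ccontr)
          assume "b \<noteq> 0"
          then have "\<mu>\<^sup>2 = \<beta>"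
            using that(2) \<open>a = 0\<close> by simp
          then have "\<mu> \<noteq> 0" "2 * \<mu> * \<kappa> * b = 0"
            using that(3,4) \<open>a = 0\<close> by auto
          then show False
            using \<open>b \<noteq> 0\<close> \<kappa> by simp
        qed
        ultimately show ?thesis
          by simp
      qed
      have 1: "T p e e + T q e e = 0 \<and> T p e f + T q e f = 0"
        by (rule semi[of _ \<alpha> _ "T p f f + T q f f"])
          (simp_all only: distrib_left[of \<alpha>] \<alpha> not_False_eq_True flip: ee ef ff, simp_all add: algebra_simps)
      have minus: "- \<alpha> * (x - y) = \<alpha> * y - \<alpha> * x" for x y
        by (simp add: algebra_simps)
      have 2: "T p e e - T q e e = 0 \<and> T p e f - T q e f = 0"
        by (rule semi[of _ "- \<alpha>" _ "T p f f - T q f f"])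
          (simp_all only: minus \<alpha> neg_equal_0_iff_equal not_False_eq_True flip: ee ef ff, simp_all add: algebra_simps)
      have "2 * T p e e = 0" "2 * T p e f = 0"
        using 1 2 by (simp_all add: algebra_simps)
      then have "T p e e = 0" "T p e f = 0"
        by simp_all
      then show False
        using nondegenerate[OF ref, of 1 0] by simp
    qed
    then show ?thesis
      using that ref e f by simp
  qed
qed


text \<open>Adding \<open>s *s e\<close> to \<open>r\<close> changes the \<open>e\<close>-component
  of \<open>A *v r - r\<close> by \<open>s * (\<mu> - 1)\<close>, so this component can be removed
  unless \<open>\<mu> = 1\<close>; likewise for \<open>f\<close>. What survives is a vector of
  eigenvalue 1, taken as the new \<open>e\<close> of a Jordan block.\<close>

lemma diagonal_or_jordan:
  obtains (diagonal) r e f \<mu> \<nu> where "adapted r e f" "A *v e \<doteq> \<mu> *s e" "A *v f \<doteq> \<nu> *s f" "A *v r \<doteq> r"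
  | (jordan) r e f \<nu> where "adapted r e f" "A *v e \<doteq> e" "A *v f \<doteq> \<nu> *s f" "A *v r \<doteq> r + e"
proof -
  obtain r0 e f \<mu> \<nu> where ref0: "adapted r0 e f" and e: "A *v e \<doteq> \<mu> *s e" and f: "A *v f \<doteq> \<nu> *s f"
    by (rule plane_diagonal)
  obtain x y where "A *v r0 \<doteq> T p q r0 *s r0 + x *s e + y *s f"
    using adapted_image'[OF ref0, of r0] .
  then have r0: "A *v r0 \<doteq> r0 + x *s e + y *s f"
    using ref0 by (simp add: adapted_def)
  have kill: "\<exists>s z. z = x + s * (\<mu> - 1) \<and> (z = 0 \<or> \<mu> = 1)" for x \<mu> :: 'k
    by (cases "\<mu> = 1") (auto intro!: exI[of _ "x / (1 - \<mu>)"] simp: field_simps)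
  obtain s x' where x': "x' = x + s * (\<mu> - 1)" "x' = 0 \<or> \<mu> = 1"
    using kill by blast
  obtain t y' where y': "y' = y + t * (\<nu> - 1)" "y' = 0 \<or> \<nu> = 1"
    using kill by blast
  define r where "r = r0 + (0 *s p + 0 *s q + s *s e + t *s f)"
  have ref: "adapted r e f"
    using adapted_shear[OF ref0, of 0 0 s t 0 0 0 0] by (simp add: r_def)
  have "A *v r \<doteq> r0 + x *s e + y *s f + s *s (\<mu> *s e) + t *s (\<nu> *s f)"
    using eqpq_add[OF eqpq_add[OF r0 eqpq_scale[OF e]] eqpq_scale[OF f]] by (simp add: r_def A_linear add.assoc)
  moreover have "r0 + x *s e + y *s f + s *s (\<mu> *s e) + t *s (\<nu> *s f) = r + (x' *s e + y' *s f)"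
    by (simp add: r_def x' y' vec_eq_iff algebra_simps)
  ultimately have r: "A *v r \<doteq> r + (x' *s e + y' *s f)"
    by simp
  consider "x' = 0" "y' = 0" | "x' \<noteq> 0" "\<mu> = 1" "y' = 0" | "x' = 0" "y' \<noteq> 0" "\<nu> = 1"
    | "x' \<noteq> 0" "y' \<noteq> 0" "\<mu> = 1" "\<nu> = 1"
    using x'(2) y'(2) by blast
  then show ?thesis
  proof cases
    case 1
    then show ?thesis
      using diagonal[OF ref e f] r by simp
  next
    case 2
    have "adapted r (x' *s e + 0 *s f) (0 *s e + 1 *s f)"
      using 2 by (intro adapted_change ref) simp
    then have "adapted r (x' *s e) f"
      by simp
    moreover have "A *v (x' *s e) \<doteq> x' *s e" "A *v r \<doteq> r + x' *s e"
      using eqpq_scale[OF e, of x'] r 2 by (simp_all add: A_linear)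
    ultimately show ?thesis
      using jordan f by blast
  next
    case 3
    have "adapted r (y' *s f + 0 *s e) (0 *s f + 1 *s e)"
      using 3 by (intro adapted_change adapted_swap[OF ref]) simp
    then have "adapted r (y' *s f) e"
      by simp
    moreover have "A *v (y' *s f) \<doteq> y' *s f" "A *v r \<doteq> r + y' *s f"
      using eqpq_scale[OF f, of y'] r 3 by (simp_all add: A_linear)
    ultimately show ?thesis
      using jordan e by blast
  next
    case 4
    have "adapted r (x' *s e + y' *s f) (0 *s e + 1 *s f)"
      using 4 by (intro adapted_change ref) simp
    then have "adapted r (x' *s e + y' *s f) f"
      by simp
    moreover have "A *v (x' *s e + y' *s f) \<doteq> x' *s e + y' *s f"
      using eqpq_add[OF eqpq_scale[OF e, of x'] eqpq_scale[OF f, of y']] 4 by (simp add: A_linear)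
    ultimately show ?thesis
      using jordan f r by blast
  qed
qed

section \<open>Lifting from the quotient to the whole space\<close>

lemma eqpq_shear:
  assumes "A *v u \<doteq> v"
  shows "A *v (u + (s *s p + t *s q)) \<doteq> v + (s' *s p + t' *s q)"
proof -
  obtain x y where uv: "A *v u = v + (x *s p + y *s q)"
    using assms unfolding eqpq_def by blast
  have "A *v (u + (s *s p + t *s q)) = v + (s' *s p + t' *s q)
      + ((x + t * \<alpha> - s') *s p + (y + s * \<alpha> - t') *s q)"
    by (simp add: A_linear uv Ap Aq vec_eq_iff algebra_simps)
  then show ?thesis
    unfolding eqpq_def by blast
qed

text \<open>Since \<open>T p q r = 1\<close>, a multiple of \<open>q\<close> added to a vector
  shifts its pairing with \<open>r\<close> under \<open>T p\<close>, and a multiple of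
  \<open>p\<close> that under \<open>T q\<close>. The corrections of \<open>r\<close> are halved
  because \<open>r\<close> enters the pairing with itself twice.\<close>

lemma normalize:
  assumes "adapted r0 e0 f0"
  obtains s t s' t' s'' t'' r e f where "adapted r e f"
    "r = r0 + (s *s p + t *s q)" "e = e0 + (s' *s p + t' *s q)" "f = f0 + (s'' *s p + t'' *s q)"
    "T p r r = 0" "T p r e = 0" "T p r f = 0" "T q r r = 0" "T q r e = 0" "T q r f = 0"
proof -
  have r0: "T p q r0 = 1" "T p q e0 = 0" "T p q f0 = 0"
    using assms by (auto simp: adapted_def)
  have sw: "T p r0 q = 1" "T q r0 p = 1" "T p e0 q = 0" "T q e0 p = 0" "T p f0 q = 0" "T q f0 p = 0" "T q p r0 = 1" "T q p e0 = 0" "T q p f0 = 0"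
    using r0 by (metis sym)+
  define r where "r = r0 + ((- (T q r0 r0 / 2)) *s p + (- (T p r0 r0 / 2)) *s q)"
  define e where "e = e0 + ((- T q r e0) *s p + (- T p r e0) *s q)"
  define f where "f = f0 + ((- T q r f0) *s p + (- T p r f0) *s q)"
  have r: "T p q r = 1" "T p r q = 1" "T q r p = 1"
    by (simp_all add: r_def expand r0 sw Tpp Tqq)
  show ?thesis
  proof (rule that[OF _ r_def e_def f_def])
    show "adapted r e f"
      using adapted_shear[OF assms, of "- (T q r0 r0 / 2)" "- (T p r0 r0 / 2)" 0 0
          "- T q r e0" "- T p r e0" "- T q r f0" "- T p r f0", folded e_def f_def]
      by (simp only: r_def vector_smult_lzero add_0_right)
    show "T p r r = 0" "T q r r = 0"
      by (simp_all add: r_def expand r0 sw Tpp Tqq)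
    show "T p r e = 0" "T p r f = 0" "T q r e = 0" "T q r f = 0"
      by (simp_all add: e_def f_def expand r Tpp Tqq)
  qed
qed

text \<open>Invariance of the vanishing pairings with \<open>r\<close> determines the components of
  \<open>A *v e\<close> and \<open>A *v f\<close> along the nodes, in terms of \<open>T p\<close>
  and \<open>T q\<close> on the plane. These components produce extra terms in
  \<open>T e e e\<close> and \<open>T e f f\<close> which invariance does not allow.\<close>

lemma no_jordan_block:
  assumes "adapted r0 e0 f0" and "A *v e0 \<doteq> e0" "A *v f0 \<doteq> \<nu> *s f0" "A *v r0 \<doteq> r0 + e0"
  shows False
proof -
  obtain s t s' t' s'' t'' r e f where ref: "adapted r e f"
    and shears: "r = r0 + (s *s p + t *s q)" "e = e0 + (s' *s p + t' *s q)" "f = f0 + (s'' *s p + t'' *s q)"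
    and zero: "T p r r = 0" "T p r e = 0" "T p r f = 0" "T q r r = 0" "T q r e = 0" "T q r f = 0"
    by (rule normalize[OF assms(1)])
  have "A *v e \<doteq> e"
    unfolding shears(2) by (rule eqpq_shear[OF assms(2)])
  then obtain s1 t1 where Ae: "A *v e = e + (s1 *s p + t1 *s q)"
    unfolding eqpq_def by blast
  have "A *v f \<doteq> \<nu> *s f0 + ((\<nu> * s'') *s p + (\<nu> * t'') *s q)"
    unfolding shears(3) by (rule eqpq_shear[OF assms(3)])
  then have "A *v f \<doteq> \<nu> *s f"
    by (simp add: shears(3) algebra_simps)
  then obtain s2 t2 where Af: "A *v f = \<nu> *s f + (s2 *s p + t2 *s q)"
    unfolding eqpq_def by blast
  have "A *v r \<doteq> (r0 + e0) + ((s + s') *s p + (t + t') *s q)"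
    unfolding shears(1) by (rule eqpq_shear[OF assms(4)])
  moreover have "(r0 + e0) + ((s + s') *s p + (t + t') *s q) = r + e"
    by (simp add: shears vec_eq_iff algebra_simps)
  ultimately obtain s3 t3 where Ar: "A *v r = r + e + (s3 *s p + t3 *s q)"
    unfolding eqpq_def by auto
  have r: "T p q r = 1" "T p q e = 0" "T p q f = 0"
    using ref by (auto simp: adapted_def)
  have sw: "T p r q = 1" "T q r p = 1" "T p e q = 0" "T q e p = 0" "T p f q = 0" "T q f p = 0"
    "T q p r = 1" "T q p e = 0" "T q p f = 0" "T p e r = 0" "T q e r = 0" "T p f r = 0" "T q f r = 0"
    "T p f e = T p e f" "T q f e = T q e f" "T e e p = T p e e" "T e e q = T q e e"
    "T e p e = T p e e" "T e q e = T q e e" "T e q p = 0" "T e p q = 0"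
    "T e f p = T p e f" "T e p f = T p e f" "T e f q = T q e f" "T e q f = T q e f"
    using r zero by (metis sym)+
  note simps = expand r sw zero Tpp Tqq
  have "T p (A *v e) (A *v r) = 0" "T q (A *v e) (A *v r) = 0"
    "T p (A *v f) (A *v r) = 0" "T q (A *v f) (A *v r) = 0"
    by (simp_all add: invp invq sw)
  then have "t1 + T p e e = 0" "s1 + T q e e = 0" "t2 + \<nu> * T p e f = 0" "s2 + \<nu> * T q e f = 0"
    by (simp_all add: Ae Ar Af simps)
  then have st: "t1 = - T p e e" "s1 = - T q e e" "t2 = - (\<nu> * T p e f)" "s2 = - (\<nu> * T q e f)"
    by (simp_all only: eq_neg_iff_add_eq_0)
  have a: "T q e e = \<alpha> * T p e e" "T p e e = \<alpha> * T q e e"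
    using invp[of e e] invq[of e e] by (simp_all add: Ae simps)
  have b: "\<nu> * T q e f = \<alpha> * T p e f" "\<nu> * T p e f = \<alpha> * T q e f"
    using invp[of e f] invq[of e f] by (simp_all add: Ae Af simps)
  have pe: "T p e e = 0"
  proof (rule ccontr)
    assume nz: "T p e e \<noteq> 0"
    have "T p e e = \<alpha> * (\<alpha> * T p e e)"
      by (subst a(1)[symmetric]) (rule a(2))
    then have "T p e e = \<alpha>\<^sup>2 * T p e e"
      by (simp only: power2_eq_square mult.assoc)
    then have "\<alpha>\<^sup>2 = 1"
      using nz by simp
    then have "T (A *v e) (A *v e) (A *v e) = T e e e"
      using inv[of e e e] by simp
    \<comment> \<open>With multiplier 1, just the cross terms of \<open>T e e e\<close> are
      left.\<close>
    then have "6 * (T p e e * T q e e) = 0"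
      by (simp add: Ae simps st algebra_simps)
    then show False
      using nz a(2) by (metis mult_eq_0_iff mult_zero_right zero_neq_numeral)
  qed
  then have qe: "T q e e = 0"
    using a(1) by simp
  \<comment> \<open>Now \<open>e\<close> is isotropic, so nondegeneracy makes it pair with
    \<open>f\<close>.\<close>
  have pf: "T p e f \<noteq> 0"
    using nondegenerate[OF ref, of 1 0] pe by auto
  then have nz: "T q e f \<noteq> 0" "\<nu> \<noteq> 0"
    using b \<alpha> pf by (metis mult_eq_0_iff)+
  have "\<nu>\<^sup>2 * T p e f = \<alpha>\<^sup>2 * T p e f"
    unfolding power2_eq_square mult.assoc b(2) mult.left_commute[of \<nu>] b(1) by simp
  then have "\<nu>\<^sup>2 = \<alpha>\<^sup>2"
    using pf by simp
  then have "T (A *v e) (A *v f) (A *v f) = \<nu>\<^sup>2 * T e f f"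
    using inv[of e f f] by simp
  \<comment> \<open>Here \<open>A *v e = e\<close>, and the cross terms come from the components of
    \<open>A *v f\<close> along the nodes.\<close>
  then have "4 * (\<nu>\<^sup>2 * (T p e f * T q e f)) = 0"
    by (simp add: Ae Af simps st pe qe power2_eq_square algebra_simps)
  then show False
    using nz pf by simp
qed

lemma frame_exists:
  obtains r e f \<mu> \<nu> where "frame A \<alpha> \<mu> \<nu> p q r e f"
proof (rule diagonal_or_jordan)
  fix r0 e0 f0 \<mu> \<nu>
  assume ref0: "adapted r0 e0 f0" "A *v e0 \<doteq> \<mu> *s e0" "A *v f0 \<doteq> \<nu> *s f0" "A *v r0 \<doteq> r0"
  obtain s t s' t' s'' t'' r e f where ref: "adapted r e f"
    and shears: "r = r0 + (s *s p + t *s q)" "e = e0 + (s' *s p + t' *s q)" "f = f0 + (s'' *s p + t'' *s q)"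
    and zero: "T p r r = 0" "T p r e = 0" "T p r f = 0" "T q r r = 0" "T q r e = 0" "T q r f = 0"
    by (rule normalize[OF ref0(1)])
  have "A *v r \<doteq> r"
    unfolding shears(1) by (rule eqpq_shear[OF ref0(4)])
  then obtain x y where Ar: "A *v r = r + (x *s p + y *s q)"
    unfolding eqpq_def by blast
  have r: "T p q r = 1" "T p q e = 0" "T p q f = 0"
    using ref by (auto simp: adapted_def)
  have sw: "T p r q = 1" "T q r p = 1" "T p e q = 0" "T q e p = 0" "T p f q = 0" "T q f p = 0"
    "T q p r = 1" "T q p e = 0" "T q p f = 0" "T p e r = 0" "T q e r = 0" "T p f r = 0" "T q f r = 0"
    using r zero by (metis sym)+
  note simps = expand r sw zero Tpp Tqq
  have "T p (A *v r) (A *v r) = 0" "T q (A *v r) (A *v r) = 0"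
    by (simp_all add: invp invq zero)
  \<comment> \<open>The pairings of \<open>A *v r\<close> with itself stay zero, and those of
    \<open>r\<close> with the nodes are 1; so a component along a node would show up here.\<close>
  then have "2 * x = 0" "2 * y = 0"
    by (simp_all add: Ar simps)
  then have Ar': "A *v r = r"
    by (simp add: Ar)
  \<comment> \<open>The same argument with \<open>r\<close> and \<open>v\<close> turns the
    congruence into an equality.\<close>
  have eig: "A *v v = \<kappa> *s v" if "A *v v \<doteq> \<kappa> *s v" "T p r v = 0" "T q r v = 0" for v \<kappa>
  proof -
    obtain x y where Av: "A *v v = \<kappa> *s v + (x *s p + y *s q)"
      using \<open>A *v v \<doteq> \<kappa> *s v\<close> unfolding eqpq_def by blast
    have "T p (A *v r) (A *v v) = 0" "T q (A *v r) (A *v v) = 0"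
      using that by (simp_all add: invp invq)
    then have "x = 0" "y = 0"
      using that unfolding Ar' Av by (simp_all add: simps)
    then show ?thesis
      by (simp add: Av)
  qed
  have eigs: "\<kappa> *s (v + (s *s p + t *s q)) = \<kappa> *s v + ((\<kappa> * s) *s p + (\<kappa> * t) *s q)" for v \<kappa> s t
    by (simp add: vec_eq_iff algebra_simps)
  have "A *v e = \<mu> *s e"
    by (intro eig zero) (simp only: shears(2) eigs eqpq_shear[OF ref0(2)])
  moreover have "A *v f = \<nu> *s f"
    by (intro eig zero) (simp only: shears(3) eigs eqpq_shear[OF ref0(3)])
  ultimately have "frame A \<alpha> \<mu> \<nu> p q r e f"
    using ref unfolding frame_def adapted_def by (simp add: nodes \<alpha> Ap Aq inv Ar' zero)
  then show ?thesis
    by (rule that)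
qed (use no_jordan_block in blast)

end

section \<open>Recognizing the normal forms\<close>

locale swapped_cubic = sym_trilinear T for T :: "'k::{alg_closed_field, field_char_0}^5 \<Rightarrow> 'k^5 \<Rightarrow> 'k^5 \<Rightarrow> 'k" +
  fixes F :: "'k poly5" and A :: "'k^5^5" and g :: "('k^5^5) set" and \<zeta> :: "nat \<Rightarrow> 'k"
  assumes F: "eval F v = T v v v" and g: "g = proj_class A"
    and \<zeta>: "\<forall>n>0. primitive_root_of_unity n (\<zeta> n)"
begin

lemma frame_swapped_nodes:
  assumes "frame A \<alpha> \<mu> \<nu> p1 p2 p3 p4 p5"
  shows "swapped_nodes T p1 p2 A \<alpha>"
  using assms sym_trilinear_axioms
  by (simp add: swapped_nodes_def swapped_nodes_axioms_def frame_def)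

lemma frame_spanning: "frame A \<alpha> \<mu> \<nu> p1 p2 p3 p4 p5 \<Longrightarrow> spanning p1 p2 p3 p4 p5"
  by (simp add: frame_def)

lemma frame_zero:
  assumes "frame A \<alpha> \<mu> \<nu> p1 p2 p3 p4 p5"
  shows "T p1 p1 w = 0" "T p2 p2 w = 0" "T p1 p2 p3 = 1" "T p1 p2 p4 = 0" "T p1 p2 p5 = 0"
    "T p1 p3 p3 = 0" "T p1 p3 p4 = 0" "T p1 p3 p5 = 0" "T p2 p3 p3 = 0" "T p2 p3 p4 = 0" "T p2 p3 p5 = 0"
    "T w p1 p1 = 0" "T w p2 p2 = 0"
  using assms by (auto simp: frame_def nodes_def sym13[of w])

text \<open>Rewriting with these rules sorts the arguments.\<close>

lemma sort5:
  "\<forall>w. T p2 p1 w = T p1 p2 w \<and> T w p2 p1 = T w p1 p2 \<and>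
    T p3 p1 w = T p1 p3 w \<and> T w p3 p1 = T w p1 p3 \<and>
    T p4 p1 w = T p1 p4 w \<and> T w p4 p1 = T w p1 p4 \<and>
    T p5 p1 w = T p1 p5 w \<and> T w p5 p1 = T w p1 p5 \<and>
    T p3 p2 w = T p2 p3 w \<and> T w p3 p2 = T w p2 p3 \<and>
    T p4 p2 w = T p2 p4 w \<and> T w p4 p2 = T w p2 p4 \<and>
    T p5 p2 w = T p2 p5 w \<and> T w p5 p2 = T w p2 p5 \<and>
    T p4 p3 w = T p3 p4 w \<and> T w p4 p3 = T w p3 p4 \<and>
    T p5 p3 w = T p3 p5 w \<and> T w p5 p3 = T w p3 p5 \<and>
    T p5 p4 w = T p4 p5 w \<and> T w p5 p4 = T w p4 p5"
  using sym12 sym23 by blast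

text \<open>The monomial \<open>x1 x2 x3\<close> has coefficient 6, the number of orderings of its
  factors. With 6 taken out, the numbers 1, 1/2 and 1/6 are the numbers of orderings of the other
  monomials divided by 6.\<close>

lemma frame_value:
  assumes "frame A \<alpha> \<mu> \<nu> p1 p2 p3 p4 p5"
  shows "eval F (basis_matrix p1 p2 p3 p4 p5 *v y) = 6 * (y$1 * y$2 * y$3
    + y$1 * (T p1 p4 p4 / 2 * y$4^2 + T p1 p4 p5 * y$4 * y$5 + T p1 p5 p5 / 2 * y$5^2)
    + y$2 * (T p2 p4 p4 / 2 * y$4^2 + T p2 p4 p5 * y$4 * y$5 + T p2 p5 p5 / 2 * y$5^2)
    + (T p3 p3 p3 / 6 * y$3^3 + T p3 p3 p4 / 2 * y$3^2 * y$4 + T p3 p3 p5 / 2 * y$3^2 * y$5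
      + T p3 p4 p4 / 2 * y$3 * y$4^2 + T p3 p4 p5 * y$3 * y$4 * y$5 + T p3 p5 p5 / 2 * y$3 * y$5^2
      + T p4 p4 p4 / 6 * y$4^3 + T p4 p4 p5 / 2 * y$4^2 * y$5 + T p4 p5 p5 / 2 * y$4 * y$5^2
      + T p5 p5 p5 / 6 * y$5^3))"
  unfolding F basis_matrix_mult
  by (simp add: expand sort5[of p2 p1 p3 p4 p5] frame_zero[OF assms] power2_eq_square power3_eq_cube)
    (simp add: algebra_simps)

text \<open>Reduces each case to matching coefficients of \<open>T\<close> in a rescaled frame. The
  frame vectors are the columns of the change of coordinates, in which \<open>A\<close> becomes a
  swap followed by a diagonal map.\<close>

lemma frame_has_normal_form:
  assumes frame: "frame A \<alpha> \<mu> \<nu> p1 p2 p3 p4 p5"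
    and nf: "normal_form \<zeta>' \<iota> q1 q2 f3"
    and \<iota>: "\<And>x. \<iota> x = vector [\<alpha> * x$2, \<alpha> * x$1, x$3, \<mu> * x$4, \<nu> * x$5]"
    and q1: "\<And>y. eval q1 y = T p1 p4 p4 / 2 * y$4^2 + T p1 p4 p5 * y$4 * y$5 + T p1 p5 p5 / 2 * y$5^2"
    and q2: "\<And>y. eval q2 y = T p2 p4 p4 / 2 * y$4^2 + T p2 p4 p5 * y$4 * y$5 + T p2 p5 p5 / 2 * y$5^2"
    and f3: "\<And>y. eval f3 y = T p3 p3 p3 / 6 * y$3^3 + T p3 p3 p4 / 2 * y$3^2 * y$4 + T p3 p3 p5 / 2 * y$3^2 * y$5
      + T p3 p4 p4 / 2 * y$3 * y$4^2 + T p3 p4 p5 * y$3 * y$4 * y$5 + T p3 p5 p5 / 2 * y$3 * y$5^2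
      + T p4 p4 p4 / 6 * y$4^3 + T p4 p4 p5 / 2 * y$4^2 * y$5 + T p4 p5 p5 / 2 * y$4 * y$5^2
      + T p5 p5 p5 / 6 * y$5^3"
  shows "has_normal_form \<zeta>' F g"
proof -
  define P where "P = basis_matrix p1 p2 p3 p4 p5"
  have P: "invertible P"
    unfolding P_def by (rule invertible_basis_matrix[OF frame_spanning[OF frame]])
  have \<iota>': "matrix \<iota> *v x = \<iota> x" for x
    by (simp add: matrix_vector_mult_def matrix_def \<iota> vec_eq_iff forall_5 sum_5 axis_def)
  have "A ** P = P ** matrix \<iota>"
    unfolding matrix_eq using frame
    by (simp add: \<iota>' \<iota> P_def basis_matrix_mult frame_def matrix_vector_right_distrib matrix_mult_scale
        mult.commute add.commute add.left_commute flip: matrix_vector_mul_assoc)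
  then have "A = P ** matrix \<iota> ** matrix_inv P"
    using matrix_inv(1)[OF P] by (metis matrix_mul_assoc matrix_mul_rid)
  then have "g = proj_class (P ** matrix \<iota> ** matrix_inv P)"
    by (simp add: g)
  moreover have "\<forall>y. eval F (P *v y) = 6 * eval (Var 1 * Var 2 * Var 3 + Var 1 * q1 + Var 2 * q2 + f3) y"
    unfolding P_def frame_value[OF frame] by (simp add: q1 q2 f3)
  ultimately show ?thesis
    unfolding has_normal_form_def using P nf by (metis zero_neq_numeral)
qed

text \<open>The nodes share the factor \<open>t\<close> to keep \<alpha>, and \<open>t3\<close>
  compensates \<open>t * t\<close> to keep \<open>T p1 p2 p3 = 1\<close>.\<close>

lemma frame_scale:
  assumes "frame A \<alpha> \<mu> \<nu> p1 p2 p3 p4 p5" and "t * t * t3 = 1" "t4 \<noteq> 0" "t5 \<noteq> 0"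
  shows "frame A \<alpha> \<mu> \<nu> (t *s p1) (t *s p2) (t3 *s p3) (t4 *s p4) (t5 *s p5)"
proof -
  have "t \<noteq> 0" "t3 \<noteq> 0"
    using assms(2) by auto
  then show ?thesis
    using assms unfolding frame_def
    by (auto simp: nodes_scale spanning_scale expand matrix_mult_scale mult_ac)
qed

lemma frame_swap:
  "frame A \<alpha> \<mu> \<nu> p1 p2 p3 p4 p5 \<Longrightarrow> frame A \<alpha> \<nu> \<mu> p1 p2 p3 p5 p4"
  unfolding frame_def by (auto simp: spanning_swap45)

lemma frame_change45:
  assumes "frame A \<alpha> \<mu> \<mu> p1 p2 p3 p4 p5" "a * d \<noteq> b * c"
  shows "frame A \<alpha> \<mu> \<mu> p1 p2 p3 (a *s p4 + b *s p5) (c *s p4 + d *s p5)"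
  using assms unfolding frame_def
  by (auto simp: spanning_change45 expand matrix_mult_scale matrix_vector_right_distrib mult_ac
      vector_add_ldistrib)

text \<open>As \<open>T p1\<close> is multiplied by \<open>j\<close> and \<open>T p2\<close> by
  \<open>- j\<close>, coefficients that were opposite at the two nodes become equal. The product of
  the two factors is 1, which keeps \<open>T p1 p2 p3\<close>.\<close>

lemma frame_flip:
  assumes "frame A \<alpha> \<mu> \<nu> p1 p2 p3 p4 p5" "j * j = - 1"
  shows "frame A (- \<alpha>) \<mu> \<nu> (j *s p1) ((- j) *s p2) p3 p4 p5"
proof -
  have j: "j \<noteq> 0" "- j \<noteq> 0" "j * \<alpha> = - (\<alpha> * - j)"
    using assms(2) by auto
  have "spanning (j *s p1) ((- j) *s p2) (1 *s p3) (1 *s p4) (1 *s p5)"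
    using assms j by (intro spanning_scale) (auto simp: frame_def)
  moreover have "nodes (j *s p1) ((- j) *s p2)"
    using assms(1) j unfolding frame_def by (intro nodes_scale) auto
  ultimately show ?thesis
    using assms unfolding frame_def
    by (auto simp: expand matrix_mult_scale matrix_mult_neg mult_ac simp del: vector_sneg_minus1)
qed

text \<open>A monomial of \<open>f3\<close> survives only if the product of the eigenvalues of its
  vectors is \<open>\<alpha>\<^sup>2\<close>. For the quadratic forms one factor \<alpha> cancels,
  and each relation links a coefficient at one node with that at the other.\<close>

lemma frame_invariance:
  assumes frame: "frame A \<alpha> \<mu> \<nu> p1 p2 p3 p4 p5"
  shows "\<mu>^2 * T p2 p4 p4 = \<alpha> * T p1 p4 p4" "\<mu>^2 * T p1 p4 p4 = \<alpha> * T p2 p4 p4"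
    "\<mu> * \<nu> * T p2 p4 p5 = \<alpha> * T p1 p4 p5" "\<mu> * \<nu> * T p1 p4 p5 = \<alpha> * T p2 p4 p5"
    "\<nu>^2 * T p2 p5 p5 = \<alpha> * T p1 p5 p5" "\<nu>^2 * T p1 p5 p5 = \<alpha> * T p2 p5 p5"
    "T p3 p3 p3 \<noteq> 0 \<Longrightarrow> \<alpha>^2 = 1" "T p3 p3 p4 \<noteq> 0 \<Longrightarrow> \<alpha>^2 = \<mu>" "T p3 p3 p5 \<noteq> 0 \<Longrightarrow> \<alpha>^2 = \<nu>"
    "T p3 p4 p4 \<noteq> 0 \<Longrightarrow> \<alpha>^2 = \<mu>^2" "T p3 p4 p5 \<noteq> 0 \<Longrightarrow> \<alpha>^2 = \<mu> * \<nu>" "T p3 p5 p5 \<noteq> 0 \<Longrightarrow> \<alpha>^2 = \<nu>^2"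
    "T p4 p4 p4 \<noteq> 0 \<Longrightarrow> \<alpha>^2 = \<mu>^3" "T p4 p4 p5 \<noteq> 0 \<Longrightarrow> \<alpha>^2 = \<mu>^2 * \<nu>"
    "T p4 p5 p5 \<noteq> 0 \<Longrightarrow> \<alpha>^2 = \<mu> * \<nu>^2" "T p5 p5 p5 \<noteq> 0 \<Longrightarrow> \<alpha>^2 = \<nu>^3"
proof -
  have \<alpha>: "\<alpha> \<noteq> 0" and inv: "T (A *v u) (A *v v) (A *v w) = \<alpha>\<^sup>2 * T u v w"
    and A: "A *v p1 = \<alpha> *s p2" "A *v p2 = \<alpha> *s p1" "A *v p3 = p3" "A *v p4 = \<mu> *s p4" "A *v p5 = \<nu> *s p5"
    for u v w using frame by (auto simp: frame_def)
  note simps = A expand power2_eq_square power3_eq_cube mult_ac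
  show "\<mu>^2 * T p2 p4 p4 = \<alpha> * T p1 p4 p4" "\<mu>^2 * T p1 p4 p4 = \<alpha> * T p2 p4 p4"
    "\<mu> * \<nu> * T p2 p4 p5 = \<alpha> * T p1 p4 p5" "\<mu> * \<nu> * T p1 p4 p5 = \<alpha> * T p2 p4 p5"
    "\<nu>^2 * T p2 p5 p5 = \<alpha> * T p1 p5 p5" "\<nu>^2 * T p1 p5 p5 = \<alpha> * T p2 p5 p5"
    using inv[of p1 p4 p4] inv[of p2 p4 p4] inv[of p1 p4 p5] inv[of p2 p4 p5] inv[of p1 p5 p5] inv[of p2 p5 p5]
    by (simp_all add: simps \<alpha>)
  show "T p3 p3 p3 \<noteq> 0 \<Longrightarrow> \<alpha>^2 = 1" "T p3 p3 p4 \<noteq> 0 \<Longrightarrow> \<alpha>^2 = \<mu>" "T p3 p3 p5 \<noteq> 0 \<Longrightarrow> \<alpha>^2 = \<nu>"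
    using inv[of p3 p3 p3] inv[of p3 p3 p4] inv[of p3 p3 p5] by (simp_all add: A expand)
  show "T p3 p4 p4 \<noteq> 0 \<Longrightarrow> \<alpha>^2 = \<mu>^2" "T p3 p4 p5 \<noteq> 0 \<Longrightarrow> \<alpha>^2 = \<mu> * \<nu>" "T p3 p5 p5 \<noteq> 0 \<Longrightarrow> \<alpha>^2 = \<nu>^2"
    using inv[of p3 p4 p4] inv[of p3 p4 p5] inv[of p3 p5 p5]
    by (simp_all add: A expand power2_eq_square[of \<mu>] power2_eq_square[of \<nu>] mult.commute[of \<nu> \<mu>] flip: mult.assoc)
  show "T p4 p4 p4 \<noteq> 0 \<Longrightarrow> \<alpha>^2 = \<mu>^3" "T p4 p4 p5 \<noteq> 0 \<Longrightarrow> \<alpha>^2 = \<mu>^2 * \<nu>"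
    "T p4 p5 p5 \<noteq> 0 \<Longrightarrow> \<alpha>^2 = \<mu> * \<nu>^2" "T p5 p5 p5 \<noteq> 0 \<Longrightarrow> \<alpha>^2 = \<nu>^3"
    using inv[of p4 p4 p4] inv[of p4 p4 p5] inv[of p4 p5 p5] inv[of p5 p5 p5]
    by (simp_all add: A expand power2_eq_square[of \<mu>] power2_eq_square[of \<nu>] power3_eq_cube mult.commute[of \<nu> \<mu>] flip: mult.assoc)
      (metis mult.assoc mult.commute)+
qed

section \<open>Nondegeneracy and the exclusion of a third singular point\<close>

lemma frame_nondegenerate:
  assumes "frame A \<alpha> \<mu> \<nu> p1 p2 p3 p4 p5"
    and "x * T p1 p4 p4 + y * T p1 p4 p5 = 0" "x * T p1 p4 p5 + y * T p1 p5 p5 = 0"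
  shows "x = 0 \<and> y = 0"
proof -
  interpret swapped_nodes T p1 p2 A \<alpha>
    by (rule frame_swapped_nodes[OF assms(1)])
  have "adapted p3 p4 p5"
    using assms(1) by (simp add: adapted_def frame_def)
  then show ?thesis
    using nondegenerate assms(2,3) by blast
qed

lemma frame_swap12:
  assumes "frame A \<alpha> \<mu> \<nu> p1 p2 p3 p4 p5"
  shows "frame A \<alpha> \<mu> \<nu> p2 p1 p3 p4 p5"
proof -
  have "nodes p2 p1"
  proof -
    have "\<nexists>t. p1 = t *s p2"
    proof
      assume "\<exists>t. p1 = t *s p2"
      then obtain t where "p1 = t *s p2" ..
      then have "1 *s p1 + (- t) *s p2 + 0 *s p3 + 0 *s p4 + 0 *s p5 = 0"
        by simp
      then have "(1 :: 'k) = 0"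
        by (rule spanning_independent(1)[OF frame_spanning[OF assms]])
      then show False
        by simp
    qed
    then show ?thesis
      using assms unfolding frame_def nodes_def by blast
  qed
  then show ?thesis
    using assms unfolding frame_def by (auto simp: sym12[of p2 p1] spanning_def insert_commute)
qed

text \<open>Otherwise \<open>p3\<close> would be a third singular point.\<close>

lemma frame_singular3:
  assumes frame: "frame A \<alpha> \<mu> \<nu> p1 p2 p3 p4 p5"
  shows "T p3 p3 p3 \<noteq> 0 \<or> T p3 p3 p4 \<noteq> 0 \<or> T p3 p3 p5 \<noteq> 0"
proof (rule ccontr)
  assume *: "\<not> ?thesis"
  have "T p3 p3 w = 0" for w
  proof -
    obtain a b c d e where "w = a *s p1 + b *s p2 + c *s p3 + d *s p4 + e *s p5"
      using spanning_coordinates[OF frame_spanning[OF frame]] by blast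
    then show ?thesis
      using * by (simp add: expand sort5[of p2 p1 p3 p4 p5] frame_zero[OF frame])
  qed
  then obtain t where "p3 = t *s p1 \<or> p3 = t *s p2"
    using frame unfolding frame_def nodes_def by blast
  then have "T p1 p2 p3 = 0"
    using frame_zero(1,2)[OF frame] by (metis expand(6) mult_zero_right sym23 sym12)
  then show False
    by (simp add: frame_zero[OF frame])
qed

lemma quadratic_root:
  assumes "a \<noteq> 0"
  obtains x where "a * x * x + b * x + c = (0 :: 'k)"
proof -
  obtain x where "poly [:c, b, a:] x = 0"
    using alg_closed_imp_poly_has_root[of "[:c, b, a:]"] assms by auto
  then show ?thesis
    using that[of x] by (simp add: algebra_simps)
qed

text \<open>Otherwise \<open>s *s p1 + t *s p2 + y\<close> would be a third singular point for suitable \<open>s\<close> and \<open>t\<close>.\<close>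

lemma frame_singular_isotropic:
  assumes frame: "frame A \<alpha> \<mu> \<nu> p1 p2 p3 p4 p5"
    and y: "y = c *s p4 + d *s p5" "y' = c' *s p4 + d' *s p5" "c * d' \<noteq> d * c'"
    and zero: "T p1 y y = 0" "T p2 y y = 0"
  shows "T y y y \<noteq> 0"
proof
  assume *: "T y y y = 0"
  have spanning: "spanning p1 p2 p3 y y'"
    unfolding y(1,2) using spanning_change45[OF frame_spanning[OF frame] y(3)] .
  have zeros: "T p1 p2 y = 0" "T p1 p2 y' = 0" "T p1 p3 y = 0" "T p1 p3 y' = 0" "T p2 p3 y = 0" "T p2 p3 y' = 0"
    by (simp_all add: y expand frame_zero[OF frame])
  \<comment> \<open>As \<open>y\<close> is isotropic for a nondegenerate form on the plane, it pairs
    nontrivially with the complementary vector \<open>y'\<close>.\<close>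
  have nonzero: "T q y y' \<noteq> 0" if q: "frame A \<alpha> \<mu> \<nu> q q' p3 p4 p5" "T q y y = 0" for q q'
  proof
    assume yy': "T q y y' = 0"
    have sw: "T q p5 p4 = T q p4 p5"
      by (rule sym23)
    define u v where "u = c * T q p4 p4 + d * T q p4 p5" and "v = c * T q p4 p5 + d * T q p5 p5"
    have uv: "c * u + d * v = 0" "c' * u + d' * v = 0"
      using q(2) yy' by (simp_all add: y expand sw u_def v_def algebra_simps)
    have "(c * d' - d * c') * u = d' * (c * u + d * v) - d * (c' * u + d' * v)"
      "(c * d' - d * c') * v = c * (c' * u + d' * v) - c' * (c * u + d * v)"
      by (simp_all add: algebra_simps)
    then have "(c * d' - d * c') * u = 0" "(c * d' - d * c') * v = 0"
      unfolding uv by simp_all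
    then have "u = 0" "v = 0"
      using y(3) by (simp_all only: mult_eq_0_iff right_minus_eq simp_thms)
    then have "c = 0 \<and> d = 0"
      unfolding u_def v_def by (rule frame_nondegenerate[OF q(1)])
    then show False
      using y(3) by simp
  qed
  define a b r e where "a = T p1 y y'" and "b = T p2 y y'" and "r = T y y y'" and "e = T p3 y y"
  have ab: "a \<noteq> 0" "b \<noteq> 0"
    unfolding a_def b_def using nonzero[OF frame zero(1)] nonzero[OF frame_swap12[OF frame] zero(2)] .
  \<comment> \<open>For \<open>v = s *s p1 + t *s p2 + y\<close> the form \<open>T v v\<close>
    vanishes on the nodes and on \<open>y\<close>. At \<open>p3\<close> and \<open>y'\<close> its
    values are \<open>e + 2 * s * t\<close> and \<open>r + 2 * s * a + 2 * t * b\<close>;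
    eliminating \<open>s\<close> leaves this quadratic equation.\<close>
  obtain t where t: "2 * b * t * t + r * t + (- (e * a)) = 0"
    using quadratic_root[of "2 * b" r "- (e * a)"] ab by auto
  define s where "s = - (r + 2 * t * b) / (2 * a)"
  have s: "r + 2 * s * a + 2 * t * b = 0"
  proof -
    have "2 * a \<noteq> 0"
      using ab by simp
    then have "s * (2 * a) = - (r + 2 * t * b)"
      by (rule iffD1[OF nonzero_eq_divide_eq s_def])
    then show ?thesis
      by (simp add: algebra_simps)
  qed
  have "2 * a * (e + 2 * s * t) = - 2 * (2 * b * t * t + r * t + (- (e * a))) + 2 * t * (r + 2 * s * a + 2 * t * b)"
    by (simp add: algebra_simps)
  then have e: "e + 2 * s * t = 0"
    unfolding s t using ab by simp
  define v where "v = s *s p1 + t *s p2 + y"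
  have "T v v w = 0" for w
  proof -
    obtain c1 c2 c3 c4 c5 where w: "w = c1 *s p1 + c2 *s p2 + c3 *s p3 + c4 *s y + c5 *s y'"
      using spanning_coordinates[OF spanning] by blast
    note simps = v_def expand sort5[of p2 p1 p3 y y'] frame_zero(1-3)[OF frame]
      frame_zero(6,9,12,13)[OF frame] zeros zero *
    have "T v v p1 = 0" "T v v p2 = 0" "T v v y = 0"
      by (simp_all add: simps)
    moreover have "T v v p3 = e + 2 * s * t" "T v v y' = r + 2 * s * a + 2 * t * b"
      by (simp_all add: simps a_def b_def r_def e_def)
    ultimately show ?thesis
      unfolding w by (simp add: expand s e)
  qed
  then obtain x where "v = x *s p1 \<or> v = x *s p2"
    using frame unfolding frame_def nodes_def by blast
  then have "(s - x) *s p1 + t *s p2 + 0 *s p3 + 1 *s y + 0 *s y' = 0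
      \<or> s *s p1 + (t - x) *s p2 + 0 *s p3 + 1 *s y + 0 *s y' = 0"
    by (auto simp: v_def algebra_simps)
  then show False
    using spanning_independent(4)[OF spanning] by (metis zero_neq_one)
qed

lemma frame_singular4:
  assumes "frame A \<alpha> \<mu> \<nu> p1 p2 p3 p4 p5" "T p1 p4 p4 = 0" "T p2 p4 p4 = 0"
  shows "T p4 p4 p4 \<noteq> 0"
  using frame_singular_isotropic[OF assms(1), of p4 1 0 p5 0 1] assms(2,3) by simp

end

section \<open>Roots of unity\<close>

lemma root_of_unity_gcd:
  fixes z :: "'k::field"
  assumes "z ^ m = 1" "z ^ n = 1" "m \<noteq> 0"
  shows "z ^ gcd m n = 1"
proof -
  obtain x y where xy: "m * x = n * y + gcd m n"
    using bezout_nat[OF assms(3), of n] by blast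
  have "1 = z ^ (m * x)"
    by (simp add: power_mult assms)
  also have "\<dots> = z ^ gcd m n"
    by (simp add: xy power_add power_mult assms)
  finally show ?thesis
    by simp
qed

text \<open>If \<open>z ^ m = 1\<close> with \<open>0 < m < n\<close>, then also
  \<open>z ^ gcd m n = 1\<close>, and this gcd is a proper divisor of \<open>n\<close>.\<close>

lemma primitive_rootI:
  assumes "n > 0" "z ^ n = 1" "\<And>d. d dvd n \<Longrightarrow> d < n \<Longrightarrow> z ^ d \<noteq> 1"
  shows "primitive_root_of_unity n z"
  unfolding primitive_root_of_unity_def
proof (intro conjI allI impI assms(1,2))
  fix m assume "0 < m \<and> m < n"
  then have "gcd m n < n"
    using gcd_le1_nat[of m n] by linarith
  then have "z ^ gcd m n \<noteq> 1"
    by (intro assms(3)) auto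
  then show "z ^ m \<noteq> 1"
    using root_of_unity_gcd[of z m n] assms(2) \<open>0 < m \<and> m < n\<close> by auto
qed

lemma primitive_root_2: "primitive_root_of_unity 2 (- 1 :: 'k::field_char_0)"
proof (rule primitive_rootI)
  fix d :: nat assume "d dvd 2" "d < 2"
  then have "d = 1"
    by (auto simp: less_2_cases_iff)
  then show "(- 1 :: 'k) ^ d \<noteq> 1"
    by simp
qed auto

lemma primitive_root_3:
  assumes "z ^ 3 = 1" "z \<noteq> 1"
  shows "primitive_root_of_unity 3 z"
proof (rule primitive_rootI)
  fix d :: nat assume d: "d dvd 3" "d < 3"
  then have "d \<in> {0, 1, 2}"
    by auto
  then have "d = 1"
    using d by auto
  then show "z ^ d \<noteq> 1"
    using assms by simp
qed (use assms in auto)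

lemma primitive_root_4:
  assumes "z ^ 2 = - 1"
  shows "primitive_root_of_unity 4 (z :: 'k::field_char_0)"
proof (rule primitive_rootI)
  have z4: "z ^ 4 = (z ^ 2) ^ 2"
    by (simp flip: power_mult)
  then show "z ^ 4 = 1"
    by (simp add: assms)
  fix d :: nat assume d: "d dvd 4" "d < 4"
  then have "d \<in> {0, 1, 2, 3}"
    by auto
  then have "d = 1 \<or> d = 2"
    using d by auto
  then show "z ^ d \<noteq> 1"
    using assms by auto
qed auto

lemma primitive_root_6:
  assumes "z ^ 3 = - 1" "z \<noteq> - 1"
  shows "primitive_root_of_unity 6 (z :: 'k::field_char_0)"
proof (rule primitive_rootI)
  have "z ^ 6 = (z ^ 3) ^ 2"
    by (simp flip: power_mult)
  then show "z ^ 6 = 1"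
    by (simp add: assms)
  have "z ^ 3 = z ^ 2 * z"
    by (simp add: power3_eq_cube power2_eq_square)
  then have "z ^ 2 \<noteq> 1"
    using assms by auto
  fix d :: nat assume d: "d dvd 6" "d < 6"
  then have "d \<in> {0, 1, 2, 3, 4, 5}"
    by auto
  then have "d = 1 \<or> d = 2 \<or> d = 3"
    using d by auto
  then show "z ^ d \<noteq> 1"
    using assms \<open>z ^ 2 \<noteq> 1\<close> by auto
qed auto

text \<open>The value -1 at the exponent 6 excludes the orders 1, 2, 3 and 6; the second hypothesis
  excludes 4.\<close>

lemma primitive_root_12:
  assumes "z ^ 6 = - 1" "z ^ 4 \<noteq> 1"
  shows "primitive_root_of_unity 12 (z :: 'k::field_char_0)"
proof (rule primitive_rootI)
  have "z ^ 12 = (z ^ 6) ^ 2"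
    by (simp flip: power_mult)
  then show "z ^ 12 = 1"
    by (simp add: assms)
  have powers: "z ^ 6 = (z ^ 2) ^ 3" "z ^ 6 = (z ^ 3) ^ 2"
    by (simp_all flip: power_mult)
  have "(1 :: 'k) \<noteq> - 1"
    by simp
  then have z: "z ^ 2 \<noteq> 1" "z ^ 3 \<noteq> 1" "z \<noteq> 1"
    using assms(1) powers by (metis power_one)+
  fix d :: nat assume d: "d dvd 12" "d < 12"
  then have "d \<in> {0..<12}"
    by simp
  then have "d \<in> {0, 1, 2, 3, 4, 5, 6, 7, 8, 9, 10, 11}"
    by (simp add: atLeastLessThan_nat_numeral) blast
  then have "d = 1 \<or> d = 2 \<or> d = 3 \<or> d = 4 \<or> d = 6"
    using d(1) by (auto simp del: One_nat_def)
  then show "z ^ d \<noteq> 1"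
    using assms z by auto
qed auto

text \<open>Comparing eigenvalues that are powers of one primitive root becomes arithmetic of
  exponents, which decides which coefficients vanish.\<close>

lemma primitive_root_power_eq:
  assumes "primitive_root_of_unity n z"
  shows "z ^ i = z ^ j \<longleftrightarrow> i mod n = j mod n"
proof -
  have z: "n > 0" "z ^ n = 1" "\<And>m. 0 < m \<Longrightarrow> m < n \<Longrightarrow> z ^ m \<noteq> 1"
    using assms by (auto simp: primitive_root_of_unity_def)
  have "z \<noteq> 0"
    using z by (metis zero_neq_one power_0_left not_gr_zero)
  have red: "z ^ i = z ^ (i mod n)" for i
  proof -
    have "z ^ i = z ^ (n * (i div n) + i mod n)"
      by simp
    then show ?thesis
      by (simp only: power_add power_mult z(2) power_one mult_1)
  qed
  have "i = j" if "z ^ i = z ^ j" "i < n" "j < n" "i \<le> j" for i j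
  proof (rule ccontr)
    assume "i \<noteq> j"
    have "z ^ j = z ^ i * z ^ (j - i)"
      using that(4) by (metis power_add le_add_diff_inverse)
    then have "z ^ (j - i) = 1"
      using that(1) \<open>z \<noteq> 0\<close> by simp
    then show False
      using z(3)[of "j - i"] that \<open>i \<noteq> j\<close> by auto
  qed
  then have "i = j" if "z ^ i = z ^ j" "i < n" "j < n" for i j
    using that by (metis nat_le_linear)
  then show ?thesis
    using red[of i] red[of j] z(1) by (metis mod_less_divisor)
qed

section \<open>The classification\<close>

context swapped_cubic
begin

text \<open>The choice of roots is existential because the root in the normal form is built from
  eigenvalues of \<open>A\<close> and need not be the given \<open>\<zeta> n\<close>.\<close>

definition recognized :: bool where
  "recognized \<longleftrightarrow> (\<exists>\<zeta>'. (\<forall>n>0. primitive_root_of_unity n (\<zeta>' n)) \<and> has_normal_form \<zeta>' F g)"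

lemma recognizedI: "primitive_root_of_unity n z \<Longrightarrow> has_normal_form (\<zeta>(n := z)) F g \<Longrightarrow> recognized"
  unfolding recognized_def using \<zeta> by (intro exI[of _ "\<zeta>(n := z)"]) simp

lemma recognizedI': "has_normal_form \<zeta> F g \<Longrightarrow> recognized"
  unfolding recognized_def using \<zeta> by blast

section \<open>Frames with known eigenvalues and their normal forms\<close>

lemma frame_rescale:
  assumes frame: "frame A \<alpha> \<mu> \<nu> p1 p2 p3 p4 p5" and t: "t * t * t3 = 1" "t4 \<noteq> 0" "t5 \<noteq> 0"
  obtains q1 q2 q3 q4 q5 where "frame A \<alpha> \<mu> \<nu> q1 q2 q3 q4 q5"
    "T q1 q4 q4 = t * t4 * t4 * T p1 p4 p4" "T q1 q4 q5 = t * t4 * t5 * T p1 p4 p5"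
    "T q1 q5 q5 = t * t5 * t5 * T p1 p5 p5"
    "T q2 q4 q4 = t * t4 * t4 * T p2 p4 p4" "T q2 q4 q5 = t * t4 * t5 * T p2 p4 p5"
    "T q2 q5 q5 = t * t5 * t5 * T p2 p5 p5"
    "T q3 q3 q3 = t3 * t3 * t3 * T p3 p3 p3" "T q3 q3 q4 = t3 * t3 * t4 * T p3 p3 p4"
    "T q3 q3 q5 = t3 * t3 * t5 * T p3 p3 p5"
    "T q4 q4 q4 = t4 * t4 * t4 * T p4 p4 p4" "T q5 q5 q5 = t5 * t5 * t5 * T p5 p5 p5"
  by (rule that[OF frame_scale[OF frame t]]) (simp_all add: expand)

text \<open>The exponents of the eigenvalues serve as weights, with weight 0 for \<open>p3\<close>:
  a coefficient of \<open>f3\<close> survives only if its weights add up to \<open>2 * a\<close>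
  modulo \<open>n\<close>. For numerals the premises are decided by evaluation.\<close>

lemma frame_exponents:
  assumes frame: "frame A \<alpha> \<mu> \<nu> p1 p2 p3 p4 p5" and z: "primitive_root_of_unity n z"
    and "\<alpha> = z ^ a" "\<mu> = z ^ b" "\<nu> = z ^ c"
  shows "2 * a mod n \<noteq> 0 mod n \<Longrightarrow> T p3 p3 p3 = 0"
    "2 * a mod n \<noteq> b mod n \<Longrightarrow> T p3 p3 p4 = 0"
    "2 * a mod n \<noteq> c mod n \<Longrightarrow> T p3 p3 p5 = 0"
    "2 * a mod n \<noteq> 2 * b mod n \<Longrightarrow> T p3 p4 p4 = 0"
    "2 * a mod n \<noteq> (b + c) mod n \<Longrightarrow> T p3 p4 p5 = 0"
    "2 * a mod n \<noteq> 2 * c mod n \<Longrightarrow> T p3 p5 p5 = 0"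
    "2 * a mod n \<noteq> 3 * b mod n \<Longrightarrow> T p4 p4 p4 = 0"
    "2 * a mod n \<noteq> (2 * b + c) mod n \<Longrightarrow> T p4 p4 p5 = 0"
    "2 * a mod n \<noteq> (b + 2 * c) mod n \<Longrightarrow> T p4 p5 p5 = 0"
    "2 * a mod n \<noteq> 3 * c mod n \<Longrightarrow> T p5 p5 p5 = 0"
proof -
  have 2: "\<alpha>^2 = z ^ (2 * a)"
    by (simp add: assms mult.commute flip: power_mult)
  show "2 * a mod n \<noteq> 0 mod n \<Longrightarrow> T p3 p3 p3 = 0"
    "2 * a mod n \<noteq> b mod n \<Longrightarrow> T p3 p3 p4 = 0"
    "2 * a mod n \<noteq> c mod n \<Longrightarrow> T p3 p3 p5 = 0"
    "2 * a mod n \<noteq> 2 * b mod n \<Longrightarrow> T p3 p4 p4 = 0"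
    "2 * a mod n \<noteq> (b + c) mod n \<Longrightarrow> T p3 p4 p5 = 0"
    "2 * a mod n \<noteq> 2 * c mod n \<Longrightarrow> T p3 p5 p5 = 0"
    "2 * a mod n \<noteq> 3 * b mod n \<Longrightarrow> T p4 p4 p4 = 0"
    "2 * a mod n \<noteq> (2 * b + c) mod n \<Longrightarrow> T p4 p4 p5 = 0"
    "2 * a mod n \<noteq> (b + 2 * c) mod n \<Longrightarrow> T p4 p5 p5 = 0"
    "2 * a mod n \<noteq> 3 * c mod n \<Longrightarrow> T p5 p5 p5 = 0"
    using frame_invariance(7-16)[OF frame]
    unfolding 2 unfolding assms(3-5)
    by (metis primitive_root_power_eq[OF z] power_0 power_add power_mult mult.commute)+
qed

lemma nth_root:
  assumes "n > 0" "c \<noteq> (0 :: 'k)"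
  obtains x where "x \<noteq> 0" "x ^ n = c"
proof -
  obtain x where "x ^ n = c"
    using nth_root_exists[OF assms(1)] by blast
  then show ?thesis
    using that[of x] assms by (metis zero_power)
qed

lemma case_C2:
  assumes frame0: "frame A 1 1 1 p1 p2 p3 p4 p5"
    and q: "T p1 p4 p4 = 0" "T p1 p5 p5 = 0" "T p2 p4 p4 = 0" "T p2 p5 p5 = 0"
    "T p1 p4 p5 \<noteq> 0" "T p2 p4 p5 = T p1 p4 p5"
  shows recognized
proof -
  define b where "b = T p1 p4 p5"
  have b: "T p1 p4 p5 = b" "T p2 p4 p5 = b" "b \<noteq> 0"
    using q by (auto simp: b_def)
  obtain q1 q2 q3 q4 q5 where frame: "frame A 1 1 1 q1 q2 q3 q4 q5"
    and "T q1 q4 q4 = 0" "T q1 q5 q5 = 0" "T q2 q4 q4 = 0" "T q2 q5 q5 = 0" "T q1 q4 q5 = 1" "T q2 q4 q5 = 1"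
    by (rule frame_rescale[OF frame0, of 1 1 "1 / b" 1]) (use b in \<open>simp_all add: q(1-4)\<close>)
  note q' = this
  define f3 where "f3 = Const (T q3 q3 q3 / 6) * Var 3 * Var 3 * Var 3
    + Const (T q3 q3 q4 / 2) * Var 3 * Var 3 * Var 4 + Const (T q3 q3 q5 / 2) * Var 3 * Var 3 * Var 5
    + Const (T q3 q4 q4 / 2) * Var 3 * Var 4 * Var 4 + Const (T q3 q4 q5) * Var 3 * Var 4 * Var 5
    + Const (T q3 q5 q5 / 2) * Var 3 * Var 5 * Var 5 + Const (T q4 q4 q4 / 6) * Var 4 * Var 4 * Var 4
    + Const (T q4 q4 q5 / 2) * Var 4 * Var 4 * Var 5 + Const (T q4 q5 q5 / 2) * Var 4 * Var 5 * Var 5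
    + Const (T q5 q5 q5 / 6) * Var 5 * Var 5 * Var 5"
  have "is_form 3 f3" "vars f3 \<subseteq> {3, 4, 5}"
    unfolding f3_def by (intro is_form_add is_form_Const_Var3 vars_add vars_mult vars_Const vars_Var; simp)+
  from normal_form.C2[OF this, of \<zeta>] have "has_normal_form \<zeta> F g"
    by (rule frame_has_normal_form[OF frame])
      (simp_all add: q' f3_def power2_eq_square power3_eq_cube mult.assoc)
  then show ?thesis
    by (rule recognizedI')
qed

lemma case_C6:
  assumes frame0: "frame A 1 z (z^2) p1 p2 p3 p4 p5" and z: "primitive_root_of_unity 3 z"
    and q: "T p1 p4 p4 = 0" "T p1 p5 p5 = 0" "T p2 p4 p4 = 0" "T p2 p5 p5 = 0"
    "T p1 p4 p5 \<noteq> 0" "T p2 p4 p5 = T p1 p4 p5" and f: "T p4 p4 p4 \<noteq> 0" "T p5 p5 p5 \<noteq> 0"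
  shows recognized
proof -
  define b where "b = T p1 p4 p5"
  have b: "T p1 p4 p5 = b" "T p2 p4 p5 = b" "b \<noteq> 0"
    using q by (auto simp: b_def)
  note exps = frame_exponents[OF _ z, of _ _ _ _ _ _ _ _ 0 1 2]
  \<comment> \<open>Of the monomials divisible by \<open>x3^2\<close> only \<open>x3^3\<close> is
    invariant.\<close>
  have f3: "T p3 p3 p3 \<noteq> 0"
    using frame_singular3[OF frame0] exps(2,3)[OF frame0] by auto
  obtain t3 where t3: "t3 \<noteq> 0" "t3 ^ 3 = 6 / T p3 p3 p3"
    using nth_root[of 3 "6 / T p3 p3 p3"] f3 by auto
  obtain t where t: "t \<noteq> 0" "t ^ 2 = 1 / t3"
    using nth_root[of 2 "1 / t3"] t3 by auto
  \<comment> \<open>The ratio \<open>r\<close> of the factors of \<open>p5\<close> and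
    \<open>p4\<close> equalizes the coefficients of \<open>x4^3\<close> and \<open>x5^3\<close>, so
    that \<open>t4\<close> remains free for normalizing \<open>x4 x5\<close>.\<close>
  obtain r where r: "r \<noteq> 0" "r ^ 3 = T p4 p4 p4 / T p5 p5 p5"
    using nth_root[of 3 "T p4 p4 p4 / T p5 p5 p5"] f by auto
  obtain t4 where t4: "t4 \<noteq> 0" "t4 ^ 2 = 1 / (t * b * r)"
    using nth_root[of 2 "1 / (t * b * r)"] t r b by auto
  have 1: "t * t * t3 = 1" "t * t4 * (r * t4) * b = 1" "t3 * t3 * t3 * T p3 p3 p3 = 6"
    "r * t4 * (r * t4) * (r * t4) * T p5 p5 p5 = t4 * t4 * t4 * T p4 p4 p4"
  proof -
    show "t * t * t3 = 1"
      using t t3 by (simp flip: power2_eq_square)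
    have "t * t4 * (r * t4) * b = t4 ^ 2 * (t * b * r)"
      by (simp add: power2_eq_square mult_ac)
    then show "t * t4 * (r * t4) * b = 1"
      using t4 t b r by simp
    show "t3 * t3 * t3 * T p3 p3 p3 = 6"
      using t3 f3 by (simp flip: power3_eq_cube)
    have "r * t4 * (r * t4) * (r * t4) * T p5 p5 p5 = t4 * t4 * t4 * (r ^ 3 * T p5 p5 p5)"
      by (simp add: power3_eq_cube mult_ac)
    then show "r * t4 * (r * t4) * (r * t4) * T p5 p5 p5 = t4 * t4 * t4 * T p4 p4 p4"
      using r f by simp
  qed
  obtain q1 q2 q3 q4 q5 where frame: "frame A 1 z (z^2) q1 q2 q3 q4 q5"
    and q': "T q1 q4 q4 = 0" "T q1 q5 q5 = 0" "T q2 q4 q4 = 0" "T q2 q5 q5 = 0" "T q1 q4 q5 = 1" "T q2 q4 q5 = 1"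
    "T q3 q3 q3 = 6" "T q5 q5 q5 = T q4 q4 q4"
    by (rule frame_rescale[OF frame0 1(1), of t4 "r * t4"])
      (use t4 r 1 in \<open>simp_all only: b q(1-4) mult_zero_right mult_eq_0_iff simp_thms\<close>)
  have "has_normal_form (\<zeta>(3 := z)) F g"
    by (rule frame_has_normal_form[OF frame
          normal_form.C6[where ?e2.0 = "T q3 q4 q5" and ?r1.0 = "T q4 q4 q4 / 6"]])
      (simp_all add: q' exps[OF frame] algebra_simps)
  then show ?thesis
    by (rule recognizedI[OF z])
qed

lemma case_C2':
  assumes frame0: "frame A (- 1) 1 (- 1) p1 p2 p3 p4 p5"
    and q: "T p2 p4 p4 = - T p1 p4 p4" "T p2 p5 p5 = - T p1 p5 p5"
    "T p1 p4 p5 \<noteq> 0" "T p2 p4 p5 = T p1 p4 p5"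
  shows recognized
proof -
  define b where "b = T p1 p4 p5"
  have b: "T p1 p4 p5 = b" "T p2 p4 p5 = b" "b \<noteq> 0"
    using q by (auto simp: b_def)
  note exps = frame_exponents[OF _ primitive_root_2, of _ _ _ _ _ _ _ _ 1 0 1]
  obtain q1 q2 q3 q4 q5 where frame: "frame A (- 1) 1 (- 1) q1 q2 q3 q4 q5"
    and q': "T q2 q4 q4 = - T q1 q4 q4" "T q2 q5 q5 = - T q1 q5 q5" "T q1 q4 q5 = 1" "T q2 q4 q5 = 1"
    by (rule frame_rescale[OF frame0, of 1 1 "1 / b" 1]) (use b in \<open>simp_all add: q(1,2)\<close>)
  have "has_normal_form \<zeta> F g"
    by (rule frame_has_normal_form[OF frame
          normal_form.C2'[where ?a1.0 = "T q1 q4 q4 / 2" and ?a3.0 = "T q1 q5 q5 / 2" and ?c1.0 = "T q3 q3 q3 / 6"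
            and ?d1.0 = "T q3 q3 q4 / 2" and ?e1.0 = "T q3 q4 q4 / 2" and ?e3.0 = "T q3 q5 q5 / 2"
            and ?r1.0 = "T q4 q4 q4 / 6" and ?r3.0 = "T q4 q5 q5 / 2"]])
      (simp_all add: q' exps[OF frame] algebra_simps)
  then show ?thesis
    by (rule recognizedI')
qed

lemma case_C2'':
  assumes frame0: "frame A 1 1 (- 1) p1 p2 p3 p4 p5"
    and q: "T p1 p4 p5 = 0" "T p2 p4 p5 = 0" "T p2 p4 p4 = T p1 p4 p4" "T p2 p5 p5 = T p1 p5 p5"
    "T p1 p4 p4 \<noteq> 0" "T p1 p5 p5 \<noteq> 0"
  shows recognized
proof -
  obtain t4 where t4: "t4 \<noteq> 0" "t4 ^ 2 = 2 / T p1 p4 p4"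
    using nth_root[of 2 "2 / T p1 p4 p4"] q by auto
  obtain t5 where t5: "t5 \<noteq> 0" "t5 ^ 2 = 2 / T p1 p5 p5"
    using nth_root[of 2 "2 / T p1 p5 p5"] q by auto
  note exps = frame_exponents[OF _ primitive_root_2, of _ _ _ _ _ _ _ _ 0 0 1]
  have 1: "1 * t4 * t4 * T p1 p4 p4 = 2" "1 * t5 * t5 * T p1 p5 p5 = 2"
    using t4 t5 q by (simp_all flip: power2_eq_square)
  obtain q1 q2 q3 q4 q5 where frame: "frame A 1 1 (- 1) q1 q2 q3 q4 q5"
    and q': "T q1 q4 q5 = 0" "T q2 q4 q5 = 0" "T q2 q4 q4 = 2" "T q2 q5 q5 = 2" "T q1 q4 q4 = 2" "T q1 q5 q5 = 2"
    by (rule frame_rescale[OF frame0, of 1 1 t4 t5])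
      (use t4 t5 1 in \<open>simp_all only: q(1-4) mult_1 mult_zero_right simp_thms\<close>)
  have "has_normal_form \<zeta> F g"
    by (rule frame_has_normal_form[OF frame
          normal_form.C2''[where ?c1.0 = "T q3 q3 q3 / 6"
            and ?d1.0 = "T q3 q3 q4 / 2" and ?e1.0 = "T q3 q4 q4 / 2" and ?e3.0 = "T q3 q5 q5 / 2"
            and ?r1.0 = "T q4 q4 q4 / 6" and ?r3.0 = "T q4 q5 q5 / 2"]])
      (simp_all add: q' exps[OF frame] algebra_simps)
  then show ?thesis
    by (rule recognizedI')
qed

lemma case_C4:
  assumes frame0: "frame A 1 z (- z) p1 p2 p3 p4 p5" and z2: "z^2 = - 1"
    and q: "T p2 p4 p4 = - T p1 p4 p4" "T p2 p5 p5 = - T p1 p5 p5"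
    "T p1 p4 p5 \<noteq> 0" "T p2 p4 p5 = T p1 p4 p5"
  shows recognized
proof -
  define b where "b = T p1 p4 p5"
  have b: "T p1 p4 p5 = b" "T p2 p4 p5 = b" "b \<noteq> 0"
    using q by (auto simp: b_def)
  have z: "primitive_root_of_unity 4 z"
    by (rule primitive_root_4[OF z2])
  have z3: "- z = z ^ 3"
    using z2 by (simp add: power3_eq_cube power2_eq_square)
  note exps = frame_exponents[OF _ z, of _ _ _ _ _ _ _ _ 0 1 3, OF _ _ _ z3]
  have f3: "T p3 p3 p3 \<noteq> 0"
    using frame_singular3[OF frame0] exps(2,3)[OF frame0] by auto
  obtain t3 where t3: "t3 \<noteq> 0" "t3 ^ 3 = 6 / T p3 p3 p3"
    using nth_root[of 3 "6 / T p3 p3 p3"] f3 by auto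
  obtain t where t: "t \<noteq> 0" "t ^ 2 = 1 / t3"
    using nth_root[of 2 "1 / t3"] t3 by auto
  have "t * t * t3 = 1" "t * (1 / (t * b)) * 1 * b = 1"
    using t t3 b by (simp_all flip: power2_eq_square)
  moreover have "t3 * t3 * t3 * T p3 p3 p3 = 6"
    using t3 f3 by (simp flip: power3_eq_cube)
  ultimately have 1: "t * t * t3 = 1" "t3 * t3 * t3 * T p3 p3 p3 = 6" "t * (1 / (t * b)) * 1 * b = 1"
    by simp_all
  obtain q1 q2 q3 q4 q5 where frame: "frame A 1 z (- z) q1 q2 q3 q4 q5"
    and q': "T q2 q4 q4 = - T q1 q4 q4" "T q2 q5 q5 = - T q1 q5 q5" "T q1 q4 q5 = 1" "T q2 q4 q5 = 1"
      "T q3 q3 q3 = 6"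
    by (rule frame_rescale[OF frame0 1(1), of "1 / (t * b)" 1]) (use t b 1 in \<open>simp_all add: q(1,2)\<close>)
  have "has_normal_form (\<zeta>(4 := z)) F g"
    by (rule frame_has_normal_form[OF frame
          normal_form.C4[where ?a1.0 = "T q1 q4 q4 / 2" and ?a3.0 = "T q1 q5 q5 / 2" and ?e2.0 = "T q3 q4 q5"]])
      (simp_all add: q' exps[OF frame] algebra_simps)
  then show ?thesis
    by (rule recognizedI[OF z])
qed

lemma case_C4':
  assumes frame0: "frame A 1 1 z p1 p2 p3 p4 p5" and z2: "z^2 = - 1"
    and q: "T p1 p4 p5 = 0" "T p2 p4 p5 = 0" "T p2 p4 p4 = T p1 p4 p4" "T p2 p5 p5 = - T p1 p5 p5"
    "T p1 p4 p4 \<noteq> 0" "T p1 p5 p5 \<noteq> 0"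
  shows recognized
proof -
  obtain t4 where t4: "t4 \<noteq> 0" "t4 ^ 2 = 2 / T p1 p4 p4"
    using nth_root[of 2 "2 / T p1 p4 p4"] q by auto
  obtain t5 where t5: "t5 \<noteq> 0" "t5 ^ 2 = - 2 / T p1 p5 p5"
    using nth_root[of 2 "- 2 / T p1 p5 p5"] q by auto
  have z: "primitive_root_of_unity 4 z"
    by (rule primitive_root_4[OF z2])
  note exps = frame_exponents[OF _ z, of _ _ _ _ _ _ _ _ 0 0 1]
  have 1: "1 * t4 * t4 * T p1 p4 p4 = 2" "1 * t5 * t5 * T p1 p5 p5 = - 2"
    using t4 t5 q by (simp_all flip: power2_eq_square)
  obtain q1 q2 q3 q4 q5 where frame: "frame A 1 1 z q1 q2 q3 q4 q5"
    and q': "T q1 q4 q5 = 0" "T q2 q4 q5 = 0" "T q2 q4 q4 = 2" "T q2 q5 q5 = 2" "T q1 q4 q4 = 2" "T q1 q5 q5 = - 2"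
    by (rule frame_rescale[OF frame0, of 1 1 t4 t5])
      (use t4 t5 1 in \<open>simp_all only: q(1-4) mult_1 mult_zero_right mult_minus_right minus_minus simp_thms\<close>)
  define f3 where "f3 = Const (T q3 q3 q3 / 6) * Var 3 * Var 3 * Var 3
    + Const (T q3 q3 q4 / 2) * Var 3 * Var 3 * Var 4
    + Const (T q3 q4 q4 / 2) * Var 3 * Var 4 * Var 4 + Const (T q4 q4 q4 / 6) * Var 4 * Var 4 * Var 4"
  have "is_form 3 f3" "vars f3 \<subseteq> {3, 4}"
    unfolding f3_def by (intro is_form_add is_form_Const_Var3 vars_add vars_mult vars_Const vars_Var; simp)+
  from normal_form.C4'[OF this] have "has_normal_form (\<zeta>(4 := z)) F g"
    by (rule frame_has_normal_form[OF frame])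
      (simp_all add: q' exps[OF frame] f3_def power2_eq_square power3_eq_cube mult.assoc)
  then show ?thesis
    by (rule recognizedI[OF z])
qed

lemma case_C4'':
  assumes frame0: "frame A 1 (- 1) z p1 p2 p3 p4 p5" and z2: "z^2 = - 1"
    and q: "T p1 p4 p5 = 0" "T p2 p4 p5 = 0" "T p2 p4 p4 = T p1 p4 p4" "T p2 p5 p5 = - T p1 p5 p5"
    "T p1 p4 p4 \<noteq> 0" "T p1 p5 p5 \<noteq> 0"
  shows recognized
proof -
  have z: "primitive_root_of_unity 4 z"
    by (rule primitive_root_4[OF z2])
  note exps = frame_exponents[OF _ z, of _ _ _ _ _ _ _ _ 0 2 1, OF _ _ z2[symmetric]]
  have f3: "T p3 p3 p3 \<noteq> 0"
    using frame_singular3[OF frame0] exps(2,3)[OF frame0] by auto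
  obtain t3 where t3: "t3 \<noteq> 0" "t3 ^ 3 = 6 / T p3 p3 p3"
    using nth_root[of 3 "6 / T p3 p3 p3"] f3 by auto
  obtain t where t: "t \<noteq> 0" "t ^ 2 = 1 / t3"
    using nth_root[of 2 "1 / t3"] t3 by auto
  obtain t4 where t4: "t4 \<noteq> 0" "t4 ^ 2 = 2 / (t * T p1 p4 p4)"
    using nth_root[of 2 "2 / (t * T p1 p4 p4)"] q t by auto
  obtain t5 where t5: "t5 \<noteq> 0" "t5 ^ 2 = - 2 / (t * T p1 p5 p5)"
    using nth_root[of 2 "- 2 / (t * T p1 p5 p5)"] q t by auto
  have 1: "t * t * t3 = 1" "t3 * t3 * t3 * T p3 p3 p3 = 6"
    using t t3 f3 by (simp flip: power2_eq_square) (use t3 f3 in \<open>simp flip: power3_eq_cube\<close>)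
  have "t * t4 * t4 * T p1 p4 p4 = t4 ^ 2 * (t * T p1 p4 p4)"
    "t * t5 * t5 * T p1 p5 p5 = t5 ^ 2 * (t * T p1 p5 p5)"
    by (simp_all add: power2_eq_square mult_ac)
  then have 2: "t * t4 * t4 * T p1 p4 p4 = 2" "t * t5 * t5 * T p1 p5 p5 = - 2"
    using t t4 t5 q by simp_all
  obtain q1 q2 q3 q4 q5 where frame: "frame A 1 (- 1) z q1 q2 q3 q4 q5"
    and q': "T q1 q4 q5 = 0" "T q2 q4 q5 = 0" "T q2 q4 q4 = 2" "T q2 q5 q5 = 2" "T q1 q4 q4 = 2" "T q1 q5 q5 = - 2"
      "T q3 q3 q3 = 6"
    by (rule frame_rescale[OF frame0 1(1), of t4 t5])
      (use t4 t5 1 2 in \<open>simp_all only: q(1-4) mult_zero_right mult_minus_right minus_minus simp_thms\<close>)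
  have "has_normal_form (\<zeta>(4 := z)) F g"
    by (rule frame_has_normal_form[OF frame
          normal_form.C4''[where ?e1.0 = "T q3 q4 q4 / 2" and ?r3.0 = "T q4 q5 q5 / 2"]])
      (simp_all add: q' exps[OF frame])
  then show ?thesis
    by (rule recognizedI[OF z])
qed

lemma case_C6':
  assumes frame0: "frame A z (z^5) (z^2) p1 p2 p3 p4 p5" and z: "primitive_root_of_unity 6 z"
    and q: "T p2 p4 p4 = - T p1 p4 p4" "T p2 p5 p5 = - T p1 p5 p5"
    "T p1 p4 p5 \<noteq> 0" "T p2 p4 p5 = T p1 p4 p5"
  shows recognized
proof -
  define b where "b = T p1 p4 p5"
  have b: "T p1 p4 p5 = b" "T p2 p4 p5 = b" "b \<noteq> 0"
    using q by (auto simp: b_def)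
  note exps = frame_exponents[OF _ z, of _ _ _ _ _ _ _ _ 1 5 2]
  \<comment> \<open>The multiplier is \<open>z ^ 2\<close>, the eigenvalue of \<open>p5\<close>, so
    \<open>x3^2 x5\<close> takes the place of \<open>x3^3\<close>. It is normalized by scaling
    \<open>p5\<close> alone.\<close>
  have f: "T p3 p3 p5 \<noteq> 0"
    using frame_singular3[OF frame0] exps(1,2)[OF frame0] by auto
  define t5 where "t5 = 2 / T p3 p3 p5"
  have t5: "t5 \<noteq> 0" "t5 * T p3 p3 p5 = 2"
    using f by (simp_all add: t5_def)
  have 1: "1 * (1 / (t5 * b)) * t5 * b = 1"
    using t5 b by simp
  obtain q1 q2 q3 q4 q5 where frame: "frame A z (z^5) (z^2) q1 q2 q3 q4 q5"
    and q': "T q2 q4 q4 = - T q1 q4 q4" "T q2 q5 q5 = - T q1 q5 q5" "T q1 q4 q5 = 1" "T q2 q4 q5 = 1"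
      "T q3 q3 q5 = 2"
    by (rule frame_rescale[OF frame0, of 1 1 "1 / (t5 * b)" t5]) (use t5 b 1 in \<open>simp_all add: q(1,2)\<close>)
  have "has_normal_form (\<zeta>(6 := z)) F g"
    by (rule frame_has_normal_form[OF frame
          normal_form.C6'[where ?a1.0 = "T q1 q4 q4 / 2" and ?a3.0 = "T q1 q5 q5 / 2"]])
      (simp_all add: q' exps[OF frame])
  then show ?thesis
    by (rule recognizedI[OF z])
qed

lemma case_C12:
  assumes frame0: "frame A (z^8) (z^4) z p1 p2 p3 p4 p5" and z: "primitive_root_of_unity 12 z"
    and q: "T p1 p4 p5 = 0" "T p2 p4 p5 = 0" "T p2 p4 p4 = T p1 p4 p4" "T p2 p5 p5 = - T p1 p5 p5"
    "T p1 p4 p4 \<noteq> 0" "T p1 p5 p5 \<noteq> 0"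
  shows recognized
proof -
  note exps = frame_exponents[OF _ z, of _ _ _ _ _ _ _ _ 8 4 1]
  have f: "T p3 p3 p4 \<noteq> 0"
    using frame_singular3[OF frame0] exps(1,3)[OF frame0] by auto
  \<comment> \<open>Normalizing \<open>x1 x2 x3\<close> and \<open>x3^2 x4\<close> forces
    \<open>t3 = 1 / t^2\<close> and \<open>t4 = 2 * t^4 / T p3 p3 p4\<close>. Coefficient 1 of
    \<open>x4^2\<close> in \<open>q1\<close> then prescribes the ninth power of
    \<open>t\<close>.\<close>
  obtain t where t: "t \<noteq> 0" "t ^ 9 = T p3 p3 p4 ^ 2 / (2 * T p1 p4 p4)"
    using nth_root[of 9 "T p3 p3 p4 ^ 2 / (2 * T p1 p4 p4)"] q f by auto
  define t3 t4 where "t3 = 1 / t^2" and "t4 = 2 * t^4 / T p3 p3 p4"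
  obtain t5 where t5: "t5 \<noteq> 0" "t5 ^ 2 = - 2 / (t * T p1 p5 p5)"
    using nth_root[of 2 "- 2 / (t * T p1 p5 p5)"] q t by auto
  have "t4 \<noteq> 0"
    using t f by (simp add: t4_def)
  have 1: "t * t * t3 = 1"
    using t by (simp add: t3_def flip: power2_eq_square)
  have "t3 * t3 = 1 / t^4"
    by (simp add: t3_def power4_eq_xxxx power2_eq_square)
  then have 3: "t3 * t3 * t4 * T p3 p3 p4 = 2"
    using t f by (simp add: t4_def)
  have "t * t4 * t4 * T p1 p4 p4 = t ^ 9 * (4 * T p1 p4 p4 / T p3 p3 p4 ^ 2)"
    by (simp add: t4_def power2_eq_square flip: power_add power_Suc)
  then have 4: "t * t4 * t4 * T p1 p4 p4 = 2"
    unfolding t(2) using q f by (simp add: field_simps)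
  have "t * t5 * t5 * T p1 p5 p5 = t5 ^ 2 * (t * T p1 p5 p5)"
    by (simp_all add: power2_eq_square mult_ac)
  then have 5: "t * t5 * t5 * T p1 p5 p5 = - 2"
    using t t5 q by simp
  obtain q1 q2 q3 q4 q5 where frame: "frame A (z^8) (z^4) z q1 q2 q3 q4 q5"
    and q': "T q1 q4 q5 = 0" "T q2 q4 q5 = 0" "T q2 q4 q4 = 2" "T q2 q5 q5 = 2" "T q1 q4 q4 = 2" "T q1 q5 q5 = - 2"
      "T q3 q3 q4 = 2"
    by (rule frame_rescale[OF frame0 1, of t4 t5])
      (use \<open>t4 \<noteq> 0\<close> t5 1 3 4 5 in \<open>simp_all only: q(1-4) mult_zero_right mult_minus_right minus_minus simp_thms\<close>)
  have "has_normal_form (\<zeta>(12 := z)) F g"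
    by (rule frame_has_normal_form[OF frame normal_form.C12])
      (simp_all add: q' exps[OF frame])
  then show ?thesis
    by (rule recognizedI[OF z])
qed

section \<open>Eigenvalues determined by the quadratic forms\<close>

lemma case_isotropic:
  assumes frame: "frame A \<alpha> \<mu> \<nu> p1 p2 p3 p4 p5"
    and q: "T p1 p4 p4 = 0" "T p1 p5 p5 = 0" "T p2 p4 p4 = 0" "T p2 p5 p5 = 0"
    "T p1 p4 p5 \<noteq> 0" "T p2 p4 p5 = T p1 p4 p5"
  shows recognized
proof -
  \<comment> \<open>Both quadratic forms are multiples of \<open>x4 x5\<close>, so \<open>p4\<close>
    and \<open>p5\<close> are common zeros.\<close>
  have f: "T p4 p4 p4 \<noteq> 0" "T p5 p5 p5 \<noteq> 0"
    using frame_singular4[OF frame] frame_singular4[OF frame_swap[OF frame]] q by auto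
  have "\<mu> * \<nu> = \<alpha>"
    using frame_invariance(3)[OF frame] q by simp
  moreover have "\<alpha> \<noteq> 0"
    using frame by (simp add: frame_def)
  ultimately have \<alpha>: "\<alpha> = \<mu> * \<nu>" "\<mu> \<noteq> 0" "\<nu> \<noteq> 0"
    by auto
  \<comment> \<open>Here \<open>\<alpha>\<^sup>2\<close> equals both \<open>\<mu>^3\<close> and
    \<open>\<nu>^3\<close>. Together with \<open>\<alpha> = \<mu> * \<nu>\<close> this leaves a cube
    root of unity \<mu> and its square \<nu>.\<close>
  have "\<mu>^2 * \<nu>^2 = \<mu>^2 * \<mu>" "\<mu>^2 * \<nu>^2 = \<nu> * \<nu>^2"
    using frame_invariance(13,16)[OF frame] f
    by (simp_all add: \<alpha>(1) power_mult_distrib power2_eq_square power3_eq_cube)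
  then have "\<nu>^2 = \<mu>" and \<nu>: "\<nu> = \<mu>^2"
    using \<alpha> by simp_all
  then have "\<mu> ^ 3 * \<mu> = 1 * \<mu>"
    by (simp add: power3_eq_cube power2_eq_square mult.assoc)
  then have \<mu>3: "\<mu> ^ 3 = 1"
    using \<alpha>(2) by simp
  have "\<alpha> = 1"
    using \<mu>3 by (simp add: \<alpha>(1) \<nu> power3_eq_cube power2_eq_square mult.assoc)
  with frame \<nu> have frame': "frame A 1 \<mu> (\<mu>^2) p1 p2 p3 p4 p5"
    by simp
  show ?thesis
  proof (cases "\<mu> = 1")
    case True
    then show ?thesis
      using case_C2[of p1 p2 p3 p4 p5] frame' q by simp
  next
    case False
    then show ?thesis
      using case_C6[OF frame' primitive_root_3[OF \<mu>3]] q f by simp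
  qed
qed

text \<open>Every basis of the plane is an eigenbasis, so it can be taken along the two isotropic
  lines of \<open>q1 = q2\<close>, which are distinct by nondegeneracy.\<close>

lemma case_scalar:
  assumes frame: "frame A \<alpha> \<mu> \<mu> p1 p2 p3 p4 p5"
    and q: "T p2 p4 p4 = T p1 p4 p4" "T p2 p5 p5 = T p1 p5 p5" "T p2 p4 p5 = T p1 p4 p5"
  shows recognized
proof -
  define a b c where "a = T p1 p4 p4" and "b = T p1 p4 p5" and "c = T p1 p5 p5"
  have nondeg: "x = 0 \<and> y = 0" if "x * a + y * b = 0" "x * b + y * c = 0" for x y
    using that unfolding a_def b_def c_def by (rule frame_nondegenerate[OF frame])
  have sw: "T p1 p5 p4 = b" "T p2 p5 p4 = b"
    using q by (simp_all add: b_def sym23[of _ p5 p4])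
  have val: "T p1 (x *s p4 + y *s p5) (x' *s p4 + y' *s p5) = x * x' * a + (x * y' + y * x') * b + y * y' * c"
    "T p2 (x *s p4 + y *s p5) (x' *s p4 + y' *s p5) = x * x' * a + (x * y' + y * x') * b + y * y' * c" for x y x' y'
    by (simp_all add: expand sw q algebra_simps flip: a_def b_def c_def)
  have finish: recognized if zeros: "x * x * a + 2 * x * y * b + y * y * c = 0"
    "x' * x' * a + 2 * x' * y' * b + y' * y' * c = 0" "x * y' \<noteq> y * x'" for x y x' y'
  proof -
    have frame': "frame A \<alpha> \<mu> \<mu> p1 p2 p3 (x *s p4 + y *s p5) (x' *s p4 + y' *s p5)"
      by (rule frame_change45[OF frame zeros(3)])
    have zeros': "T p1 (x *s p4 + y *s p5) (x *s p4 + y *s p5) = 0" "T p1 (x' *s p4 + y' *s p5) (x' *s p4 + y' *s p5) = 0"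
      using zeros unfolding val by (simp_all add: algebra_simps)
    then have "T p1 (x *s p4 + y *s p5) (x' *s p4 + y' *s p5) \<noteq> 0"
      using frame_nondegenerate[OF frame', of 1 0] by auto
    then show ?thesis
      using case_isotropic[OF frame'] zeros' unfolding val by blast
  qed
  show ?thesis
  proof (cases "a = 0")
    case True
    then have "b \<noteq> 0"
      using nondeg[of 1 0] by auto
    \<comment> \<open>The form \<open>2 * x * y * b + y * y * c\<close> vanishes at
      \<open>(1, 0)\<close> and \<open>(c, - 2 * b)\<close>.\<close>
    then show ?thesis
      using finish[of 1 0 c "- 2 * b"] True by (simp add: algebra_simps)
  next
    case False
    obtain x where x: "a * x * x + 2 * b * x + c = 0"
      using quadratic_root[OF False, of "2 * b" c] by auto
    \<comment> \<open>The other root, from the sum of the roots.\<close>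
    define x' where "x' = - (2 * b + a * x) / a"
    have ax': "a * x' = - (2 * b + a * x)"
      using False by (simp add: x'_def)
    have "a * (a * x' * x' + 2 * b * x' + c) = (a * x') * (a * x') + 2 * b * (a * x') + a * c"
      by (simp add: algebra_simps)
    also have "\<dots> = a * (a * x * x + 2 * b * x + c)"
      unfolding ax' by (simp add: algebra_simps)
    finally have x': "a * x' * x' + 2 * b * x' + c = 0"
      using False x by simp
    have "x \<noteq> x'"
    proof
      assume "x = x'"
      then have "2 * (x * a + 1 * b) = 0"
        using ax' by (simp add: algebra_simps)
      then have 1: "x * a + 1 * b = 0"
        by (metis mult_eq_0_iff zero_neq_numeral)
      have "x * b + 1 * c = (a * x * x + 2 * b * x + c) - x * (x * a + 1 * b)"
        by (simp add: algebra_simps)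
      then have "x * b + 1 * c = 0"
        unfolding x 1 by simp
      then show False
        using nondeg[OF 1] by simp
    qed
    then show ?thesis
      using finish[of x 1 x' 1] x x' by (simp add: mult_ac)
  qed
qed

text \<open>A monomial divisible by \<open>x3^2\<close> occurs and gives \<open>\<mu>^4 = 1\<close>,
  \<open>\<mu>^4 = \<mu>\<close> or \<open>\<mu>^4 = - \<mu>\<close>. The solutions 1 and -1 lead to
  \<open>C2'\<close>, square roots of -1 to \<open>C4\<close>, and the other cube roots of 1 and -1
  to \<open>C6'\<close>. Exchanging \<open>p4\<close> and \<open>p5\<close> replaces \<mu> by
  -\<mu>.\<close>

lemma case_alternating:
  assumes frame: "frame A (- (\<mu>^2)) \<mu> (- \<mu>) p1 p2 p3 p4 p5"
    and q: "T p2 p4 p4 = - T p1 p4 p4" "T p2 p5 p5 = - T p1 p5 p5"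
    "T p1 p4 p5 \<noteq> 0" "T p2 p4 p5 = T p1 p4 p5"
  shows recognized
proof -
  have swap: "frame A (- (\<mu>^2)) (- \<mu>) \<mu> p1 p2 p3 p5 p4" "T p1 p5 p4 \<noteq> 0" "T p2 p5 p4 = T p1 p5 p4"
    using frame_swap[OF frame] q by (simp_all add: sym23[of _ p5 p4])
  have "- (\<mu>^2) \<noteq> 0"
    using frame unfolding frame_def by blast
  then have \<mu>0: "\<mu> \<noteq> 0"
    by simp
  have 4: "(- (\<mu>^2))^2 = \<mu> ^ 4"
    by (simp flip: power_mult)
  consider "\<mu> ^ 4 = 1" | "\<mu> ^ 4 = \<mu>" | "\<mu> ^ 4 = - \<mu>"
    using frame_singular3[OF frame] frame_invariance(7-9)[OF frame] unfolding 4 by blast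
  then consider "\<mu> = 1" | "\<mu> = - 1" | "\<mu>^2 = - 1" | "\<mu>^3 = 1" "\<mu> \<noteq> 1" | "\<mu>^3 = - 1" "\<mu> \<noteq> - 1"
  proof cases
    case 1
    then have "(\<mu>^2)^2 = 1"
      by (simp flip: power_mult)
    then show ?thesis
      using that(1,2,3) unfolding power2_eq_1_iff by blast
  next
    case 2
    then have "\<mu> ^ 3 * \<mu> = 1 * \<mu>"
      by (simp flip: power_Suc2)
    then show ?thesis
      using that(1,4) \<mu>0 by auto
  next
    case 3
    then have "\<mu> ^ 3 * \<mu> = - 1 * \<mu>"
      by (simp flip: power_Suc2)
    then show ?thesis
      using that(2,5) \<mu>0 by (metis mult_right_cancel)
  qed
  then show ?thesis
  proof cases
    case 1
    then show ?thesis
      using case_C2'[of p1 p2 p3 p4 p5] frame q by simp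
  next
    case 2
    then show ?thesis
      using case_C2'[of p1 p2 p3 p5 p4] swap q by simp
  next
    case 3
    then show ?thesis
      using case_C4[of \<mu> p1 p2 p3 p4 p5] frame q by simp
  next
    case 4
    \<comment> \<open>In \<open>C6'\<close> the root is \<alpha> itself. For
      \<open>\<mu>^3 = 1\<close> its square is \<mu> and its fifth power -\<mu>, so
      \<open>p4\<close> and \<open>p5\<close> have to be exchanged.\<close>
    let ?z = "- (\<mu>^2)"
    have pow: "\<mu>^6 = 1" "\<mu>^4 = \<mu>" "\<mu>^10 = \<mu>"
      using 4(1) power_mult[of \<mu> 3 2] power_add[of \<mu> 3 1] power_add[of "\<mu>" 9 1] power_mult[of \<mu> 3 3] by simp_all
    have z: "?z^3 = - 1" "?z^5 = - \<mu>" "?z^2 = \<mu>"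
      using pow by (simp_all flip: power_mult)
    have "?z \<noteq> - 1"
    proof
      assume "?z = - 1"
      then have "?z^2 = (- 1)^2"
        by (simp only:)
      then show False
        unfolding z using 4(2) by simp
    qed
    then have "primitive_root_of_unity 6 ?z"
      using primitive_root_6[OF z(1)] by blast
    moreover have "frame A ?z (?z^5) (?z^2) p1 p2 p3 p5 p4"
      unfolding z by (rule swap)
    ultimately show ?thesis
      using case_C6' swap q by blast
  next
    case 5
    let ?z = "- (\<mu>^2)"
    have pow: "\<mu>^6 = 1" "\<mu>^4 = - \<mu>" "\<mu>^10 = - \<mu>"
      using 5(1) power_mult[of \<mu> 3 2] power_add[of \<mu> 3 1] power_add[of "\<mu>" 9 1] power_mult[of \<mu> 3 3] by simp_all
    have z: "?z^3 = - 1" "?z^5 = \<mu>" "?z^2 = - \<mu>"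
      using pow by (simp_all flip: power_mult)
    have "?z \<noteq> - 1"
    proof
      assume "?z = - 1"
      then have "?z^2 = (- 1)^2"
        by (simp only:)
      then have "- \<mu> = 1"
        unfolding z by simp
      then show False
        using 5(2) by (metis minus_minus)
    qed
    then have "primitive_root_of_unity 6 ?z"
      using primitive_root_6[OF z(1)] by blast
    moreover have "frame A ?z (?z^5) (?z^2) p1 p2 p3 p4 p5"
      unfolding z by (rule frame)
    ultimately show ?thesis
      using case_C6' q by blast
  qed
qed

text \<open>A common zero of the equal forms \<open>q1\<close> and \<open>q2\<close> requires a
  monomial of \<open>f3\<close> in \<open>x4\<close>, \<open>x5\<close>, and its eigenvalue is
  \<open>\<mu>^3\<close> or \<open>- (\<mu>^3)\<close>. As the multiplier is \<open>\<mu>^4\<close>,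
  only \<open>\<mu> = 1\<close> and \<open>\<mu> = - 1\<close> remain, related by exchanging
  \<open>p4\<close> and \<open>p5\<close>.\<close>

lemma case_diagonal:
  assumes frame: "frame A (\<mu>^2) \<mu> (- \<mu>) p1 p2 p3 p4 p5"
    and q: "T p1 p4 p5 = 0" "T p2 p4 p5 = 0" "T p2 p4 p4 = T p1 p4 p4" "T p2 p5 p5 = T p1 p5 p5"
    "T p1 p4 p4 \<noteq> 0" "T p1 p5 p5 \<noteq> 0"
  shows recognized
proof -
  have swap: "frame A (\<mu>^2) (- \<mu>) \<mu> p1 p2 p3 p5 p4" "T p1 p5 p4 = 0" "T p2 p5 p4 = 0"
    using frame_swap[OF frame] q by (simp_all add: sym23[of _ p5 p4])
  have "\<mu>^2 \<noteq> 0"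
    using frame unfolding frame_def by blast
  then have \<mu>0: "\<mu> \<noteq> 0"
    by simp
  obtain x where x: "x ^ 2 = - T p1 p5 p5 / T p1 p4 p4"
    using nth_root_exists[of 2 "- T p1 p5 p5 / T p1 p4 p4"] by auto
  then have x0: "x \<noteq> 0" "x * x * T p1 p4 p4 + T p1 p5 p5 = 0"
    using q by (auto simp flip: power2_eq_square)
  define y where "y = x *s p4 + 1 *s p5"
  have "T p1 y y = 0" "T p2 y y = 0"
    using x0(2) by (simp_all add: y_def expand swap q mult.assoc)
  then have "T y y y \<noteq> 0"
    by (intro frame_singular_isotropic[OF frame y_def, of p4 1 0]) simp_all
  then have "T p4 p4 p4 \<noteq> 0 \<or> T p4 p4 p5 \<noteq> 0 \<or> T p4 p5 p5 \<noteq> 0 \<or> T p5 p5 p5 \<noteq> 0"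
    using sort5[of p5 p4 p3 p2 p1] by (auto simp: y_def expand sym12[of p5 p4] sym23[of _ p5 p4])
  then have "\<mu> ^ 4 = \<mu> ^ 3 \<or> \<mu> ^ 4 = - (\<mu> ^ 3)"
    using frame_invariance(13-16)[OF frame] by (simp add: power3_eq_cube power2_eq_square power4_eq_xxxx mult.assoc) blast
  moreover have "\<mu> ^ 4 = \<mu> ^ 3 * \<mu>"
    by (simp flip: power_Suc2)
  ultimately have "\<mu> ^ 3 * \<mu> = \<mu> ^ 3 * 1 \<or> \<mu> ^ 3 * \<mu> = \<mu> ^ 3 * - 1"
    by simp
  moreover have "\<mu> ^ 3 \<noteq> 0"
    using \<mu>0 by simp
  ultimately have "\<mu> = 1 \<or> \<mu> = - 1"
    using mult_left_cancel by blast
  then show ?thesis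
  proof
    assume "\<mu> = 1"
    then show ?thesis
      using case_C2''[of p1 p2 p3 p4 p5] frame q by simp
  next
    assume "\<mu> = - 1"
    then show ?thesis
      using case_C2''[of p1 p2 p3 p5 p4] swap q by simp
  qed
qed

text \<open>For \<open>\<mu> = 1\<close> and \<open>\<mu> = - 1\<close> the other eigenvalue is a
  square root of -1, which gives \<open>C4'\<close> and \<open>C4''\<close>. For a nontrivial cube
  root \<mu> one finds \<open>\<nu>^4 = \<mu>\<close> and \<open>\<nu>^6 = - 1\<close>, so \<nu> is
  the twelfth root of \<open>C12\<close>.\<close>

lemma case_mixed_aux:
  assumes frame: "frame A (\<mu>^2) \<mu> \<nu> p1 p2 p3 p4 p5" and \<nu>: "\<nu>^2 = - (\<mu>^2)"
    and q: "T p1 p4 p5 = 0" "T p2 p4 p5 = 0" "T p2 p4 p4 = T p1 p4 p4" "T p2 p5 p5 = - T p1 p5 p5"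
    "T p1 p4 p4 \<noteq> 0" "T p1 p5 p5 \<noteq> 0"
    and \<mu>: "\<mu>^2 = 1 \<or> \<mu>^3 = 1"
  shows recognized
proof -
  consider "\<mu> = 1" | "\<mu> = - 1" | "\<mu>^3 = 1" "\<mu> \<noteq> 1"
    using \<mu> unfolding power2_eq_1_iff by blast
  then show ?thesis
  proof cases
    case 1
    then show ?thesis
      using case_C4'[of \<nu> p1 p2 p3 p4 p5] frame q \<nu> by simp
  next
    case 2
    then show ?thesis
      using case_C4''[of \<nu> p1 p2 p3 p4 p5] frame q \<nu> by simp
  next
    case 3
    have pow: "\<mu>^6 = 1" "\<mu>^4 = \<mu>"
      using 3(1) power_mult[of \<mu> 3 2] power_add[of \<mu> 3 1] by simp_all
    have "\<nu>^4 = (\<nu>^2)^2" "\<nu>^6 = (\<nu>^2)^3" "\<nu>^8 = (\<nu>^2)^4"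
      by (simp_all flip: power_mult)
    then have z: "\<nu>^4 = \<mu>" "\<nu>^6 = - 1" "\<nu>^8 = \<mu>^2"
      unfolding \<nu> using pow power_mult[of \<mu> 4 2] by (simp_all flip: power_mult)
    then have "primitive_root_of_unity 12 \<nu>"
      using 3(2) by (intro primitive_root_12) simp_all
    moreover have "frame A (\<nu>^8) (\<nu>^4) \<nu> p1 p2 p3 p4 p5"
      unfolding z by (rule frame)
    ultimately show ?thesis
      using case_C12 q by blast
  qed
qed

text \<open>A monomial divisible by \<open>x3^2\<close> gives \<open>\<mu>^4 = 1\<close>,
  \<open>\<mu>^4 = \<mu>\<close> or, because \<open>\<mu>^4 = \<nu>^4\<close>,
  \<open>\<nu>^4 = \<nu>\<close>. The situation is symmetric in \<mu> and \<nu> up to the sign of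
  \<alpha>, which \<open>frame_flip\<close> changes.\<close>

lemma case_mixed:
  assumes frame: "frame A (\<mu>^2) \<mu> \<nu> p1 p2 p3 p4 p5" and \<nu>: "\<nu>^2 = - (\<mu>^2)"
    and q: "T p1 p4 p5 = 0" "T p2 p4 p5 = 0" "T p2 p4 p4 = T p1 p4 p4" "T p2 p5 p5 = - T p1 p5 p5"
    "T p1 p4 p4 \<noteq> 0" "T p1 p5 p5 \<noteq> 0"
  shows recognized
proof -
  have "\<mu>^2 \<noteq> 0"
    using frame unfolding frame_def by blast
  then have nz: "\<mu> \<noteq> 0" "\<nu> \<noteq> 0"
    using \<nu> by auto
  have 4: "(\<mu>^2)^2 = \<mu> ^ 4" "(- (\<nu>^2))^2 = \<nu> ^ 4" "\<mu>^2 = - (\<nu>^2)" "\<mu> ^ 4 = \<nu> ^ 4"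
  proof -
    show "(\<mu>^2)^2 = \<mu> ^ 4" "(- (\<nu>^2))^2 = \<nu> ^ 4"
      by (simp_all flip: power_mult)
    then show "\<mu>^2 = - (\<nu>^2)" "\<mu> ^ 4 = \<nu> ^ 4"
      using \<nu> by simp_all
  qed
  have cube: "x ^ 3 = 1" if "x ^ 4 = x" "x \<noteq> 0" for x :: 'k
  proof -
    have "x ^ 3 * x = 1 * x"
      using that by (simp flip: power_Suc2)
    then show ?thesis
      using that by simp
  qed
  have square: "\<mu>^2 = 1 \<or> \<nu>^2 = 1" if "\<mu> ^ 4 = 1"
  proof -
    have "(\<mu>^2)^2 = 1"
      using that by (simp flip: power_mult)
    then show ?thesis
      unfolding power2_eq_1_iff[of "\<mu>^2"] \<nu> by auto
  qed
  have "\<mu> ^ 4 = 1 \<or> \<mu> ^ 4 = \<mu> \<or> \<nu> ^ 4 = \<nu>"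
    using frame_singular3[OF frame] frame_invariance(7-9)[OF frame] unfolding 4(1) 4(4) by blast
  then have "(\<mu>^2 = 1 \<or> \<mu>^3 = 1) \<or> (\<nu>^2 = 1 \<or> \<nu>^3 = 1)"
    using cube square nz by blast
  then show ?thesis
  proof
    assume "\<mu>^2 = 1 \<or> \<mu>^3 = 1"
    then show ?thesis
      using case_mixed_aux[OF frame \<nu> q] by blast
  next
    assume \<nu>': "\<nu>^2 = 1 \<or> \<nu>^3 = 1"
    obtain j :: 'k where "j ^ 2 = - 1"
      using nth_root_exists[of 2 "- 1 :: 'k"] by auto
    then have j: "j * j = - 1"
      by (simp add: power2_eq_square)
    then have "j \<noteq> 0"
      by auto
    have frame': "frame A (\<nu>^2) \<nu> \<mu> (j *s p1) ((- j) *s p2) p3 p5 p4"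
      using frame_flip[OF frame_swap[OF frame] j] by (simp only: \<nu>)
    show ?thesis
      by (rule case_mixed_aux[OF frame' 4(3) _ _ _ _ _ _ \<nu>'])
        (use \<open>j \<noteq> 0\<close> in \<open>simp_all add: expand q sym23[of _ p5 p4]\<close>)
  qed
qed

text \<open>Each coefficient of \<open>q2\<close> is plus or minus that of \<open>q1\<close>. A flip
  makes one pair equal: that of \<open>x4 x5\<close> if it is nonzero, otherwise that of
  \<open>x4^2\<close>. The relative sign of the other coefficients then relates \<mu>, \<nu> and
  \<alpha>.\<close>

lemma frame_recognized:
  assumes frame: "frame A \<alpha> \<mu> \<nu> p1 p2 p3 p4 p5"
  shows recognized
proof -
  have \<alpha>: "\<alpha> \<noteq> 0"
    using frame by (simp add: frame_def)
  have sign: "y = x \<or> y = - x" if "m * y = \<alpha> * x" "m * x = \<alpha> * y" for m x y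
  proof -
    have "\<alpha> * (x * x) = m * y * x"
      using that(1) by simp
    also have "\<dots> = \<alpha> * (y * y)"
      using that(2) by (simp add: mult_ac)
    finally show ?thesis
      using \<alpha> by (simp add: square_eq_iff) auto
  qed
  obtain j :: 'k where "j ^ 2 = - 1"
    using nth_root_exists[of 2 "- 1 :: 'k"] by auto
  then have j: "j * j = - 1"
    by (simp add: power2_eq_square)
  then have j0: "j \<noteq> 0"
    by auto
  note inv = frame_invariance[OF frame]
  show ?thesis
  proof (cases "T p1 p4 p5 = 0")
    case False
    have main: recognized if fr: "frame A \<alpha> \<mu> \<nu> p1 p2 p3 p4 p5"
      and eq: "T p2 p4 p5 = T p1 p4 p5" and nz: "T p1 p4 p5 \<noteq> 0" for \<alpha> p1 p2
    proof -
      note inv = frame_invariance[OF fr]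
      have \<alpha>: "\<alpha> = \<mu> * \<nu>" "\<alpha> \<noteq> 0"
        using inv(3) eq nz fr by (simp_all add: frame_def)
      \<comment> \<open>If \<open>x4^2\<close> or \<open>x5^2\<close> occurs, the eigenvalue
        \<open>m\<close> of its vector satisfies \<open>m * m = \<mu> * \<nu>\<close> or
        \<open>m * m = - (\<mu> * \<nu>)\<close>, hence \<open>\<nu> = \<mu>\<close> or
        \<open>\<nu> = - \<mu>\<close>.\<close>
      consider "\<mu> = \<nu>" | "\<mu> \<noteq> \<nu>" "\<nu> = - \<mu>" | "T p1 p4 p4 = 0" "T p1 p5 p5 = 0"
      proof (cases "T p1 p4 p4 = 0 \<and> T p1 p5 p5 = 0")
        case False
        have square: "m * m = \<mu> * \<nu> \<or> m * m = - (\<mu> * \<nu>)"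
          if "x \<noteq> 0" "m^2 * y = \<alpha> * x" "m^2 * x = \<alpha> * y" for m x y
        proof -
          have "m^2 * m^2 * x = \<alpha> * (m^2 * y)"
            unfolding mult.assoc that(3) by (rule mult.left_commute)
          then have "m^2 * m^2 * x = \<alpha> * \<alpha> * x"
            unfolding that(2) mult.assoc .
          then have "m^2 * m^2 = \<alpha> * \<alpha>"
            using that(1) by simp
          then show ?thesis
            unfolding square_eq_iff \<alpha>(1) by (simp add: power2_eq_square)
        qed
        have "\<mu> * \<mu> = \<mu> * \<nu> \<or> \<mu> * \<mu> = \<mu> * - \<nu> \<or> \<nu> * \<nu> = \<mu> * \<nu> \<or> \<nu> * \<nu> = - \<mu> * \<nu>"
          using False square[OF _ inv(1,2)] square[OF _ inv(5,6)]
          unfolding mult_minus_left mult_minus_right by blast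
        moreover have "\<mu> \<noteq> 0" "\<nu> \<noteq> 0"
          using \<alpha> by auto
        ultimately have "\<mu> = \<nu> \<or> \<mu> = - \<nu> \<or> \<nu> = \<mu> \<or> \<nu> = - \<mu>"
          by (simp only: mult_left_cancel mult_right_cancel not_False_eq_True)
        then have "\<mu> = \<nu> \<or> \<nu> = - \<mu>"
          by auto
        then show ?thesis
          using that(1,2) by blast
      qed (use that(3) in blast)
      then show ?thesis
      proof cases
        case 1
        then have "\<alpha> = \<mu>^2" "\<mu> \<noteq> 0"
          using \<alpha> by (auto simp: power2_eq_square)
        then have "T p2 p4 p4 = T p1 p4 p4" "T p2 p5 p5 = T p1 p5 p5"
          using inv(1,5) 1 by simp_all
        then show ?thesis
          using case_scalar[of \<alpha> \<mu> p1 p2 p3 p4 p5] fr eq 1 by simp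
      next
        case 2
        then have \<alpha>': "\<alpha> = - (\<mu>^2)" "\<mu> \<noteq> 0"
          using \<alpha> by (auto simp: power2_eq_square)
        have "\<mu>^2 * T p2 p4 p4 = \<mu>^2 * - T p1 p4 p4" "\<mu>^2 * T p2 p5 p5 = \<mu>^2 * - T p1 p5 p5"
          using inv(1,5) unfolding \<alpha>'(1) 2(2) by simp_all
        then have "T p2 p4 p4 = - T p1 p4 p4" "T p2 p5 p5 = - T p1 p5 p5"
          using \<alpha>'(2) by (simp_all only: mult_left_cancel power_not_zero not_False_eq_True)
        then show ?thesis
          using case_alternating[of \<mu> p1 p2 p3 p4 p5] fr eq nz unfolding \<alpha>' 2(2) by blast
      next
        case 3
        have "T p2 p4 p4 = 0" "T p2 p5 p5 = 0"
          using inv(2,6) \<alpha>(2) 3 by auto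
        then show ?thesis
          using case_isotropic[OF fr] 3 eq nz by blast
      qed
    qed
    consider "T p2 p4 p5 = T p1 p4 p5" | "T p2 p4 p5 = - T p1 p4 p5"
      using sign[OF inv(3,4)] by blast
    then show ?thesis
    proof cases
      case 1
      then show ?thesis
        using main[OF frame] False by blast
    next
      case 2
      then show ?thesis
        by (intro main[OF frame_flip[OF frame j]]) (use False j0 in \<open>simp_all add: expand\<close>)
    qed
  next
    case True
    have main: recognized if fr: "frame A \<alpha> \<mu> \<nu> p1 p2 p3 p4 p5"
      and zero: "T p1 p4 p5 = 0" "T p2 p4 p5 = 0" and eq: "T p2 p4 p4 = T p1 p4 p4"
      and sgn: "T p2 p5 p5 = T p1 p5 p5 \<or> T p2 p5 p5 = - T p1 p5 p5" for \<alpha> p1 p2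
    proof -
      note inv = frame_invariance[OF fr]
      have nz: "T p1 p4 p4 \<noteq> 0" "T p1 p5 p5 \<noteq> 0"
        using frame_nondegenerate[OF fr, of 1 0] frame_nondegenerate[OF fr, of 0 1] zero by auto
      have \<alpha>: "\<alpha> = \<mu>^2"
        using inv(1) eq nz by simp
      from sgn show ?thesis
      proof
        assume eq5: "T p2 p5 p5 = T p1 p5 p5"
        then have "\<nu>^2 = \<mu>^2"
          using inv(5) nz \<alpha> by simp
        then consider "\<nu> = \<mu>" | "\<nu> = - \<mu>"
          unfolding power2_eq_iff by blast
        then show ?thesis
        proof cases
          case 1
          then show ?thesis
            using case_scalar[of \<alpha> \<mu> p1 p2 p3 p4 p5] fr eq eq5 zero by simp
        next
          case 2
          then show ?thesis
            using case_diagonal[of \<mu> p1 p2 p3 p4 p5] fr eq eq5 zero nz unfolding \<alpha> by blast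
        qed
      next
        assume eq5: "T p2 p5 p5 = - T p1 p5 p5"
        then have "- (\<nu>^2) * T p1 p5 p5 = \<mu>^2 * T p1 p5 p5"
          using inv(5) \<alpha> by simp
        then have "- (\<nu>^2) = \<mu>^2"
          using nz(2) by (simp only: mult_right_cancel not_False_eq_True)
        then have "\<nu>^2 = - (\<mu>^2)"
          by (metis minus_minus)
        then show ?thesis
          using case_mixed[of \<mu> \<nu> p1 p2 p3 p4 p5] fr eq eq5 zero nz unfolding \<alpha> by blast
      qed
    qed
    have zero: "T p2 p4 p5 = 0"
      using inv(4) \<alpha> True by auto
    have sgn: "T p2 p5 p5 = T p1 p5 p5 \<or> T p2 p5 p5 = - T p1 p5 p5"
      by (rule sign[OF inv(5,6)])
    consider "T p2 p4 p4 = T p1 p4 p4" | "T p2 p4 p4 = - T p1 p4 p4"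
      using sign[OF inv(1,2)] by blast
    then show ?thesis
    proof cases
      case 1
      then show ?thesis
        using main[OF frame] True zero sgn by blast
    next
      case 2
      then show ?thesis
        by (intro main[OF frame_flip[OF frame j]]) (use True zero sgn j0 in \<open>auto simp: expand\<close>)
    qed
  qed
qed

end

section \<open>Changing the roots of unity\<close>

text \<open>The common shape of all maps in the list. Its square is diagonal, so odd powers keep the
  shape and raise the three factors to the same power.\<close>

definition monomial_swap :: "'k::field \<Rightarrow> 'k \<Rightarrow> 'k \<Rightarrow> 'k^5 \<Rightarrow> 'k^5" where
  "monomial_swap a b c x = vector [a * x$2, a * x$1, x$3, b * x$4, c * x$5]"

lemma monomial_swap_odd_power:
  "monomial_swap a b c ^^ Suc (2 * k) = monomial_swap (a ^ Suc (2 * k)) (b ^ Suc (2 * k)) (c ^ Suc (2 * k))"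
proof (induction k)
  case (Suc k)
  have eq: "monomial_swap a b c ^^ Suc (2 * Suc k) =
      monomial_swap a b c \<circ> monomial_swap a b c \<circ> monomial_swap a b c ^^ Suc (2 * k)"
    by (simp add: comp_assoc)
  show ?case
    unfolding eq Suc by (simp add: fun_eq_iff vec_eq_iff forall_5 monomial_swap_def mult_ac)
qed (simp add: fun_eq_iff monomial_swap_def)

lemma matrix_monomial_swap: "matrix (monomial_swap a b c) *v x = monomial_swap a b c x"
  by (simp add: matrix_vector_mult_def matrix_def monomial_swap_def vec_eq_iff forall_5 sum_5 axis_def)

lemma invertible_monomial_swap:
  fixes a b c :: "'k::field"
  assumes "a \<noteq> 0" "b \<noteq> 0" "c \<noteq> 0"
  shows "invertible (matrix (monomial_swap a b c))"
proof -
  have "x = 0" if "monomial_swap a b c x = 0" for x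
    using that assms by (simp add: vec_eq_iff forall_5 monomial_swap_def)
  then show ?thesis
    by (simp add: invertible_left_inverse matrix_left_invertible_ker matrix_monomial_swap)
qed

text \<open>The \<open>n\<close> distinct powers of \<open>w\<close> exhaust the roots of
  \<open>x^n - 1\<close>, of which there are at most \<open>n\<close>.\<close>

lemma roots_of_unity_powers:
  fixes w z :: "'k::field_char_0"
  assumes w: "primitive_root_of_unity n w" and z: "z ^ n = 1"
  obtains i where "i < n" "z = w ^ i"
proof -
  have n: "n > 0" "w ^ n = 1"
    using w by (auto simp: primitive_root_of_unity_def)
  let ?p = "monom 1 n - 1 :: 'k poly" and ?R = "{x :: 'k. x ^ n = 1}"
  have deg: "degree ?p \<le> n"
    by (intro degree_diff_le) (auto simp: degree_monom_le)
  have "coeff ?p n = 1"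
    using n by simp
  then have nz: "?p \<noteq> 0"
    by (metis coeff_0 zero_neq_one)
  have R: "?R = {x. poly ?p x = 0}"
    by (simp add: poly_monom)
  have "finite ?R" "card ?R \<le> n"
    unfolding R using poly_roots_finite[OF nz] card_poly_roots_bound[OF nz] deg by linarith+
  moreover have sub: "(\<lambda>i. w ^ i) ` {..<n} \<subseteq> ?R"
  proof -
    have "(w ^ i) ^ n = 1" for i
      by (metis n(2) power_mult mult.commute power_one)
    then show ?thesis
      by auto
  qed
  moreover have "inj_on (\<lambda>i. w ^ i) {..<n}"
    by (intro inj_onI) (simp add: primitive_root_power_eq[OF w])
  then have "card ((\<lambda>i. w ^ i) ` {..<n}) = n"
    by (simp add: card_image)
  ultimately have "(\<lambda>i. w ^ i) ` {..<n} = ?R"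
    by (metis card_seteq)
  then show ?thesis
    using that z by blast
qed

text \<open>For these \<open>n\<close> every unit modulo \<open>n\<close> is its own inverse, so one
  exponent leads from \<open>w\<close> to \<open>z\<close> and back. It can be taken odd, because 1,
  5, 7 and 11 represent all units modulo each such \<open>n\<close>.\<close>

lemma conjugate_root:
  fixes w z :: "'k::field_char_0"
  assumes w: "primitive_root_of_unity n w" and z: "primitive_root_of_unity n z" and n: "n \<in> {3, 4, 6, 12}"
  obtains k where "w ^ Suc (2 * k) = z" "z ^ Suc (2 * k) = w"
proof -
  have zp: "z ^ n = 1" "\<And>m. 0 < m \<Longrightarrow> m < n \<Longrightarrow> z ^ m \<noteq> 1"
    using z by (auto simp: primitive_root_of_unity_def)
  obtain i where i: "i < n" "z = w ^ i"
    using roots_of_unity_powers[OF w zp(1)] .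
  \<comment> \<open>If \<open>i\<close> shared a factor with \<open>n\<close>, a smaller power of
    \<open>z\<close> would be 1.\<close>
  have not_dvd: "i * m mod n \<noteq> 0" if "0 < m" "m < n" for m
    using zp(2)[OF that] primitive_root_power_eq[OF w, of "i * m" 0] unfolding i(2) by (auto simp: power_mult)
  have "\<exists>j\<in>{1, 5, 7, 11}. j mod n = i mod n \<and> (j * j) mod n = 1 mod n"
  proof -
    consider "n = 3" | "n = 4" | "n = 6" | "n = 12"
      using n by auto
    then show ?thesis
    proof cases
      case 1
      then have "i < 3" "i * 1 mod 3 \<noteq> 0"
        using i(1) not_dvd[of 1] by simp_all
      then have "i = 1 \<or> i = 2"
        by presburger
      then show ?thesis
        using 1 by auto
    next
      case 2
      then have "i < 4" "i * 2 mod 4 \<noteq> 0"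
        using i(1) not_dvd[of 2] by simp_all
      then have "i = 1 \<or> i = 3"
        by presburger
      then show ?thesis
        using 2 by auto
    next
      case 3
      then have "i < 6" "i * 2 mod 6 \<noteq> 0" "i * 3 mod 6 \<noteq> 0"
        using i(1) not_dvd[of 2] not_dvd[of 3] by simp_all
      then have "i = 1 \<or> i = 5"
        by presburger
      then show ?thesis
        using 3 by auto
    next
      case 4
      then have "i < 12" "i * 4 mod 12 \<noteq> 0" "i * 6 mod 12 \<noteq> 0"
        using i(1) not_dvd[of 4] not_dvd[of 6] by simp_all
      then have "i = 1 \<or> i = 5 \<or> i = 7 \<or> i = 11"
        by presburger
      then show ?thesis
        using 4 by auto
    qed
  qed
  then obtain j where j: "j \<in> {1, 5, 7, 11}" "j mod n = i mod n" "(j * j) mod n = 1 mod n"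
    by blast
  then obtain k where k: "j = Suc (2 * k)"
    by (metis empty_iff insert_iff odd_Suc_minus_one even_Suc odd_one odd_numeral oddE Suc_eq_plus1)
  have "w ^ j = z"
    unfolding i(2) by (simp add: primitive_root_power_eq[OF w] j)
  moreover have "z ^ j = w"
    unfolding \<open>w ^ j = z\<close>[symmetric] power_mult[symmetric]
    using primitive_root_power_eq[OF w, of "j * j" 1] j(3) by simp
  ultimately show ?thesis
    using that unfolding k by blast
qed

text \<open>Only \<iota> involves the roots of unity, the equations do not; an odd power changes the
  roots and keeps the cubic. That the same power leads back ensures that the generated group is
  unchanged.\<close>

lemma normal_form_conjugate:
  fixes \<zeta> \<zeta>' :: "nat \<Rightarrow> 'k::field_char_0"
  assumes nf: "normal_form \<zeta>' \<iota> q1 q2 f3"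
    and \<zeta>: "\<forall>n>0. primitive_root_of_unity n (\<zeta> n)" and \<zeta>': "\<forall>n>0. primitive_root_of_unity n (\<zeta>' n)"
  shows "\<exists>a b c k. a \<noteq> 0 \<and> b \<noteq> 0 \<and> c \<noteq> 0 \<and> \<iota> = monomial_swap a b c \<and>
    normal_form \<zeta> (\<iota> ^^ Suc (2 * k)) q1 q2 f3 \<and> (\<iota> ^^ Suc (2 * k)) ^^ Suc (2 * k) = \<iota>"
    (is ?thesis)
proof -
  have root: "\<exists>k. \<zeta>' n ^ Suc (2 * k) = \<zeta> n \<and> \<zeta> n ^ Suc (2 * k) = \<zeta>' n" if "n \<in> {3, 4, 6, 12}" for n
  proof -
    have "primitive_root_of_unity n (\<zeta>' n)" "primitive_root_of_unity n (\<zeta> n)"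
      using that \<zeta> \<zeta>' by auto
    then show ?thesis
      using conjugate_root that by metis
  qed
  have nz: "\<zeta>' n \<noteq> 0" if "n > 0" for n
    using \<zeta>' that unfolding primitive_root_of_unity_def by (metis power_0_left not_gr_zero zero_neq_one)
  have conj: ?thesis
    if "a \<noteq> 0" "b \<noteq> 0" "c \<noteq> 0" "\<iota> = monomial_swap a b c" "normal_form \<zeta> (monomial_swap a' b' c') q1 q2 f3"
      "a ^ Suc (2 * k) = a'" "b ^ Suc (2 * k) = b'" "c ^ Suc (2 * k) = c'"
      "a' ^ Suc (2 * k) = a" "b' ^ Suc (2 * k) = b" "c' ^ Suc (2 * k) = c" for a b c a' b' c' k
  proof -
    have "\<iota> ^^ Suc (2 * k) = monomial_swap a' b' c'" "monomial_swap a' b' c' ^^ Suc (2 * k) = \<iota>"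
      unfolding that(4) monomial_swap_odd_power that(6-) by (rule refl)+
    then show ?thesis
      using that(1-5) by metis
  qed
  \<comment> \<open>The maps of order 2 contain no roots of unity and are left as they are, with
    \<open>k = 0\<close>.\<close>
  have trivial: ?thesis
    if "a \<noteq> 0" "b \<noteq> 0" "c \<noteq> 0" "\<iota> = monomial_swap a b c" "normal_form \<zeta> \<iota> q1 q2 f3" for a b c
    by (rule conj[of a b c a b c 0]) (use that in simp_all)
  have pow: "(x ^ m) ^ Suc (2 * k) = (x ^ Suc (2 * k)) ^ m" for x :: 'k and m k
    by (metis power_mult mult.commute)
  have neg: "(- x) ^ Suc (2 * k) = - (x ^ Suc (2 * k))" for x :: 'k and k
    by simp
  note swap = monomial_swap_def[abs_def]
  show ?thesis
    using nf
  proof cases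
    case C2
    show ?thesis
      by (rule trivial[of 1 1 1]) (use C2 in \<open>simp_all add: swap normal_form.C2\<close>)
  next
    case (C2' a1 a3 c1 d1 e1 e3 r1 r3)
    show ?thesis
      by (rule trivial[of "- 1" 1 "- 1"]) (use C2' in \<open>simp_all only: normal_form.C2', simp_all add: swap\<close>)
  next
    case (C2'' c1 d1 e1 e3 r1 r3)
    show ?thesis
      by (rule trivial[of 1 1 "- 1"]) (use C2'' in \<open>simp_all only: normal_form.C2'', simp_all add: swap\<close>)
  next
    case (C4 a1 a3 e2)
    obtain k where k: "\<zeta>' 4 ^ Suc (2 * k) = \<zeta> 4" "\<zeta> 4 ^ Suc (2 * k) = \<zeta>' 4"
      using root[of 4] by auto
    have "normal_form \<zeta> (monomial_swap 1 (\<zeta> 4) (- \<zeta> 4)) q1 q2 f3"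
      using normal_form.C4[of \<zeta> a1 a3 e2] unfolding C4 swap by simp
    then show ?thesis
      by (intro conj[of 1 "\<zeta>' 4" "- \<zeta>' 4" 1 "\<zeta> 4" "- \<zeta> 4" k])
        (simp_all only: C4(1) swap k neg power_one neg_equal_0_iff_equal nz zero_less_numeral one_neq_zero
          not_False_eq_True mult_1)
  next
    case (C4' )
    obtain k where k: "\<zeta>' 4 ^ Suc (2 * k) = \<zeta> 4" "\<zeta> 4 ^ Suc (2 * k) = \<zeta>' 4"
      using root[of 4] by auto
    have "normal_form \<zeta> (monomial_swap 1 1 (\<zeta> 4)) q1 q2 f3"
      using normal_form.C4'[of f3 \<zeta>] C4' unfolding swap by simp
    then show ?thesis
      by (intro conj[of 1 1 "\<zeta>' 4" 1 1 "\<zeta> 4" k])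
        (simp_all only: C4'(1) swap k neg power_one nz zero_less_numeral one_neq_zero not_False_eq_True mult_1)
  next
    case (C4'' e1 r3)
    obtain k where k: "\<zeta>' 4 ^ Suc (2 * k) = \<zeta> 4" "\<zeta> 4 ^ Suc (2 * k) = \<zeta>' 4"
      using root[of 4] by auto
    have "normal_form \<zeta> (monomial_swap 1 (- 1) (\<zeta> 4)) q1 q2 f3"
      using normal_form.C4''[of \<zeta> e1 r3] unfolding C4'' swap by simp
    then show ?thesis
      by (intro conj[of 1 "- 1" "\<zeta>' 4" 1 "- 1" "\<zeta> 4" k])
        (simp_all only: C4''(1) swap k neg power_one nz zero_less_numeral one_neq_zero neg_equal_0_iff_equal
          not_False_eq_True mult_1 mult_minus1)
  next
    case (C6 e2 r1)
    obtain k where k: "\<zeta>' 3 ^ Suc (2 * k) = \<zeta> 3" "\<zeta> 3 ^ Suc (2 * k) = \<zeta>' 3"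
      using root[of 3] by auto
    have "normal_form \<zeta> (monomial_swap 1 (\<zeta> 3) (\<zeta> 3 ^ 2)) q1 q2 f3"
      using normal_form.C6[of \<zeta> e2 r1] unfolding C6 swap by simp
    then show ?thesis
      by (intro conj[of 1 "\<zeta>' 3" "\<zeta>' 3 ^ 2" 1 "\<zeta> 3" "\<zeta> 3 ^ 2" k])
        (simp_all only: C6(1) swap k pow power_one nz power_not_zero zero_less_numeral one_neq_zero
          not_False_eq_True mult_1)
  next
    case (C6' a1 a3)
    obtain k where k: "\<zeta>' 6 ^ Suc (2 * k) = \<zeta> 6" "\<zeta> 6 ^ Suc (2 * k) = \<zeta>' 6"
      using root[of 6] by auto
    have "normal_form \<zeta> (monomial_swap (\<zeta> 6) (\<zeta> 6 ^ 5) (\<zeta> 6 ^ 2)) q1 q2 f3"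
      using normal_form.C6'[of \<zeta> a1 a3] unfolding C6' swap by simp
    then show ?thesis
      by (intro conj[of "\<zeta>' 6" "\<zeta>' 6 ^ 5" "\<zeta>' 6 ^ 2" "\<zeta> 6" "\<zeta> 6 ^ 5" "\<zeta> 6 ^ 2" k])
        (simp_all only: C6'(1) swap k pow power_one nz power_not_zero zero_less_numeral
          not_False_eq_True)
  next
    case C12
    obtain k where k: "\<zeta>' 12 ^ Suc (2 * k) = \<zeta> 12" "\<zeta> 12 ^ Suc (2 * k) = \<zeta>' 12"
      using root[of 12] by auto
    have "normal_form \<zeta> (monomial_swap (\<zeta> 12 ^ 8) (\<zeta> 12 ^ 4) (\<zeta> 12)) q1 q2 f3"
      using normal_form.C12[of \<zeta>] unfolding C12 swap by simp
    then show ?thesis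
      by (intro conj[of "\<zeta>' 12 ^ 8" "\<zeta>' 12 ^ 4" "\<zeta>' 12" "\<zeta> 12 ^ 8" "\<zeta> 12 ^ 4" "\<zeta> 12" k])
        (simp_all only: C12(1) swap k pow power_one nz power_not_zero zero_less_numeral
          not_False_eq_True)
  qed
qed

text \<open>The same coordinates serve both generators, and each generator is a power of the
  other.\<close>

lemma has_normal_form_conjugate:
  fixes \<zeta> \<zeta>' :: "nat \<Rightarrow> 'k::field_char_0"
  assumes "has_normal_form \<zeta>' F g"
    and \<zeta>: "\<forall>n>0. primitive_root_of_unity n (\<zeta> n)" and \<zeta>': "\<forall>n>0. primitive_root_of_unity n (\<zeta>' n)"
  shows "\<exists>g'. generate PGL5 {g} = generate PGL5 {g'} \<and> has_normal_form \<zeta> F g'"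
proof -
  obtain P \<iota> q1 q2 f3 d where P: "invertible P" and nf: "normal_form \<zeta>' \<iota> q1 q2 f3" and d: "d \<noteq> 0"
    "\<forall>y. eval F (P *v y) = d * eval (Var 1 * Var 2 * Var 3 + Var 1 * q1 + Var 2 * q2 + f3) y"
    and g: "g = proj_class (P ** matrix \<iota> ** matrix_inv P)"
    using assms(1) unfolding has_normal_form_def by blast
  obtain a b c k where abc: "a \<noteq> 0" "b \<noteq> 0" "c \<noteq> 0" "\<iota> = monomial_swap a b c"
    and nf': "normal_form \<zeta> (\<iota> ^^ Suc (2 * k)) q1 q2 f3" and returns: "(\<iota> ^^ Suc (2 * k)) ^^ Suc (2 * k) = \<iota>"
    using normal_form_conjugate[OF nf \<zeta> \<zeta>'] by blast
  define \<kappa> where "\<kappa> = \<iota> ^^ Suc (2 * k)"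
  have \<kappa>: "\<kappa> = monomial_swap (a ^ Suc (2 * k)) (b ^ Suc (2 * k)) (c ^ Suc (2 * k))"
    unfolding \<kappa>_def abc(4) by (rule monomial_swap_odd_power)
  have M: "(\<lambda>x. matrix \<iota> *v x) = \<iota>" "(\<lambda>x. matrix \<kappa> *v x) = \<kappa>"
    unfolding abc(4) \<kappa> by (simp_all only: matrix_monomial_swap)
  have inv: "invertible (matrix \<iota>)" "invertible (matrix \<kappa>)"
    unfolding abc(4) \<kappa> using abc(1-3) by (intro invertible_monomial_swap; simp)+
  define g' where "g' = proj_class (P ** matrix \<kappa> ** matrix_inv P)"
  have carrier: "{g} \<subseteq> carrier PGL5" "{g'} \<subseteq> carrier PGL5"
    unfolding g g'_def carrier_PGL5 using P inv by (auto simp: invertible_mult invertible_matrix_inv)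
  have "g' \<in> generate PGL5 {g}"
    unfolding g g'_def
    by (rule generate_conjugate_power[OF P inv(1), of _ "Suc (2 * k)"])
      (simp only: M \<kappa>_def[symmetric] fun_cong[OF M(2)])
  moreover have "g \<in> generate PGL5 {g'}"
    unfolding g g'_def
    by (rule generate_conjugate_power[OF P inv(2), of _ "Suc (2 * k)"])
      (simp only: M returns[folded \<kappa>_def] fun_cong[OF M(1)])
  ultimately have "generate PGL5 {g} = generate PGL5 {g'}"
    by (intro equalityI group.generate_subgroup_incl[OF group_PGL5] group.generate_is_subgroup[OF group_PGL5] carrier)
      auto
  moreover have "has_normal_form \<zeta> F g'"
    unfolding has_normal_form_def g'_def using P nf'[folded \<kappa>_def] d by blast
  ultimately show ?thesis
    by blast
qed

theorem proposition3p2: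
  fixes \<zeta> :: "nat \<Rightarrow> 'k::{alg_closed_field, field_char_0}"
    and F :: "'k poly5"
    and G :: "('k^5^5) set set"
    and g :: "('k^5^5) set"
  assumes "\<forall>n>0. primitive_root_of_unity n (\<zeta> n)"
    and "F \<noteq> 0" and "is_form 3 F"
    and "card (sing_locus F) = 2" and "\<forall>p\<in>sing_locus F. is_node F p"
    and "g \<in> Aut F" and "G = generate PGL5 {g}"
    and "\<forall>p\<in>sing_locus F. \<not> (\<forall>h\<in>G. act h p = p)"
  shows "(\<exists>g'. G = generate PGL5 {g'} \<and> has_normal_form \<zeta> F g') \<and>
    (\<exists>\<zeta>'. (\<forall>n>0. primitive_root_of_unity n (\<zeta>' n)) \<and> has_normal_form \<zeta>' F g)"
proof -
  obtain T p q A \<alpha> where T: "sym_trilinear T" "\<And>v. eval F v = T v v v" and nodes: "sym_trilinear.nodes T p q"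
    and A: "g = proj_class A" "\<alpha> \<noteq> 0" "A *v p = \<alpha> *s q" "A *v q = \<alpha> *s p"
    "\<And>u v w. T (A *v u) (A *v v) (A *v w) = \<alpha>\<^sup>2 * T u v w"
    using swapped_nodes[OF assms(3-6) assms(8)[unfolded assms(7)]] by metis
  interpret swapped_nodes T p q A \<alpha>
    using T(1) nodes A by (simp add: swapped_nodes_def swapped_nodes_axioms_def)
  interpret cubic: swapped_cubic T F A g \<zeta>
    using T A(1) assms(1) by (simp add: swapped_cubic_def swapped_cubic_axioms_def)
  obtain r e f \<mu> \<nu> where "frame A \<alpha> \<mu> \<nu> p q r e f"
    by (rule frame_exists)
  then have "cubic.recognized"
    by (rule cubic.frame_recognized)
  then obtain \<zeta>' where \<zeta>': "\<forall>n>0. primitive_root_of_unity n (\<zeta>' n)" "has_normal_form \<zeta>' F g"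
    unfolding cubic.recognized_def by blast
  \<comment> \<open>The classification gives the second part; the first replaces the generator
    instead of the roots of unity.\<close>
  then show ?thesis
    using has_normal_form_conjugate[OF \<zeta>'(2) assms(1) \<zeta>'(1)] assms(7) by blast
qed

end
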